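(* Let $(\mathcal{U},\mathcal{V})$ and $(\mathcal{X},\mathcal{Y})$ be two cotorsion pairs in $R\text{-Mod}$ with $\mathcal{U}\subseteq\mathcal{X}$ (equivalently, $\mathcal{Y}\subseteq\mathcal{V}$). Then $({}^{\perp}(\widetilde{\mathcal{Y}}_{\mathcal{V}}),\widetilde{\mathcal{Y}}_{\mathcal{V}})$ is a cotorsion pair in $\mathrm{Ch}(R)$, and ${}^{\perp}(\widetilde{\mathcal{Y}}_{\mathcal{V}})$ is the class of all chain complexes $X$ such that $X_n\in\mathcal{X}$ for every $n\in\mathbb{Z}$ and such that every chain map $X\to Y$ with $Y\in\widetilde{\mathcal{Y}}_{\mathcal{V}}$ is null homotopic.
   Context: $R$ is an associative ring with $1$, $R\text{-Mod}$ is the category of left $R$-modules, and $\mathrm{Ch}(R)$ is the category of ($\mathbb{Z}$-indexed, unbounded) chain complexes $\cdots\to C_{n+1}\xrightarrow{\delta_{n+1}}C_n\xrightarrow{\delta_n}C_{n-1}\to\cdots$ of left $R$-modules. The $n$th cycle module of $C$ is $Z_nC=\mathrm{Ker}(\delta_n)$. A complex is exact if all its homology modules vanish. For a class $\mathcal{A}$ of objects in an abelian category $\mathcal{C}$, put $\mathcal{A}^{\perp}=\{X : \mathrm{Ext}^1_{\mathcal{C}}(A,X)=0 \text{ for all } A\in\mathcal{A}\}$ and ${}^{\perp}\mathcal{A}=\{X : \mathrm{Ext}^1_{\mathcal{C}}(X,A)=0\text{ for all }A\in\mathcal{A}\}$, where $\mathrm{Ext}^1_{\mathcal{C}}$ is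 the Yoneda group of (equivalence classes of) short exact sequences. A pair $(\mathcal{A},\mathcal{B})$ of classes of objects of $\mathcal{C}$ is a cotorsion pair if $\mathcal{A}={}^{\perp}\mathcal{B}$ and $\mathcal{B}=\mathcal{A}^{\perp}$. For classes $\mathcal{Y}\subseteq\mathcal{V}$ of $R$-modules, $\widetilde{\mathcal{Y}}_{\mathcal{V}}$ denotes the class of all exact chain complexes $Y$ in $\mathrm{Ch}(R)$ with $Y_n\in\mathcal{Y}$ and $Z_nY\in\mathcal{V}$ for every $n\in\mathbb{Z}$. *)

theory Defs
  imports "HOL-Algebra.Module" "HOL-Algebra.AbelCoset" "HOL-Algebra.Elementary_Groups" "HOL-Library.Equipollence"
begin

section \<open>Left modules\<close>

text \<open>The library locale for modules requires a commutative ring of scalars. We keep its record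
  type but allow an arbitrary associative ring with one. As in the library, the multiplicative part
  of the module record is irrelevant.\<close>

locale left_module = R?: ring R + M?: abelian_group M
  for R :: "('r, 'e) ring_scheme" (structure) and M :: "('r, 'm, 'f) module_scheme" (structure) +
  assumes smult_closed [simp, intro]:
      "\<lbrakk>a \<in> carrier R; x \<in> carrier M\<rbrakk> \<Longrightarrow> a \<odot>\<^bsub>M\<^esub> x \<in> carrier M"
    and smult_l_distr:
      "\<lbrakk>a \<in> carrier R; b \<in> carrier R; x \<in> carrier M\<rbrakk> \<Longrightarrow>
        (a \<oplus>\<^bsub>R\<^esub> b) \<odot>\<^bsub>M\<^esub> x = a \<odot>\<^bsub>M\<^esub> x \<oplus>\<^bsub>M\<^esub> b \<odot>\<^bsub>M\<^esub> x"
    and smult_r_distr: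
      "\<lbrakk>a \<in> carrier R; x \<in> carrier M; y \<in> carrier M\<rbrakk> \<Longrightarrow>
        a \<odot>\<^bsub>M\<^esub> (x \<oplus>\<^bsub>M\<^esub> y) = a \<odot>\<^bsub>M\<^esub> x \<oplus>\<^bsub>M\<^esub> a \<odot>\<^bsub>M\<^esub> y"
    and smult_assoc1:
      "\<lbrakk>a \<in> carrier R; b \<in> carrier R; x \<in> carrier M\<rbrakk> \<Longrightarrow>
        (a \<otimes>\<^bsub>R\<^esub> b) \<odot>\<^bsub>M\<^esub> x = a \<odot>\<^bsub>M\<^esub> (b \<odot>\<^bsub>M\<^esub> x)"
    and smult_one [simp]:
      "x \<in> carrier M \<Longrightarrow> \<one>\<^bsub>R\<^esub> \<odot>\<^bsub>M\<^esub> x = x"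

text \<open>Maps are only relevant on the carrier of their source; two maps that agree there
  represent the same morphism.\<close>

definition lin_hom ::
  "('r, 'e) ring_scheme \<Rightarrow> ('r, 'a) module \<Rightarrow> ('r, 'b) module \<Rightarrow> ('a \<Rightarrow> 'b) set" where
  "lin_hom R M N = {f \<in> hom (add_monoid M) (add_monoid N).
     \<forall>a \<in> carrier R. \<forall>x \<in> carrier M. f (a \<odot>\<^bsub>M\<^esub> x) = a \<odot>\<^bsub>N\<^esub> f x}"

text \<open>A type cannot range over all modules, so the category of modules is taken relative to
  a collection \<open>S\<close> of small subsets of a type. The conditions hold in particular if \<open>S\<close> consists of
  the sets that are small with respect to a Grothendieck universe containing the ring and an
  infinite set, and also if \<open>S\<close> consists of all subsets of an infinite type into which the ring
  embeds.\<close>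

definition module_universe :: "('r, 'e) ring_scheme \<Rightarrow> 'm set set \<Rightarrow> bool" where
  "module_universe R S \<longleftrightarrow>
     (\<forall>A \<in> S. \<forall>B :: 'm set. lepoll B A \<longrightarrow> B \<in> S) \<and>
     (\<exists>A \<in> S. infinite A) \<and>
     (\<exists>A \<in> S. lepoll (carrier R) A)"

definition RMod :: "('r, 'e) ring_scheme \<Rightarrow> 'm set set \<Rightarrow> ('r, 'm) module set" where
  "RMod R S = {M. left_module R M \<and> carrier M \<in> S}"


section \<open>Chain complexes\<close>

record ('r, 'm) chain_complex =
  obj :: "int \<Rightarrow> ('r, 'm) module"
  bd :: "int \<Rightarrow> 'm \<Rightarrow> 'm"

definition Ch :: "('r, 'e) ring_scheme \<Rightarrow> 'm set set \<Rightarrow> ('r, 'm) chain_complex set" where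
  "Ch R S = {C. (\<forall>n. obj C n \<in> RMod R S) \<and>
     (\<forall>n. bd C n \<in> lin_hom R (obj C n) (obj C (n - 1))) \<and>
     (\<forall>n. \<forall>x \<in> carrier (obj C (n + 1)). bd C n (bd C (n + 1) x) = \<zero>\<^bsub>obj C (n - 1)\<^esub>)}"

definition chain_map ::
  "('r, 'e) ring_scheme \<Rightarrow> ('r, 'a) chain_complex \<Rightarrow> ('r, 'b) chain_complex
     \<Rightarrow> (int \<Rightarrow> 'a \<Rightarrow> 'b) set" where
  "chain_map R C D = {f. (\<forall>n. f n \<in> lin_hom R (obj C n) (obj D n)) \<and>
     (\<forall>n. \<forall>x \<in> carrier (obj C n). bd D n (f n x) = f (n - 1) (bd C n x))}"

definition null_homotopic ::
  "('r, 'e) ring_scheme \<Rightarrow> ('r, 'a) chain_complex \<Rightarrow> ('r, 'b) chain_complex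
     \<Rightarrow> (int \<Rightarrow> 'a \<Rightarrow> 'b) \<Rightarrow> bool" where
  "null_homotopic R C D f \<longleftrightarrow>
     (\<exists>s. (\<forall>n. s n \<in> lin_hom R (obj C n) (obj D (n + 1))) \<and>
       (\<forall>n. \<forall>x \<in> carrier (obj C n).
          f n x = bd D (n + 1) (s n x) \<oplus>\<^bsub>obj D n\<^esub> s (n - 1) (bd C n x)))"

definition cycle_module :: "('r, 'm) chain_complex \<Rightarrow> int \<Rightarrow> ('r, 'm) module" where
  "cycle_module C n = (obj C n)\<lparr>carrier := a_kernel (obj C n) (obj C (n - 1)) (bd C n)\<rparr>"

definition boundaries :: "('r, 'm) chain_complex \<Rightarrow> int \<Rightarrow> 'm set" where
  "boundaries C n = bd C (n + 1) ` carrier (obj C (n + 1))"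

text \<open>The underlying additive group of the homology module, written multiplicatively by the
  library; it suffices to express that homology vanishes.\<close>

definition homology_group :: "('r, 'm) chain_complex \<Rightarrow> int \<Rightarrow> 'm set monoid" where
  "homology_group C n = cycle_module C n A_Mod boundaries C n"

definition exact_complex :: "('r, 'm) chain_complex \<Rightarrow> bool" where
  "exact_complex C \<longleftrightarrow> (\<forall>n. trivial_group (homology_group C n))"


section \<open>Yoneda extensions\<close>

definition short_exact ::
  "('r, 'e) ring_scheme \<Rightarrow> ('r, 'a) module \<Rightarrow> ('a \<Rightarrow> 'b) \<Rightarrow> ('r, 'b) module
     \<Rightarrow> ('b \<Rightarrow> 'c) \<Rightarrow> ('r, 'c) module \<Rightarrow> bool" where
  "short_exact R B i E p A \<longleftrightarrow> i \<in> lin_hom R B E \<and> p \<in> lin_hom R E A \<and>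
     inj_on i (carrier B) \<and> i ` carrier B = a_kernel E A p \<and> p ` carrier E = carrier A"

type_synonym ('r, 'm) mod_ext = "('m \<Rightarrow> 'm) \<times> ('r, 'm) module \<times> ('m \<Rightarrow> 'm)"

definition mod_exts ::
  "('r, 'e) ring_scheme \<Rightarrow> 'm set set \<Rightarrow> ('r, 'm) module \<Rightarrow> ('r, 'm) module
     \<Rightarrow> ('r, 'm) mod_ext set" where
  "mod_exts R S A B = {(i, E, p). E \<in> RMod R S \<and> short_exact R B i E p A}"

definition mod_ext_equiv ::
  "('r, 'e) ring_scheme \<Rightarrow> 'm set set \<Rightarrow> ('r, 'm) module \<Rightarrow> ('r, 'm) module
     \<Rightarrow> (('r, 'm) mod_ext \<times> ('r, 'm) mod_ext) set" where
  "mod_ext_equiv R S A B = {((i, E, p), (i', E', p')).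
     (i, E, p) \<in> mod_exts R S A B \<and> (i', E', p') \<in> mod_exts R S A B \<and>
     (\<exists>f \<in> lin_hom R E E'. bij_betw f (carrier E) (carrier E') \<and>
        (\<forall>x \<in> carrier B. f (i x) = i' x) \<and> (\<forall>e \<in> carrier E. p' (f e) = p e))}"

text \<open>The underlying set of the Yoneda group \<open>Ext\<^sup>1(A, B)\<close>. Short exact sequences are
  \<open>0 \<rightarrow> B \<rightarrow> E \<rightarrow> A \<rightarrow> 0\<close>. The Baer sum is not defined here, as the group vanishes
  iff its underlying set has exactly one element.\<close>

definition Ext1_Mod ::
  "('r, 'e) ring_scheme \<Rightarrow> 'm set set \<Rightarrow> ('r, 'm) module \<Rightarrow> ('r, 'm) module
     \<Rightarrow> ('r, 'm) mod_ext set set" where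
  "Ext1_Mod R S A B = mod_exts R S A B // mod_ext_equiv R S A B"

type_synonym ('r, 'm) ch_ext =
  "(int \<Rightarrow> 'm \<Rightarrow> 'm) \<times> ('r, 'm) chain_complex \<times> (int \<Rightarrow> 'm \<Rightarrow> 'm)"

text \<open>A sequence of chain complexes is short exact iff it is so in each degree.\<close>

definition ch_exts ::
  "('r, 'e) ring_scheme \<Rightarrow> 'm set set \<Rightarrow> ('r, 'm) chain_complex \<Rightarrow> ('r, 'm) chain_complex
     \<Rightarrow> ('r, 'm) ch_ext set" where
  "ch_exts R S A B = {(i, E, p). E \<in> Ch R S \<and> i \<in> chain_map R B E \<and> p \<in> chain_map R E A \<and>
     (\<forall>n. short_exact R (obj B n) (i n) (obj E n) (p n) (obj A n))}"

definition ch_ext_equiv ::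
  "('r, 'e) ring_scheme \<Rightarrow> 'm set set \<Rightarrow> ('r, 'm) chain_complex \<Rightarrow> ('r, 'm) chain_complex
     \<Rightarrow> (('r, 'm) ch_ext \<times> ('r, 'm) ch_ext) set" where
  "ch_ext_equiv R S A B = {((i, E, p), (i', E', p')).
     (i, E, p) \<in> ch_exts R S A B \<and> (i', E', p') \<in> ch_exts R S A B \<and>
     (\<exists>f \<in> chain_map R E E'. \<forall>n. bij_betw (f n) (carrier (obj E n)) (carrier (obj E' n)) \<and>
        (\<forall>x \<in> carrier (obj B n). f n (i n x) = i' n x) \<and>
        (\<forall>e \<in> carrier (obj E n). p' n (f n e) = p n e))}"

definition Ext1_Ch ::
  "('r, 'e) ring_scheme \<Rightarrow> 'm set set \<Rightarrow> ('r, 'm) chain_complex \<Rightarrow> ('r, 'm) chain_complex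
     \<Rightarrow> ('r, 'm) ch_ext set set" where
  "Ext1_Ch R S A B = ch_exts R S A B // ch_ext_equiv R S A B"


section \<open>Cotorsion pairs\<close>

text \<open>These notions are parametrised by the class \<open>Ob\<close> of objects of the abelian category and
  by its \<open>Ext\<close>, so that they apply to both modules and chain complexes.\<close>

definition right_perp :: "'o set \<Rightarrow> ('o \<Rightarrow> 'o \<Rightarrow> 'x set) \<Rightarrow> 'o set \<Rightarrow> 'o set" where
  "right_perp Ob Ext \<A> = {B \<in> Ob. \<forall>A \<in> \<A>. is_singleton (Ext A B)}"

definition left_perp :: "'o set \<Rightarrow> ('o \<Rightarrow> 'o \<Rightarrow> 'x set) \<Rightarrow> 'o set \<Rightarrow> 'o set" where
  "left_perp Ob Ext \<A> = {B \<in> Ob. \<forall>A \<in> \<A>. is_singleton (Ext B A)}"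

definition cotorsion_pair ::
  "'o set \<Rightarrow> ('o \<Rightarrow> 'o \<Rightarrow> 'x set) \<Rightarrow> 'o set \<Rightarrow> 'o set \<Rightarrow> bool" where
  "cotorsion_pair Ob Ext \<A> \<B> \<longleftrightarrow> \<A> \<subseteq> Ob \<and> \<B> \<subseteq> Ob \<and>
     \<A> = left_perp Ob Ext \<B> \<and> \<B> = right_perp Ob Ext \<A>"

lemma cotorsion_pair_subset_iff:
  assumes "cotorsion_pair Ob Ext \<U> \<V>" and "cotorsion_pair Ob Ext \<X> \<Y>"
  shows "\<U> \<subseteq> \<X> \<longleftrightarrow> \<Y> \<subseteq> \<V>"
proof -
  have anti: "left_perp Ob Ext \<Q> \<subseteq> left_perp Ob Ext \<P>" "right_perp Ob Ext \<Q> \<subseteq> right_perp Ob Ext \<P>"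
    if "\<P> \<subseteq> \<Q>" for \<P> \<Q>
    using that by (auto simp: left_perp_def right_perp_def)
  show ?thesis
    using assms anti[of \<U> \<X>] anti[of \<Y> \<V>] unfolding cotorsion_pair_def by metis
qed

definition exact_tilde ::
  "('r, 'e) ring_scheme \<Rightarrow> 'm set set \<Rightarrow> ('r, 'm) module set \<Rightarrow> ('r, 'm) module set
     \<Rightarrow> ('r, 'm) chain_complex set" where
  "exact_tilde R S \<Y> \<V> = {Y \<in> Ch R S. exact_complex Y \<and>
     (\<forall>n. obj Y n \<in> \<Y> \<and> cycle_module Y n \<in> \<V>)}"

end

theory Submission
  imports Defs
begin

text \<open>An \<open>Ext\<close> group vanishes iff every extension splits, so its vanishing lets chain maps be
  extended along (by a pushout), or lifted through (by a pullback), any short exact sequence of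
  complexes. Write \<open>\<A>\<close> for the left orthogonal of \<open>\<Y>~\<^sub>\<V>\<close>. It contains the disks on modules
  of \<open>\<X>\<close>, as \<open>Y\<^sub>n \<in> \<Y>\<close>, and the spheres on modules of \<open>\<U>\<close>, as \<open>Y\<close> is exact with
  \<open>Z\<^sub>nY \<in> \<V>\<close>. Conversely, let \<open>B\<close> be right orthogonal to \<open>\<A>\<close>. Pushing extensions of disks
  and of spheres forward along the canonical maps from the disk on \<open>B\<^sub>n\<close> and the sphere on \<open>Z\<^sub>nB\<close>
  to \<open>B\<close> gives \<open>B\<^sub>n \<in> \<Y>\<close> and \<open>Z\<^sub>nB \<in> \<V>\<close>, and the spheres on \<open>R\<close> give exactness.

  The disks on modules of \<open>\<Y>\<close> lie in \<open>\<Y>~\<^sub>\<V>\<close> because \<open>\<Y> \<subseteq> \<V>\<close>, which puts the terms of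
  complexes in \<open>\<A>\<close> into \<open>\<X>\<close>. Extensions of \<open>A\<close> by \<open>Y\<close> that split in each degree are twisted
  sums, given by chain maps from \<open>A\<close> to a shift of \<open>Y\<close>, and they split iff these are null homotopic.\<close>

section \<open>Linear maps\<close>

text \<open>Size and type are the obstacle. Ext ranges over middle terms on the type
  \<open>'m\<close> with carriers in \<open>S\<close>, whereas direct sums, pullbacks, pushouts and
  twisted sums live on product types and on sets of cosets. They are therefore built in
  \<open>Ch R UNIV\<close>, which imposes no size bound and allows any type. An extension of small
  by small is small whatever type carries it, since a choice of preimages injects its carrier into
  the product of the outer carriers. It thus has an isomorphic copy in \<open>Ch R S\<close>, which
  vanishing of Ext splits, and the section is carried back. The infinite member of \<open>S\<close>
  gives closure under products; the member into which the ring embeds gives a copy of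
  \<open>R\<close> as a module. The classes are sets of records, not of isomorphism types. Hence
  zero modules are always the zero submodule of a module at hand, and each of them has to be shown
  orthogonal.\<close>

lemma left_module_ring: "left_module R M \<Longrightarrow> ring R"
  by (rule left_module.axioms(1))

lemma left_module_group: "left_module R M \<Longrightarrow> abelian_group M"
  by (rule left_module.axioms(2))

lemma lin_homI:
  assumes "\<And>x. x \<in> carrier M \<Longrightarrow> f x \<in> carrier N"
    and "\<And>x y. \<lbrakk>x \<in> carrier M; y \<in> carrier M\<rbrakk> \<Longrightarrow> f (x \<oplus>\<^bsub>M\<^esub> y) = f x \<oplus>\<^bsub>N\<^esub> f y"
    and "\<And>a x. \<lbrakk>a \<in> carrier R; x \<in> carrier M\<rbrakk> \<Longrightarrow> f (a \<odot>\<^bsub>M\<^esub> x) = a \<odot>\<^bsub>N\<^esub> f x"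
  shows "f \<in> lin_hom R M N"
  using assms by (auto simp: lin_hom_def hom_def)

lemma lin_hom_closed: "\<lbrakk>f \<in> lin_hom R M N; x \<in> carrier M\<rbrakk> \<Longrightarrow> f x \<in> carrier N"
  by (auto simp: lin_hom_def hom_def)

lemma lin_hom_add:
  "\<lbrakk>f \<in> lin_hom R M N; x \<in> carrier M; y \<in> carrier M\<rbrakk> \<Longrightarrow> f (x \<oplus>\<^bsub>M\<^esub> y) = f x \<oplus>\<^bsub>N\<^esub> f y"
  by (auto simp: lin_hom_def hom_def)

lemma lin_hom_smult:
  "\<lbrakk>f \<in> lin_hom R M N; a \<in> carrier R; x \<in> carrier M\<rbrakk> \<Longrightarrow> f (a \<odot>\<^bsub>M\<^esub> x) = a \<odot>\<^bsub>N\<^esub> f x"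
  by (auto simp: lin_hom_def)

lemma lin_hom_zero:
  assumes "f \<in> lin_hom R M N" "abelian_group M" "abelian_group N"
  shows "f \<zero>\<^bsub>M\<^esub> = \<zero>\<^bsub>N\<^esub>"
proof -
  interpret M: abelian_group M by fact
  interpret N: abelian_group N by fact
  show ?thesis
    using lin_hom_add[OF assms(1), of "\<zero>\<^bsub>M\<^esub>" "\<zero>\<^bsub>M\<^esub>"] lin_hom_closed[OF assms(1), of "\<zero>\<^bsub>M\<^esub>"]
    by (simp add: M.zero_closed)
qed

lemma lin_hom_minus:
  assumes "f \<in> lin_hom R M N" "abelian_group M" "abelian_group N" "x \<in> carrier M"
  shows "f (\<ominus>\<^bsub>M\<^esub> x) = \<ominus>\<^bsub>N\<^esub> f x"
proof -
  interpret M: abelian_group M by fact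
  interpret N: abelian_group N by fact
  have "f (\<ominus>\<^bsub>M\<^esub> x) \<oplus>\<^bsub>N\<^esub> f x = \<zero>\<^bsub>N\<^esub>"
    using lin_hom_add[OF assms(1), of "\<ominus>\<^bsub>M\<^esub> x" x] assms lin_hom_zero[OF assms(1-3)]
    by (simp add: M.l_neg)
  then show ?thesis
    using N.minus_equality assms lin_hom_closed[OF assms(1)] by simp
qed

lemma lin_hom_diff:
  assumes "f \<in> lin_hom R M N" "abelian_group M" "abelian_group N" "x \<in> carrier M" "y \<in> carrier M"
  shows "f (x \<ominus>\<^bsub>M\<^esub> y) = f x \<ominus>\<^bsub>N\<^esub> f y"
proof -
  interpret M: abelian_group M by fact
  show ?thesis
    using assms by (simp add: a_minus_def lin_hom_add[OF assms(1)] lin_hom_minus[OF assms(1-3)])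
qed

lemma lin_hom_id: "(\<lambda>x. x) \<in> lin_hom R M M"
  by (intro lin_homI) auto

lemma lin_hom_comp:
  "\<lbrakk>f \<in> lin_hom R M N; g \<in> lin_hom R N P\<rbrakk> \<Longrightarrow> (\<lambda>x. g (f x)) \<in> lin_hom R M P"
  by (intro lin_homI) (simp_all add: lin_hom_closed lin_hom_add lin_hom_smult)

lemma smult_zero:
  assumes "left_module R M" "a \<in> carrier R"
  shows "a \<odot>\<^bsub>M\<^esub> \<zero>\<^bsub>M\<^esub> = \<zero>\<^bsub>M\<^esub>"
proof -
  interpret M: abelian_group M using assms(1) by (rule left_module_group)
  show ?thesis
    using left_module.smult_r_distr[OF assms, of "\<zero>\<^bsub>M\<^esub>" "\<zero>\<^bsub>M\<^esub>"] left_module.smult_closed[OF assms, of "\<zero>\<^bsub>M\<^esub>"]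
    by simp
qed

lemma zero_smult:
  assumes "left_module R M" "x \<in> carrier M"
  shows "\<zero>\<^bsub>R\<^esub> \<odot>\<^bsub>M\<^esub> x = \<zero>\<^bsub>M\<^esub>"
proof -
  interpret M: abelian_group M using assms(1) by (rule left_module_group)
  interpret R: ring R using assms(1) by (rule left_module_ring)
  show ?thesis
    using left_module.smult_l_distr[OF assms(1) _ _ assms(2), of "\<zero>\<^bsub>R\<^esub>" "\<zero>\<^bsub>R\<^esub>"]
      left_module.smult_closed[OF assms(1) _ assms(2), of "\<zero>\<^bsub>R\<^esub>"]
    by simp
qed

text \<open>Negation is a scalar multiplication, so a subset closed under scalars is closed under
  negatives. \<open>submodule\<close> and \<open>quotient_module_exists\<close> obtain inverses in
  this way.\<close>

lemma neg_one_smult: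
  assumes "left_module R M" "x \<in> carrier M"
  shows "(\<ominus>\<^bsub>R\<^esub> \<one>\<^bsub>R\<^esub>) \<odot>\<^bsub>M\<^esub> x = \<ominus>\<^bsub>M\<^esub> x"
proof -
  interpret M: abelian_group M using assms(1) by (rule left_module_group)
  interpret R: ring R using assms(1) by (rule left_module_ring)
  have "(\<ominus>\<^bsub>R\<^esub> \<one>\<^bsub>R\<^esub>) \<odot>\<^bsub>M\<^esub> x \<oplus>\<^bsub>M\<^esub> \<one>\<^bsub>R\<^esub> \<odot>\<^bsub>M\<^esub> x = \<zero>\<^bsub>M\<^esub>"
    using left_module.smult_l_distr[OF assms(1) _ _ assms(2), of "\<ominus>\<^bsub>R\<^esub> \<one>\<^bsub>R\<^esub>" "\<one>\<^bsub>R\<^esub>"] zero_smult[OF assms]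
    by (simp add: R.l_neg)
  then show ?thesis
    using M.minus_equality assms by (simp add: left_module.smult_one left_module.smult_closed)
qed

lemma smult_minus:
  assumes "left_module R M" "a \<in> carrier R" "x \<in> carrier M"
  shows "a \<odot>\<^bsub>M\<^esub> (\<ominus>\<^bsub>M\<^esub> x) = \<ominus>\<^bsub>M\<^esub> (a \<odot>\<^bsub>M\<^esub> x)"
proof -
  interpret M: abelian_group M using assms(1) by (rule left_module_group)
  have "a \<odot>\<^bsub>M\<^esub> (\<ominus>\<^bsub>M\<^esub> x) \<oplus>\<^bsub>M\<^esub> a \<odot>\<^bsub>M\<^esub> x = \<zero>\<^bsub>M\<^esub>"
    using left_module.smult_r_distr[OF assms(1,2), of "\<ominus>\<^bsub>M\<^esub> x" x] assms smult_zero[OF assms(1,2)]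
    by (simp add: M.l_neg)
  then show ?thesis
    using M.minus_equality assms by (simp add: left_module.smult_closed)
qed

lemma lin_hom_const_zero:
  assumes "left_module R N"
  shows "(\<lambda>x. \<zero>\<^bsub>N\<^esub>) \<in> lin_hom R M N"
proof -
  interpret N: abelian_group N using assms by (rule left_module_group)
  show ?thesis by (intro lin_homI) (simp_all add: smult_zero[OF assms])
qed

lemma lin_hom_sum:
  assumes "left_module R N" "f \<in> lin_hom R M N" "g \<in> lin_hom R M N"
  shows "(\<lambda>x. f x \<oplus>\<^bsub>N\<^esub> g x) \<in> lin_hom R M N"
proof -
  interpret N: abelian_group N using assms(1) by (rule left_module_group)
  show ?thesis
    using assms
    by (intro lin_homI)
      (simp_all add: lin_hom_closed lin_hom_add lin_hom_smult left_module.smult_r_distr N.a_ac)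
qed

lemma lin_hom_neg:
  assumes "left_module R N" "f \<in> lin_hom R M N"
  shows "(\<lambda>x. \<ominus>\<^bsub>N\<^esub> f x) \<in> lin_hom R M N"
proof -
  interpret N: abelian_group N using assms(1) by (rule left_module_group)
  show ?thesis
    using assms
    by (intro lin_homI) (simp_all add: lin_hom_closed lin_hom_add lin_hom_smult smult_minus N.minus_add)
qed

lemma a_kernel_iff: "x \<in> a_kernel M N f \<longleftrightarrow> x \<in> carrier M \<and> f x = \<zero>\<^bsub>N\<^esub>"
  by (simp add: a_kernel_def')

lemma left_moduleI:
  fixes M :: "('r, 'm, 'f) module_scheme"
  assumes "ring R"
    and "\<And>x y. \<lbrakk>x \<in> carrier M; y \<in> carrier M\<rbrakk> \<Longrightarrow> x \<oplus>\<^bsub>M\<^esub> y \<in> carrier M"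
    and "\<zero>\<^bsub>M\<^esub> \<in> carrier M"
    and "\<And>x y z. \<lbrakk>x \<in> carrier M; y \<in> carrier M; z \<in> carrier M\<rbrakk> \<Longrightarrow> (x \<oplus>\<^bsub>M\<^esub> y) \<oplus>\<^bsub>M\<^esub> z = x \<oplus>\<^bsub>M\<^esub> (y \<oplus>\<^bsub>M\<^esub> z)"
    and "\<And>x y. \<lbrakk>x \<in> carrier M; y \<in> carrier M\<rbrakk> \<Longrightarrow> x \<oplus>\<^bsub>M\<^esub> y = y \<oplus>\<^bsub>M\<^esub> x"
    and "\<And>x. x \<in> carrier M \<Longrightarrow> \<zero>\<^bsub>M\<^esub> \<oplus>\<^bsub>M\<^esub> x = x"
    and "\<And>x. x \<in> carrier M \<Longrightarrow> \<exists>y \<in> carrier M. y \<oplus>\<^bsub>M\<^esub> x = \<zero>\<^bsub>M\<^esub>"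
    and "\<And>a x. \<lbrakk>a \<in> carrier R; x \<in> carrier M\<rbrakk> \<Longrightarrow> a \<odot>\<^bsub>M\<^esub> x \<in> carrier M"
    and "\<And>a b x. \<lbrakk>a \<in> carrier R; b \<in> carrier R; x \<in> carrier M\<rbrakk> \<Longrightarrow>
        (a \<oplus>\<^bsub>R\<^esub> b) \<odot>\<^bsub>M\<^esub> x = a \<odot>\<^bsub>M\<^esub> x \<oplus>\<^bsub>M\<^esub> b \<odot>\<^bsub>M\<^esub> x"
    and "\<And>a x y. \<lbrakk>a \<in> carrier R; x \<in> carrier M; y \<in> carrier M\<rbrakk> \<Longrightarrow>
        a \<odot>\<^bsub>M\<^esub> (x \<oplus>\<^bsub>M\<^esub> y) = a \<odot>\<^bsub>M\<^esub> x \<oplus>\<^bsub>M\<^esub> a \<odot>\<^bsub>M\<^esub> y"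
    and "\<And>a b x. \<lbrakk>a \<in> carrier R; b \<in> carrier R; x \<in> carrier M\<rbrakk> \<Longrightarrow>
        (a \<otimes>\<^bsub>R\<^esub> b) \<odot>\<^bsub>M\<^esub> x = a \<odot>\<^bsub>M\<^esub> (b \<odot>\<^bsub>M\<^esub> x)"
    and "\<And>x. x \<in> carrier M \<Longrightarrow> \<one>\<^bsub>R\<^esub> \<odot>\<^bsub>M\<^esub> x = x"
  shows "left_module R M"
  by (intro left_module.intro left_module_axioms.intro abelian_groupI) (fact assms)+

section \<open>Constructions of modules\<close>

text \<open>The module axioms are identities, apart from the existence of negatives, so all of them
  pass along a surjection compatible with the operations.\<close>

lemma surjective_image_module:
  assumes M: "left_module R M" and N: "carrier N = q ` carrier M" "\<zero>\<^bsub>N\<^esub> = q \<zero>\<^bsub>M\<^esub>"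
    and add: "\<And>x y. \<lbrakk>x \<in> carrier M; y \<in> carrier M\<rbrakk> \<Longrightarrow> q x \<oplus>\<^bsub>N\<^esub> q y = q (x \<oplus>\<^bsub>M\<^esub> y)"
    and smult: "\<And>a x. \<lbrakk>a \<in> carrier R; x \<in> carrier M\<rbrakk> \<Longrightarrow> a \<odot>\<^bsub>N\<^esub> q x = q (a \<odot>\<^bsub>M\<^esub> x)"
  shows "left_module R N"
proof -
  interpret M: abelian_group M using M by (rule left_module_group)
  interpret R: ring R using M by (rule left_module_ring)
  note MM = left_module.smult_closed[OF M] left_module.smult_l_distr[OF M] left_module.smult_r_distr[OF M]
    left_module.smult_assoc1[OF M] left_module.smult_one[OF M]
  show ?thesis
  proof (rule left_moduleI)
    show "ring R" by unfold_locales
    show "\<exists>y \<in> carrier N. y \<oplus>\<^bsub>N\<^esub> x = \<zero>\<^bsub>N\<^esub>" if "x \<in> carrier N" for x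
    proof -
      from that obtain u where "u \<in> carrier M" "x = q u" using N by auto
      then show ?thesis
        using N add M.l_neg by (intro bexI[of _ "q (\<ominus>\<^bsub>M\<^esub> u)"]) auto
    qed
  qed (auto simp: N add smult MM M.a_ac)
qed

text \<open>The operations on the image are computed on chosen preimages; \<open>ca\<close> and
  \<open>cs\<close> say that the fibres of \<open>q\<close> form a congruence, so the choice does
  not matter. It serves two kinds of \<open>q\<close>: the coset map of a quotient, and an injection
  that transports structure to another type.\<close>

lemma image_module_exists:
  fixes M :: "('r, 'a) module" and q :: "'a \<Rightarrow> 'b"
  assumes M: "left_module R M"
    and ca: "\<And>x x' y y'. \<lbrakk>x \<in> carrier M; x' \<in> carrier M; y \<in> carrier M; y' \<in> carrier M; q x = q x'; q y = q y'\<rbrakk>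
       \<Longrightarrow> q (x \<oplus>\<^bsub>M\<^esub> y) = q (x' \<oplus>\<^bsub>M\<^esub> y')"
    and cs: "\<And>a x x'. \<lbrakk>a \<in> carrier R; x \<in> carrier M; x' \<in> carrier M; q x = q x'\<rbrakk>
       \<Longrightarrow> q (a \<odot>\<^bsub>M\<^esub> x) = q (a \<odot>\<^bsub>M\<^esub> x')"
  obtains N :: "('r, 'b) module" where "left_module R N" "carrier N = q ` carrier M" "q \<in> lin_hom R M N"
proof -
  let ?j = "inv_into (carrier M) q"
  let ?N = "\<lparr>carrier = q ` carrier M, monoid.mult = undefined, one = undefined, zero = q \<zero>\<^bsub>M\<^esub>,
    add = (\<lambda>u v. q (?j u \<oplus>\<^bsub>M\<^esub> ?j v)), smult = (\<lambda>a u. q (a \<odot>\<^bsub>M\<^esub> ?j u))\<rparr> :: ('r, 'b) module"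
  have j: "?j (q x) \<in> carrier M" "q (?j (q x)) = q x" if "x \<in> carrier M" for x
    using that by (auto simp: inv_into_into f_inv_into_f)
  have add: "q x \<oplus>\<^bsub>?N\<^esub> q y = q (x \<oplus>\<^bsub>M\<^esub> y)" if "x \<in> carrier M" "y \<in> carrier M" for x y
    using ca[OF j(1)[OF that(1)] that(1) j(1)[OF that(2)] that(2) j(2)[OF that(1)] j(2)[OF that(2)]] by simp
  have smult: "a \<odot>\<^bsub>?N\<^esub> q x = q (a \<odot>\<^bsub>M\<^esub> x)" if "a \<in> carrier R" "x \<in> carrier M" for a x
    using cs[OF that(1) j(1)[OF that(2)] that(2) j(2)[OF that(2)]] by simp
  have "left_module R ?N"
    by (rule surjective_image_module[OF M _ _ add smult]) simp_all
  moreover have "q \<in> lin_hom R M ?N"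
    by (intro lin_homI) (simp_all only: add smult, simp)
  ultimately show thesis by (intro that[of ?N]) simp_all
qed

section \<open>Submodules, direct sums and quotients of modules\<close>

lemma submodule:
  assumes M: "left_module R M" and K: "K \<subseteq> carrier M" "\<zero>\<^bsub>M\<^esub> \<in> K"
    and add: "\<And>x y. \<lbrakk>x \<in> K; y \<in> K\<rbrakk> \<Longrightarrow> x \<oplus>\<^bsub>M\<^esub> y \<in> K"
    and smult: "\<And>a x. \<lbrakk>a \<in> carrier R; x \<in> K\<rbrakk> \<Longrightarrow> a \<odot>\<^bsub>M\<^esub> x \<in> K"
  shows "left_module R (M\<lparr>carrier := K\<rparr>)"
proof -
  interpret M: abelian_group M using M by (rule left_module_group)
  interpret R: ring R using M by (rule left_module_ring)
  note MM = left_module.smult_closed[OF M] left_module.smult_l_distr[OF M] left_module.smult_r_distr[OF M]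
    left_module.smult_assoc1[OF M] left_module.smult_one[OF M]
  show ?thesis
  proof (rule left_moduleI)
    show "ring R" by unfold_locales
    show "\<exists>y \<in> carrier (M\<lparr>carrier := K\<rparr>). y \<oplus>\<^bsub>M\<lparr>carrier := K\<rparr>\<^esub> x = \<zero>\<^bsub>M\<lparr>carrier := K\<rparr>\<^esub>"
      if "x \<in> carrier (M\<lparr>carrier := K\<rparr>)" for x
    proof -
      have "\<ominus>\<^bsub>M\<^esub> x \<in> K"
        using smult[of "\<ominus>\<^bsub>R\<^esub> \<one>\<^bsub>R\<^esub>" x] neg_one_smult[OF M, of x] that K by auto
      then show ?thesis
        using that K M.l_neg by (intro bexI[of _ "\<ominus>\<^bsub>M\<^esub> x"]) auto
    qed
  qed (use K add smult in \<open>auto simp: MM subset_iff M.a_ac\<close>)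
qed

lemma zero_submodule:
  assumes "left_module R M"
  shows "left_module R (M\<lparr>carrier := {\<zero>\<^bsub>M\<^esub>}\<rparr>)"
proof -
  interpret M: abelian_group M using assms by (rule left_module_group)
  show ?thesis by (rule submodule[OF assms]) (auto simp: smult_zero[OF assms])
qed

lemma kernel_submodule:
  assumes M: "left_module R M" and N: "left_module R N" and f: "f \<in> lin_hom R M N"
  shows "left_module R (M\<lparr>carrier := a_kernel M N f\<rparr>)"
proof -
  interpret M: abelian_group M using M by (rule left_module_group)
  interpret N: abelian_group N using N by (rule left_module_group)
  show ?thesis
    by (rule submodule[OF M])
      (auto simp: a_kernel_iff lin_hom_zero[OF f M.abelian_group_axioms N.abelian_group_axioms]
        lin_hom_add[OF f] lin_hom_smult[OF f] smult_zero[OF N] left_module.smult_closed[OF M])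
qed

text \<open>The direct sum, on a product type. It belongs to \<open>RMod R S\<close> only after
  being copied by \<open>small_module_copy\<close>.\<close>

definition pair_module :: "('r, 'a) module \<Rightarrow> ('r, 'b) module \<Rightarrow> ('r, 'a \<times> 'b) module" where
  "pair_module M N = \<lparr>carrier = carrier M \<times> carrier N, monoid.mult = undefined, one = undefined,
     zero = (\<zero>\<^bsub>M\<^esub>, \<zero>\<^bsub>N\<^esub>), add = (\<lambda>x y. (fst x \<oplus>\<^bsub>M\<^esub> fst y, snd x \<oplus>\<^bsub>N\<^esub> snd y)),
     smult = (\<lambda>a x. (a \<odot>\<^bsub>M\<^esub> fst x, a \<odot>\<^bsub>N\<^esub> snd x))\<rparr>"

lemma pair_module_simps [simp]:
  "carrier (pair_module M N) = carrier M \<times> carrier N"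
  "\<zero>\<^bsub>pair_module M N\<^esub> = (\<zero>\<^bsub>M\<^esub>, \<zero>\<^bsub>N\<^esub>)"
  "x \<oplus>\<^bsub>pair_module M N\<^esub> y = (fst x \<oplus>\<^bsub>M\<^esub> fst y, snd x \<oplus>\<^bsub>N\<^esub> snd y)"
  "a \<odot>\<^bsub>pair_module M N\<^esub> x = (a \<odot>\<^bsub>M\<^esub> fst x, a \<odot>\<^bsub>N\<^esub> snd x)"
  by (simp_all add: pair_module_def)

lemma pair_module:
  assumes M: "left_module R M" and N: "left_module R N"
  shows "left_module R (pair_module M N)"
proof -
  interpret M: abelian_group M using M by (rule left_module_group)
  interpret N: abelian_group N using N by (rule left_module_group)
  interpret R: ring R using M by (rule left_module_ring)
  note MM = left_module.smult_closed[OF M] left_module.smult_l_distr[OF M] left_module.smult_r_distr[OF M]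
    left_module.smult_assoc1[OF M] left_module.smult_one[OF M]
  note NN = left_module.smult_closed[OF N] left_module.smult_l_distr[OF N] left_module.smult_r_distr[OF N]
    left_module.smult_assoc1[OF N] left_module.smult_one[OF N]
  show ?thesis
  proof (rule left_moduleI)
    show "ring R" by unfold_locales
    show "\<exists>y \<in> carrier (pair_module M N). y \<oplus>\<^bsub>pair_module M N\<^esub> x = \<zero>\<^bsub>pair_module M N\<^esub>"
      if "x \<in> carrier (pair_module M N)" for x
      using that M.l_neg N.l_neg by (intro bexI[of _ "(\<ominus>\<^bsub>M\<^esub> fst x, \<ominus>\<^bsub>N\<^esub> snd x)"]) auto
  qed (auto simp: MM NN M.a_ac N.a_ac)
qed

lemma lin_hom_pair:
  "\<lbrakk>f \<in> lin_hom R P M; g \<in> lin_hom R P N\<rbrakk> \<Longrightarrow> (\<lambda>x. (f x, g x)) \<in> lin_hom R P (pair_module M N)"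
  by (intro lin_homI) (auto simp: lin_hom_closed lin_hom_add lin_hom_smult)

lemma lin_hom_fst: "fst \<in> lin_hom R (pair_module M N) M"
  by (intro lin_homI) auto

lemma lin_hom_snd: "snd \<in> lin_hom R (pair_module M N) N"
  by (intro lin_homI) auto

text \<open>The map sending \<open>x\<close> to the coset \<open>K + x\<close> has a congruence as
  its fibre relation, so its image carries a module structure. That \<open>K\<close> is a submodule
  is expressed by restricting the record of \<open>M\<close> to \<open>K\<close>.\<close>

lemma quotient_module_exists:
  fixes M :: "('r, 'a) module"
  assumes M: "left_module R M" and KM: "K \<subseteq> carrier M" and K: "left_module R (M\<lparr>carrier := K\<rparr>)"
  obtains N :: "('r, 'a set) module" and q where "left_module R N" "q \<in> lin_hom R M N"
    "q ` carrier M = carrier N" "a_kernel M N q = K"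
proof -
  interpret M: abelian_group M using M by (rule left_module_group)
  interpret K: abelian_group "M\<lparr>carrier := K\<rparr>" using K by (rule left_module_group)
  interpret R: ring R using M by (rule left_module_ring)
  have zK: "\<zero>\<^bsub>M\<^esub> \<in> K" using K.zero_closed by simp
  have addK: "x \<oplus>\<^bsub>M\<^esub> y \<in> K" if "x \<in> K" "y \<in> K" for x y using K.a_closed[of x y] that by simp
  have smK: "a \<odot>\<^bsub>M\<^esub> x \<in> K" if "a \<in> carrier R" "x \<in> K" for a x
    using left_module.smult_closed[OF K, of a x] that by simp
  have negK: "\<ominus>\<^bsub>M\<^esub> x \<in> K" if "x \<in> K" for x
    using smK[of "\<ominus>\<^bsub>R\<^esub> \<one>\<^bsub>R\<^esub>" x] neg_one_smult[OF M, of x] that KM by auto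
  define q where "q x = (\<lambda>k. k \<oplus>\<^bsub>M\<^esub> x) ` K" for x
  have qiff: "q x = q y \<longleftrightarrow> (\<exists>k \<in> K. x = k \<oplus>\<^bsub>M\<^esub> y)" if xy: "x \<in> carrier M" "y \<in> carrier M" for x y
  proof
    assume "q x = q y"
    moreover have "x \<in> q x" unfolding q_def using zK xy by (intro image_eqI[of _ _ "\<zero>\<^bsub>M\<^esub>"]) auto
    ultimately show "\<exists>k \<in> K. x = k \<oplus>\<^bsub>M\<^esub> y" by (auto simp: q_def)
  next
    assume "\<exists>k \<in> K. x = k \<oplus>\<^bsub>M\<^esub> y"
    then obtain k where k: "k \<in> K" "x = k \<oplus>\<^bsub>M\<^esub> y" by auto
    have kM: "k \<in> carrier M" using k KM by auto
    have "l \<oplus>\<^bsub>M\<^esub> x \<in> q y" if "l \<in> K" for l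
    proof -
      have "l \<in> carrier M" using that KM by auto
      then have "l \<oplus>\<^bsub>M\<^esub> x = (l \<oplus>\<^bsub>M\<^esub> k) \<oplus>\<^bsub>M\<^esub> y" using k kM xy by (simp add: M.a_assoc)
      then show ?thesis unfolding q_def using addK[OF that k(1)] by (rule image_eqI)
    qed
    moreover have "l \<oplus>\<^bsub>M\<^esub> y \<in> q x" if "l \<in> K" for l
    proof -
      have "l \<in> carrier M" using that KM by auto
      then have "l \<oplus>\<^bsub>M\<^esub> y = (l \<oplus>\<^bsub>M\<^esub> \<ominus>\<^bsub>M\<^esub> k) \<oplus>\<^bsub>M\<^esub> x"
        using k kM xy by (simp add: M.a_assoc M.r_neg1)
      then show ?thesis unfolding q_def using addK[OF that negK[OF k(1)]] by (rule image_eqI)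
    qed
    ultimately show "q x = q y" by (auto simp: q_def)
  qed
  have ca: "q (x \<oplus>\<^bsub>M\<^esub> y) = q (x' \<oplus>\<^bsub>M\<^esub> y')"
    if c: "x \<in> carrier M" "x' \<in> carrier M" "y \<in> carrier M" "y' \<in> carrier M" and e: "q x = q x'" "q y = q y'"
    for x x' y y'
  proof -
    obtain k l where k: "k \<in> K" "x = k \<oplus>\<^bsub>M\<^esub> x'" and l: "l \<in> K" "y = l \<oplus>\<^bsub>M\<^esub> y'"
      using e qiff[OF c(1,2)] qiff[OF c(3,4)] by blast
    then have "x \<oplus>\<^bsub>M\<^esub> y = (k \<oplus>\<^bsub>M\<^esub> l) \<oplus>\<^bsub>M\<^esub> (x' \<oplus>\<^bsub>M\<^esub> y')"
      using c KM by (simp add: M.a_ac subset_iff)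
    then show ?thesis using qiff[of "x \<oplus>\<^bsub>M\<^esub> y" "x' \<oplus>\<^bsub>M\<^esub> y'"] c addK[OF k(1) l(1)] by blast
  qed
  have cs: "q (a \<odot>\<^bsub>M\<^esub> x) = q (a \<odot>\<^bsub>M\<^esub> x')"
    if c: "a \<in> carrier R" "x \<in> carrier M" "x' \<in> carrier M" and e: "q x = q x'" for a x x'
  proof -
    obtain k where k: "k \<in> K" "x = k \<oplus>\<^bsub>M\<^esub> x'" using e qiff[OF c(2,3)] by blast
    then have "a \<odot>\<^bsub>M\<^esub> x = (a \<odot>\<^bsub>M\<^esub> k) \<oplus>\<^bsub>M\<^esub> (a \<odot>\<^bsub>M\<^esub> x')"
      using c KM by (auto simp: left_module.smult_r_distr[OF M] subset_iff)
    then show ?thesis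
      using qiff[of "a \<odot>\<^bsub>M\<^esub> x" "a \<odot>\<^bsub>M\<^esub> x'"] c smK[OF c(1) k(1)] left_module.smult_closed[OF M] by blast
  qed
  obtain N :: "('r, 'a set) module"
    where N: "left_module R N" "carrier N = q ` carrier M" "q \<in> lin_hom R M N"
    by (rule image_module_exists[where q = q, OF M ca cs])
  have "q \<zero>\<^bsub>M\<^esub> = \<zero>\<^bsub>N\<^esub>"
    using lin_hom_zero[OF N(3) M.abelian_group_axioms] N(1) left_module_group by blast
  then have "q x = \<zero>\<^bsub>N\<^esub> \<longleftrightarrow> x \<in> K" if "x \<in> carrier M" for x
    using qiff[OF that, of "\<zero>\<^bsub>M\<^esub>"] KM that by (auto simp: subset_iff)
  then have "a_kernel M N q = K"
    using KM by (auto simp: a_kernel_iff)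
  then show thesis by (rule that[OF N(1,3) N(2)[symmetric]])
qed

section \<open>Splittings of short exact sequences\<close>

lemma short_exactD:
  assumes "short_exact R B i E p A"
  shows "i \<in> lin_hom R B E" "p \<in> lin_hom R E A"
    and "\<lbrakk>b \<in> carrier B; b' \<in> carrier B; i b = i b'\<rbrakk> \<Longrightarrow> b = b'"
    and "b \<in> carrier B \<Longrightarrow> p (i b) = \<zero>\<^bsub>A\<^esub>"
    and "\<lbrakk>e \<in> carrier E; p e = \<zero>\<^bsub>A\<^esub>\<rbrakk> \<Longrightarrow> \<exists>b \<in> carrier B. e = i b"
    and "a \<in> carrier A \<Longrightarrow> \<exists>e \<in> carrier E. p e = a"
proof -
  have ker: "i ` carrier B = a_kernel E A p" using assms by (simp add: short_exact_def)
  show "i \<in> lin_hom R B E" "p \<in> lin_hom R E A"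
    "\<lbrakk>b \<in> carrier B; b' \<in> carrier B; i b = i b'\<rbrakk> \<Longrightarrow> b = b'"
    using assms by (auto simp: short_exact_def dest: inj_onD)
  show "b \<in> carrier B \<Longrightarrow> p (i b) = \<zero>\<^bsub>A\<^esub>" using ker a_kernel_iff[of "i b"] by blast
  show "\<lbrakk>e \<in> carrier E; p e = \<zero>\<^bsub>A\<^esub>\<rbrakk> \<Longrightarrow> \<exists>b \<in> carrier B. e = i b"
    using ker a_kernel_iff[of e] by blast
  show "a \<in> carrier A \<Longrightarrow> \<exists>e \<in> carrier E. p e = a"
    using assms unfolding short_exact_def by (metis imageE)
qed

lemma short_exactI:
  assumes "i \<in> lin_hom R B E" "p \<in> lin_hom R E A"
    and "\<And>b b'. \<lbrakk>b \<in> carrier B; b' \<in> carrier B; i b = i b'\<rbrakk> \<Longrightarrow> b = b'"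
    and "\<And>b. b \<in> carrier B \<Longrightarrow> p (i b) = \<zero>\<^bsub>A\<^esub>"
    and "\<And>e. \<lbrakk>e \<in> carrier E; p e = \<zero>\<^bsub>A\<^esub>\<rbrakk> \<Longrightarrow> \<exists>b \<in> carrier B. e = i b"
    and "\<And>a. a \<in> carrier A \<Longrightarrow> \<exists>e \<in> carrier E. p e = a"
  shows "short_exact R B i E p A"
proof -
  have "i ` carrier B = a_kernel E A p"
    using assms(4,5) lin_hom_closed[OF assms(1)] by (auto simp: a_kernel_iff image_iff)
  moreover have "p ` carrier E = carrier A"
    using assms(6) lin_hom_closed[OF assms(2)] by blast
  ultimately show ?thesis using assms(1,2,3) by (auto simp: short_exact_def inj_on_def)
qed

lemma short_exact_diff:
  assumes "short_exact R B i E p A" "left_module R E" "left_module R A"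
    and "e \<in> carrier E" "e' \<in> carrier E" "p e = p e'"
  obtains b where "b \<in> carrier B" "e = i b \<oplus>\<^bsub>E\<^esub> e'"
proof -
  interpret E: abelian_group E using assms(2) by (rule left_module_group)
  interpret A: abelian_group A using assms(3) by (rule left_module_group)
  note se = short_exactD[OF assms(1)]
  have "p (e \<ominus>\<^bsub>E\<^esub> e') = \<zero>\<^bsub>A\<^esub>"
    using lin_hom_diff[OF se(2) E.abelian_group_axioms A.abelian_group_axioms] assms lin_hom_closed[OF se(2)]
    by (simp add: A.r_neg A.minus_eq)
  then obtain b where b: "b \<in> carrier B" "e \<ominus>\<^bsub>E\<^esub> e' = i b"
    using se(5) assms E.minus_closed by metis
  have "e = (e \<ominus>\<^bsub>E\<^esub> e') \<oplus>\<^bsub>E\<^esub> e'" using assms by (simp add: E.minus_eq E.a_assoc E.l_neg)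
  with b that show thesis by metis
qed

text \<open>\<open>r e\<close> is the only \<open>b\<close> with \<open>i b + s (p e) = e\<close>:
  it exists because \<open>e\<close> and \<open>s (p e)\<close> have the same image under
  \<open>p\<close>, and is unique because \<open>i\<close> is injective. Uniqueness then gives
  linearity and the values on the images of \<open>i\<close> and \<open>s\<close>.\<close>

lemma retraction_of_section:
  assumes se: "short_exact R B i E p A"
    and mod: "left_module R B" "left_module R E" "left_module R A"
    and s: "s \<in> lin_hom R A E" "\<And>a. a \<in> carrier A \<Longrightarrow> p (s a) = a"
  obtains r where "r \<in> lin_hom R E B" "\<And>b. b \<in> carrier B \<Longrightarrow> r (i b) = b"
    "\<And>a. a \<in> carrier A \<Longrightarrow> r (s a) = \<zero>\<^bsub>B\<^esub>" "\<And>e. e \<in> carrier E \<Longrightarrow> i (r e) \<oplus>\<^bsub>E\<^esub> s (p e) = e"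
proof -
  interpret E: abelian_group E using mod by (intro left_module_group)
  interpret A: abelian_group A using mod by (intro left_module_group)
  interpret B: abelian_group B using mod by (intro left_module_group)
  note D = short_exactD[OF se]
  note ic = lin_hom_closed[OF D(1)] and pc = lin_hom_closed[OF D(2)] and sc = lin_hom_closed[OF s(1)]
  have ex: "\<exists>b. b \<in> carrier B \<and> i b \<oplus>\<^bsub>E\<^esub> s (p e) = e" if "e \<in> carrier E" for e
    by (rule short_exact_diff[OF se mod(2,3) that, of "s (p e)"]) (use that pc sc s(2) in auto)
  define r where "r e = (SOME b. b \<in> carrier B \<and> i b \<oplus>\<^bsub>E\<^esub> s (p e) = e)" for e
  have r: "r e \<in> carrier B" "i (r e) \<oplus>\<^bsub>E\<^esub> s (p e) = e" if "e \<in> carrier E" for e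
    using someI_ex[OF ex[OF that]] by (auto simp: r_def)
  have uniq: "r e = b" if "b \<in> carrier B" "e \<in> carrier E" "i b \<oplus>\<^bsub>E\<^esub> s (p e) = e" for b e
  proof (rule D(3))
    show "i (r e) = i b"
      using that r[OF that(2)] ic sc pc by (metis E.add.right_cancel)
  qed (use that r in auto)
  have ri: "r (i b) = b" if "b \<in> carrier B" for b
    using that D(4) lin_hom_zero[OF s(1) A.abelian_group_axioms E.abelian_group_axioms] ic
    by (intro uniq) simp_all
  have rs: "r (s a) = \<zero>\<^bsub>B\<^esub>" if "a \<in> carrier A" for a
    using that lin_hom_zero[OF D(1) B.abelian_group_axioms E.abelian_group_axioms] sc s(2)
    by (intro uniq) simp_all
  have "r \<in> lin_hom R E B"
  proof (rule lin_homI)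
    fix e e' assume e: "e \<in> carrier E" "e' \<in> carrier E"
    have "i (r e \<oplus>\<^bsub>B\<^esub> r e') \<oplus>\<^bsub>E\<^esub> s (p (e \<oplus>\<^bsub>E\<^esub> e'))
        = (i (r e) \<oplus>\<^bsub>E\<^esub> s (p e)) \<oplus>\<^bsub>E\<^esub> (i (r e') \<oplus>\<^bsub>E\<^esub> s (p e'))"
      using e r(1) ic sc pc
      by (simp add: lin_hom_add[OF D(1)] lin_hom_add[OF D(2)] lin_hom_add[OF s(1)] E.a_ac)
    then show "r (e \<oplus>\<^bsub>E\<^esub> e') = r e \<oplus>\<^bsub>B\<^esub> r e'" using e r by (intro uniq) simp_all
  next
    fix c e assume c: "c \<in> carrier R" and e: "e \<in> carrier E"
    have "i (c \<odot>\<^bsub>B\<^esub> r e) \<oplus>\<^bsub>E\<^esub> s (p (c \<odot>\<^bsub>E\<^esub> e)) = c \<odot>\<^bsub>E\<^esub> (i (r e) \<oplus>\<^bsub>E\<^esub> s (p e))"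
      using c e r(1) ic sc pc
      by (simp add: lin_hom_smult[OF D(1)] lin_hom_smult[OF D(2)] lin_hom_smult[OF s(1)]
        left_module.smult_r_distr[OF mod(2)])
    then show "r (c \<odot>\<^bsub>E\<^esub> e) = c \<odot>\<^bsub>B\<^esub> r e"
      using c e r left_module.smult_closed[OF mod(1)] left_module.smult_closed[OF mod(2)]
      by (intro uniq) simp_all
  qed (use r in auto)
  then show thesis using ri rs r(2) by (rule that)
qed

text \<open>\<open>s a\<close> is the only element over \<open>a\<close> killed by \<open>r\<close>;
  any \<open>e\<close> over \<open>a\<close> yields it as \<open>e - i (r e)\<close>. Uniqueness,
  that is, joint injectivity of \<open>p\<close> and \<open>r\<close>, again gives
  linearity.\<close>

lemma section_of_retraction:
  assumes se: "short_exact R B i E p A"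
    and mod: "left_module R B" "left_module R E" "left_module R A"
    and r: "r \<in> lin_hom R E B" "\<And>b. b \<in> carrier B \<Longrightarrow> r (i b) = b"
  obtains s where "s \<in> lin_hom R A E" "\<And>a. a \<in> carrier A \<Longrightarrow> p (s a) = a"
    "\<And>a. a \<in> carrier A \<Longrightarrow> r (s a) = \<zero>\<^bsub>B\<^esub>"
    "\<And>e e'. \<lbrakk>e \<in> carrier E; e' \<in> carrier E; p e = p e'; r e = r e'\<rbrakk> \<Longrightarrow> e = e'"
proof -
  interpret E: abelian_group E using mod by (intro left_module_group)
  interpret A: abelian_group A using mod by (intro left_module_group)
  interpret B: abelian_group B using mod by (intro left_module_group)
  note D = short_exactD[OF se]
  note ic = lin_hom_closed[OF D(1)] and pc = lin_hom_closed[OF D(2)] and rc = lin_hom_closed[OF r(1)]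
  have uniq: "e = e'" if e: "e \<in> carrier E" "e' \<in> carrier E" "p e = p e'" "r e = r e'" for e e'
  proof -
    obtain b where b: "b \<in> carrier B" "e = i b \<oplus>\<^bsub>E\<^esub> e'"
      using short_exact_diff[OF se mod(2,3) e(1-3)] .
    then have "r e' = b \<oplus>\<^bsub>B\<^esub> r e'"
      using lin_hom_add[OF r(1) ic[OF b(1)] e(2)] r(2)[OF b(1)] e(4) by simp
    then have "b = \<zero>\<^bsub>B\<^esub>" using b(1) rc[OF e(2)] by simp
    then show ?thesis
      using b e lin_hom_zero[OF D(1) B.abelian_group_axioms E.abelian_group_axioms] by simp
  qed
  have ex: "\<exists>e. e \<in> carrier E \<and> p e = a \<and> r e = \<zero>\<^bsub>B\<^esub>" if "a \<in> carrier A" for a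
  proof -
    from D(6)[OF that] obtain e where e: "e \<in> carrier E" "p e = a" by auto
    have ir: "i (r e) \<in> carrier E" using e ic rc by blast
    have "p (e \<ominus>\<^bsub>E\<^esub> i (r e)) = a" "r (e \<ominus>\<^bsub>E\<^esub> i (r e)) = \<zero>\<^bsub>B\<^esub>"
      using lin_hom_diff[OF D(2) E.abelian_group_axioms A.abelian_group_axioms e(1) ir]
        lin_hom_diff[OF r(1) E.abelian_group_axioms B.abelian_group_axioms e(1) ir]
        D(4)[OF rc[OF e(1)]] r(2)[OF rc[OF e(1)]] e that rc[OF e(1)]
      by (simp_all add: A.minus_eq B.minus_eq B.r_neg)
    then show ?thesis using e ir E.minus_closed by blast
  qed
  define s where "s a = (SOME e. e \<in> carrier E \<and> p e = a \<and> r e = \<zero>\<^bsub>B\<^esub>)" for a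
  have s: "s a \<in> carrier E" "p (s a) = a" "r (s a) = \<zero>\<^bsub>B\<^esub>" if "a \<in> carrier A" for a
    using someI_ex[OF ex[OF that]] by (auto simp: s_def)
  have "s \<in> lin_hom R A E"
  proof (rule lin_homI)
    fix a a' assume a: "a \<in> carrier A" "a' \<in> carrier A"
    show "s (a \<oplus>\<^bsub>A\<^esub> a') = s a \<oplus>\<^bsub>E\<^esub> s a'"
      by (rule uniq) (use a s in \<open>simp_all add: lin_hom_add[OF D(2)] lin_hom_add[OF r(1)]\<close>)
  next
    fix c a assume a: "c \<in> carrier R" "a \<in> carrier A"
    show "s (c \<odot>\<^bsub>A\<^esub> a) = c \<odot>\<^bsub>E\<^esub> s a"
      by (rule uniq) (use a s in \<open>simp_all add: lin_hom_smult[OF D(2)] lin_hom_smult[OF r(1)]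
        smult_zero[OF mod(1)] left_module.smult_closed[OF mod(2)] left_module.smult_closed[OF mod(3)]\<close>)
  qed (use s in auto)
  then show thesis using s(2,3) uniq by (rule that)
qed

section \<open>Small sets\<close>

text \<open>Stated for sets of any type, so that carriers on product types or types of cosets can be
  measured against \<open>S\<close>.\<close>

definition small :: "'m set set \<Rightarrow> 'a set \<Rightarrow> bool" where
  "small S A \<longleftrightarrow> (\<exists>T \<in> S. A \<lesssim> T)"

lemma small_lepoll: "\<lbrakk>A \<lesssim> B; small S B\<rbrakk> \<Longrightarrow> small S A"
  unfolding small_def using lepoll_trans by blast

lemma small_mem: "A \<in> S \<Longrightarrow> small S A"
  unfolding small_def using lepoll_refl by blast

lemma lepoll_total: "A \<lesssim> B \<or> B \<lesssim> A"
  using ordLeq_total[OF card_of_Well_order card_of_Well_order, of A B]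
  by (simp add: lepoll_def card_of_ordLeq)

text \<open>For an infinite set \<open>Z\<close> the square of \<open>Z\<close> is equipollent to
  \<open>Z\<close>, so a common infinite bound in \<open>S\<close> for both factors is
  enough.\<close>

lemma small_times:
  assumes U: "module_universe R S" and "small S A" "small S B"
  shows "small S (A \<times> B)"
proof -
  obtain T T' I where T: "T \<in> S" "A \<lesssim> T" "T' \<in> S" "B \<lesssim> T'" "I \<in> S" "infinite I"
    using assms by (auto simp: small_def module_universe_def)
  have max: "\<exists>Z \<in> S. X \<lesssim> Z \<and> Y \<lesssim> Z" if "X \<in> S" "Y \<in> S" for X Y
    using that lepoll_total[of X Y] lepoll_refl by blast
  \<comment> \<open>Members of \<open>S\<close> are pairwise comparable, so the larger one bounds
    both. The second use absorbs the infinite set \<open>I\<close>, which makes \<open>Z\<close>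
    infinite.\<close>
  obtain Z1 where Z1: "Z1 \<in> S" "T \<lesssim> Z1" "T' \<lesssim> Z1" using max T by blast
  obtain Z where Z: "Z \<in> S" "Z1 \<lesssim> Z" "I \<lesssim> Z" using max T Z1 by blast
  have "infinite Z" using Z(3) T(6) infinite_le_lepoll lepoll_trans by blast
  then have "Z \<times> Z \<approx> Z" by (simp add: eqpoll_iff_card_of_ordIso card_of_Times_same_infinite)
  moreover have "A \<times> B \<lesssim> Z \<times> Z"
    using T Z Z1 by (intro times_lepoll_mono) (meson lepoll_trans)+
  ultimately show ?thesis
    unfolding small_def using Z(1) by (meson eqpoll_imp_lepoll lepoll_trans)
qed

text \<open>Fix a preimage \<open>t a\<close> for each \<open>a\<close>, without any linearity. Then
  \<open>e = i b + t (p e)\<close>, so \<open>e\<close> is determined by the pair of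
  \<open>b\<close> and \<open>p e\<close>. The type of \<open>E\<close> is arbitrary.\<close>

lemma small_extension:
  assumes U: "module_universe R S" and se: "short_exact R B i E p A"
    and mod: "left_module R B" "left_module R E" "left_module R A"
    and sm: "small S (carrier B)" "small S (carrier A)"
  shows "small S (carrier E)"
proof -
  note D = short_exactD[OF se]
  define t where "t a = (SOME e. e \<in> carrier E \<and> p e = a)" for a
  have t: "t (p e) \<in> carrier E" "p (t (p e)) = p e" if "e \<in> carrier E" for e
    using someI[of "\<lambda>x. x \<in> carrier E \<and> p x = p e" e] that by (auto simp: t_def)
  have "\<exists>b. b \<in> carrier B \<and> e = i b \<oplus>\<^bsub>E\<^esub> t (p e)" if "e \<in> carrier E" for e
    by (rule short_exact_diff[OF se mod(2,3) that, of "t (p e)"]) (use that t in auto)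
  then obtain b where b: "\<And>e. e \<in> carrier E \<Longrightarrow> b e \<in> carrier B \<and> e = i (b e) \<oplus>\<^bsub>E\<^esub> t (p e)"
    by metis
  have "inj_on (\<lambda>e. (b e, p e)) (carrier E)"
    by (rule inj_onI) (metis b prod.inject)
  moreover have "(\<lambda>e. (b e, p e)) ` carrier E \<subseteq> carrier B \<times> carrier A"
    using b lin_hom_closed[OF D(2)] by auto
  ultimately have "carrier E \<lesssim> carrier B \<times> carrier A" unfolding lepoll_def by blast
  then show ?thesis using small_times[OF U sm] small_lepoll by blast
qed

lemma RMod_module: "M \<in> RMod R S \<Longrightarrow> left_module R M"
  by (simp add: RMod_def)

lemma RMod_small: "M \<in> RMod R S \<Longrightarrow> small S (carrier M)"
  by (simp add: RMod_def small_mem)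

lemma RModI: "\<lbrakk>module_universe R S; left_module R M; small S (carrier M)\<rbrakk> \<Longrightarrow> M \<in> RMod R S"
  unfolding RMod_def small_def module_universe_def by blast

text \<open>Transport of structure along an injection of the carrier into a member of
  \<open>S\<close>. This brings modules built on other types back into \<open>RMod R S\<close>, with
  mutually inverse linear maps to compare them.\<close>

lemma small_module_copy:
  fixes M :: "('r, 'a) module"
  assumes U: "module_universe R S" and M: "left_module R M" "small S (carrier M)"
  obtains N f g where "N \<in> RMod R S" "f \<in> lin_hom R M N" "g \<in> lin_hom R N M"
    "\<And>x. x \<in> carrier M \<Longrightarrow> g (f x) = x" "\<And>y. y \<in> carrier N \<Longrightarrow> f (g y) = y"
proof -
  obtain T f where T: "T \<in> S" "inj_on f (carrier M)" "f ` carrier M \<subseteq> T"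
    using M(2) by (auto simp: small_def lepoll_def)
  obtain N where N: "left_module R N" "carrier N = f ` carrier M" "f \<in> lin_hom R M N"
  proof (rule image_module_exists[where q = f, OF M(1)])
    show "f (x \<oplus>\<^bsub>M\<^esub> y) = f (x' \<oplus>\<^bsub>M\<^esub> y')"
      if "x \<in> carrier M" "x' \<in> carrier M" "y \<in> carrier M" "y' \<in> carrier M" "f x = f x'" "f y = f y'"
      for x x' y y'
      using that inj_onD[OF T(2), of x x'] inj_onD[OF T(2), of y y'] by simp
    show "f (a \<odot>\<^bsub>M\<^esub> x) = f (a \<odot>\<^bsub>M\<^esub> x')"
      if "a \<in> carrier R" "x \<in> carrier M" "x' \<in> carrier M" "f x = f x'" for a x x'
      using that inj_onD[OF T(2), of x x'] by simp
  qed
  let ?g = "inv_into (carrier M) f"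
  have gf: "?g (f x) = x" if "x \<in> carrier M" for x using that T(2) by simp
  have fg: "f (?g y) = y" if "y \<in> carrier N" for y using that N(2) by (simp add: f_inv_into_f)
  have gc: "?g y \<in> carrier M" if "y \<in> carrier N" for y using that N(2) by (simp add: inv_into_into)
  have "small S (carrier N)"
    unfolding small_def using T(1,3) N(2) subset_imp_lepoll by metis
  then have NR: "N \<in> RMod R S" using RModI[OF U N(1)] by blast
  have "?g \<in> lin_hom R N M"
  proof (rule lin_homI)
    fix x y assume xy: "x \<in> carrier N" "y \<in> carrier N"
    have "x \<oplus>\<^bsub>N\<^esub> y = f (?g x \<oplus>\<^bsub>M\<^esub> ?g y)" using xy gc fg lin_hom_add[OF N(3)] by simp
    then show "?g (x \<oplus>\<^bsub>N\<^esub> y) = ?g x \<oplus>\<^bsub>M\<^esub> ?g y"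
      using gf gc xy abelian_groupE(1)[OF left_module_group[OF M(1)]] by simp
  next
    fix a x assume ax: "a \<in> carrier R" "x \<in> carrier N"
    have "a \<odot>\<^bsub>N\<^esub> x = f (a \<odot>\<^bsub>M\<^esub> ?g x)" using ax gc fg lin_hom_smult[OF N(3)] by simp
    then show "?g (a \<odot>\<^bsub>N\<^esub> x) = a \<odot>\<^bsub>M\<^esub> ?g x"
      using gf gc ax left_module.smult_closed[OF M(1)] by simp
  qed (use gc in auto)
  then show thesis by (rule that[OF NR N(3) _ gf fg])
qed

section \<open>Vanishing of Ext for modules\<close>

text \<open>By reflexivity each element lies in its own class. If there is only one class, it thus
  contains every element and is the set of elements related to any given one.\<close>

lemma singleton_quotient_iff:
  assumes "r \<subseteq> X \<times> X" "\<And>x. x \<in> X \<Longrightarrow> (x, x) \<in> r"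
  shows "is_singleton (X // r) \<longleftrightarrow> X \<noteq> {} \<and> (\<forall>x \<in> X. \<forall>y \<in> X. (x, y) \<in> r)"
proof
  assume "is_singleton (X // r)"
  then obtain c where c: "X // r = {c}" by (auto simp: is_singleton_def)
  have "r `` {x} = c" if "x \<in> X" for x using c quotientI[OF that, of r] by auto
  then have "(x, y) \<in> r" if "x \<in> X" "y \<in> X" for x y using assms(2) that by blast
  moreover have "X \<noteq> {}" using c by (auto simp: quotient_def)
  ultimately show "X \<noteq> {} \<and> (\<forall>x \<in> X. \<forall>y \<in> X. (x, y) \<in> r)" by blast
next
  assume r: "X \<noteq> {} \<and> (\<forall>x \<in> X. \<forall>y \<in> X. (x, y) \<in> r)"
  then have "r `` {x} = X" if "x \<in> X" for x using assms(1) that by blast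
  then have "X // r = {X}" using r by (auto simp: quotient_def)
  then show "is_singleton (X // r)" by (simp add: is_singleton_def)
qed

lemma bij_betw_of_inverse:
  assumes "\<And>x. x \<in> A \<Longrightarrow> f x \<in> B" "\<And>y. y \<in> B \<Longrightarrow> g y \<in> A"
    and "\<And>x. x \<in> A \<Longrightarrow> g (f x) = x" "\<And>y. y \<in> B \<Longrightarrow> f (g y) = y"
  shows "bij_betw f A B"
  using assms by (intro bij_betw_byWitness[of A g f B]) auto

text \<open>The comparison map sends \<open>i b + s a\<close> to \<open>i' b + s' a\<close>.\<close>

lemma split_extension_map:
  assumes se: "short_exact R B i E p A" and mod: "left_module R B" "left_module R E" "left_module R A"
    and s: "s \<in> lin_hom R A E" "\<And>a. a \<in> carrier A \<Longrightarrow> p (s a) = a"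
    and se': "short_exact R B i' E' p' A" and mod': "left_module R E'"
    and s': "s' \<in> lin_hom R A E'" "\<And>a. a \<in> carrier A \<Longrightarrow> p' (s' a) = a"
  obtains f where "f \<in> lin_hom R E E'" "bij_betw f (carrier E) (carrier E')"
    "\<And>b. b \<in> carrier B \<Longrightarrow> f (i b) = i' b" "\<And>a. a \<in> carrier A \<Longrightarrow> f (s a) = s' a"
    "\<And>e. e \<in> carrier E \<Longrightarrow> p' (f e) = p e"
proof -
  interpret E: abelian_group E using mod by (intro left_module_group)
  interpret E': abelian_group E' using mod' by (intro left_module_group)
  interpret A: abelian_group A using mod by (intro left_module_group)
  interpret B: abelian_group B using mod by (intro left_module_group)
  obtain r where r: "r \<in> lin_hom R E B" "\<And>b. b \<in> carrier B \<Longrightarrow> r (i b) = b"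
    "\<And>a. a \<in> carrier A \<Longrightarrow> r (s a) = \<zero>\<^bsub>B\<^esub>" "\<And>e. e \<in> carrier E \<Longrightarrow> i (r e) \<oplus>\<^bsub>E\<^esub> s (p e) = e"
    by (rule retraction_of_section[OF se mod s(1)], erule s(2), rule that)
  obtain r' where r': "r' \<in> lin_hom R E' B" "\<And>b. b \<in> carrier B \<Longrightarrow> r' (i' b) = b"
    "\<And>a. a \<in> carrier A \<Longrightarrow> r' (s' a) = \<zero>\<^bsub>B\<^esub>" "\<And>e. e \<in> carrier E' \<Longrightarrow> i' (r' e) \<oplus>\<^bsub>E'\<^esub> s' (p' e) = e"
    by (rule retraction_of_section[OF se' mod(1) mod' mod(3) s'(1)], erule s'(2), rule that)
  note D = short_exactD[OF se] and D' = short_exactD[OF se']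
  note c = lin_hom_closed[OF D(1)] lin_hom_closed[OF D(2)] lin_hom_closed[OF D'(1)] lin_hom_closed[OF D'(2)]
    lin_hom_closed[OF s(1)] lin_hom_closed[OF s'(1)] lin_hom_closed[OF r(1)] lin_hom_closed[OF r'(1)]
  define f where "f e = i' (r e) \<oplus>\<^bsub>E'\<^esub> s' (p e)" for e
  define g where "g e = i (r' e) \<oplus>\<^bsub>E\<^esub> s (p' e)" for e
  have f: "f \<in> lin_hom R E E'"
    unfolding f_def by (intro lin_hom_sum[OF mod'] lin_hom_comp[OF r(1) D'(1)] lin_hom_comp[OF D(2) s'(1)])
  have g: "g \<in> lin_hom R E' E"
    unfolding g_def by (intro lin_hom_sum[OF mod(2)] lin_hom_comp[OF r'(1) D(1)] lin_hom_comp[OF D'(2) s(1)])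
  have rp: "p' (f e) = p e" "r' (f e) = r e" if "e \<in> carrier E" for e
    using that c by (simp_all add: f_def lin_hom_add[OF D'(2)] lin_hom_add[OF r'(1)] D'(4) s'(2) r'(2,3))
  have rp': "p (g e) = p' e" "r (g e) = r' e" if "e \<in> carrier E'" for e
    using that c by (simp_all add: g_def lin_hom_add[OF D(2)] lin_hom_add[OF r(1)] D(4) s(2) r(2,3))
  have "bij_betw f (carrier E) (carrier E')"
  proof (rule bij_betw_of_inverse)
    show "g (f e) = e" if "e \<in> carrier E" for e using rp[OF that] r(4)[OF that] by (simp add: g_def)
    show "f (g e) = e" if "e \<in> carrier E'" for e using rp'[OF that] r'(4)[OF that] by (simp add: f_def)
  qed (use lin_hom_closed[OF f] lin_hom_closed[OF g] in auto)
  moreover have "f (i b) = i' b" if "b \<in> carrier B" for b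
    using that c r(2) D(4) lin_hom_zero[OF s'(1) A.abelian_group_axioms E'.abelian_group_axioms]
    by (simp add: f_def)
  moreover have "f (s a) = s' a" if "a \<in> carrier A" for a
    using that c r(3) s(2) lin_hom_zero[OF D'(1) B.abelian_group_axioms E'.abelian_group_axioms]
    by (simp add: f_def)
  ultimately show thesis using f rp(1) by (intro that[of f])
qed

lemma short_exact_pair:
  assumes "left_module R B" "left_module R A"
  shows "short_exact R B (\<lambda>b. (b, \<zero>\<^bsub>A\<^esub>)) (pair_module B A) snd A"
proof -
  interpret B: abelian_group B using assms by (intro left_module_group)
  show ?thesis
  proof (rule short_exactI)
    show "(\<lambda>b. (b, \<zero>\<^bsub>A\<^esub>)) \<in> lin_hom R B (pair_module B A)"
      by (rule lin_hom_pair[OF lin_hom_id lin_hom_const_zero[OF assms(2)]])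
    show "\<exists>e\<in>carrier (pair_module B A). snd e = a" if "a \<in> carrier A" for a
      using that by (intro bexI[of _ "(\<zero>\<^bsub>B\<^esub>, a)"]) simp_all
  qed (auto intro: lin_hom_snd)
qed

lemma short_exact_transport:
  assumes se: "short_exact R B i E p A" and f: "f \<in> lin_hom R E F" and g: "g \<in> lin_hom R F E"
    and gf: "\<And>x. x \<in> carrier E \<Longrightarrow> g (f x) = x" and fg: "\<And>y. y \<in> carrier F \<Longrightarrow> f (g y) = y"
  shows "short_exact R B (\<lambda>b. f (i b)) F (\<lambda>e. p (g e)) A"
proof -
  note D = short_exactD[OF se]
  note c = lin_hom_closed[OF D(1)] lin_hom_closed[OF f] lin_hom_closed[OF g]
  show ?thesis
  proof (rule short_exactI)
    show "b = b'" if "b \<in> carrier B" "b' \<in> carrier B" "f (i b) = f (i b')" for b b'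
      using that c gf D(3) by metis
    show "\<exists>b\<in>carrier B. e = f (i b)" if "e \<in> carrier F" "p (g e) = \<zero>\<^bsub>A\<^esub>" for e
      using that c fg D(5) by metis
    show "\<exists>e\<in>carrier F. p (g e) = a" if "a \<in> carrier A" for a
      using that c gf D(6) by metis
  qed (use c gf D(4) in \<open>auto intro: lin_hom_comp[OF D(1) f] lin_hom_comp[OF g D(2)]\<close>)
qed

text \<open>The split extension always exists, so if there is one class, every extension is
  equivalent to it and receives its section. Conversely two extensions with sections are matched by
  \<open>split_extension_map\<close>.\<close>

lemma Ext1_Mod_singleton_iff:
  assumes U: "module_universe R S" and A: "A \<in> RMod R S" and B: "B \<in> RMod R S"
  shows "is_singleton (Ext1_Mod R S A B) \<longleftrightarrow>
    (\<forall>E i p. E \<in> RMod R S \<longrightarrow> short_exact R B i E p A \<longrightarrow>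
       (\<exists>s \<in> lin_hom R A E. \<forall>a \<in> carrier A. p (s a) = a))" (is "_ \<longleftrightarrow> ?split")
proof -
  note Am = RMod_module[OF A] and Bm = RMod_module[OF B]
  interpret A: abelian_group A using Am by (intro left_module_group)
  interpret B: abelian_group B using Bm by (intro left_module_group)
  let ?X = "mod_exts R S A B" and ?r = "mod_ext_equiv R S A B"
  \<comment> \<open>\<open>F\<close> with \<open>j\<close>, \<open>q\<close> and the section
    \<open>t\<close> is the split extension on the direct sum of \<open>B\<close> and
    \<open>A\<close>, copied into \<open>S\<close>.\<close>
  have "small S (carrier (pair_module B A))"
    using small_times[OF U RMod_small[OF B] RMod_small[OF A]] by simp
  then obtain F f g where F: "F \<in> RMod R S" "f \<in> lin_hom R (pair_module B A) F"
    "g \<in> lin_hom R F (pair_module B A)" "\<And>x. x \<in> carrier (pair_module B A) \<Longrightarrow> g (f x) = x"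
    "\<And>y. y \<in> carrier F \<Longrightarrow> f (g y) = y"
    by (rule small_module_copy[OF U pair_module[OF Bm Am]]) (rule that)
  define j where "j b = f (b, \<zero>\<^bsub>A\<^esub>)" for b
  define q where "q e = snd (g e)" for e
  define t where "t a = f (\<zero>\<^bsub>B\<^esub>, a)" for a
  have seF: "short_exact R B j F q A"
    unfolding j_def q_def by (rule short_exact_transport[OF short_exact_pair[OF Bm Am] F(2-5)])
  then have memF: "(j, F, q) \<in> ?X" using F(1) by (simp add: mod_exts_def)
  have t: "t \<in> lin_hom R A F"
    unfolding t_def using lin_hom_comp[OF lin_hom_pair[OF lin_hom_const_zero[OF Bm] lin_hom_id] F(2)] .
  have qt: "q (t a) = a" if "a \<in> carrier A" for a
    using F(4)[of "(\<zero>\<^bsub>B\<^esub>, a)"] that by (simp add: q_def t_def)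
  have sub: "?r \<subseteq> ?X \<times> ?X" by (auto simp: mod_ext_equiv_def)
  have refl: "(x, x) \<in> ?r" if "x \<in> ?X" for x
  proof -
    obtain i E p where x: "x = (i, E, p)" by (cases x)
    then show ?thesis
      using that lin_hom_id[of R E] by (auto simp: mod_ext_equiv_def intro!: bexI[of _ "\<lambda>x. x"] simp: bij_betw_def)
  qed
  have iff: "is_singleton (Ext1_Mod R S A B) \<longleftrightarrow> (\<forall>x \<in> ?X. \<forall>y \<in> ?X. (x, y) \<in> ?r)"
    unfolding Ext1_Mod_def using singleton_quotient_iff[OF sub refl] memF by blast
  show ?thesis
  proof
    assume s: "is_singleton (Ext1_Mod R S A B)"
    show ?split
    proof (intro allI impI)
      fix E i p assume E: "E \<in> RMod R S" "short_exact R B i E p A"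
      then have "(i, E, p) \<in> ?X" by (simp add: mod_exts_def)
      then have "((j, F, q), (i, E, p)) \<in> ?r" using iff s memF by blast
      then obtain h where h: "h \<in> lin_hom R F E" "\<forall>e \<in> carrier F. p (h e) = q e"
        by (auto simp: mod_ext_equiv_def)
      then show "\<exists>s \<in> lin_hom R A E. \<forall>a \<in> carrier A. p (s a) = a"
        using lin_hom_comp[OF t h(1)] qt lin_hom_closed[OF t] by (intro bexI[of _ "\<lambda>a. h (t a)"]) auto
    qed
  next
    assume split: ?split
    have "(x, y) \<in> ?r" if xy: "x \<in> ?X" "y \<in> ?X" for x y
    proof -
      obtain i E p i' E' p' where e: "x = (i, E, p)" "y = (i', E', p')" by (cases x; cases y)
      have E: "E \<in> RMod R S" "short_exact R B i E p A" "E' \<in> RMod R S" "short_exact R B i' E' p' A"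
        using xy e by (auto simp: mod_exts_def)
      obtain s where s: "s \<in> lin_hom R A E" "\<forall>a \<in> carrier A. p (s a) = a"
        using split[rule_format, OF E(1,2)] by blast
      obtain s' where s': "s' \<in> lin_hom R A E'" "\<forall>a \<in> carrier A. p' (s' a) = a"
        using split[rule_format, OF E(3,4)] by blast
      obtain h where "h \<in> lin_hom R E E'" "bij_betw h (carrier E) (carrier E')"
        "\<And>b. b \<in> carrier B \<Longrightarrow> h (i b) = i' b" "\<And>e. e \<in> carrier E \<Longrightarrow> p' (h e) = p e"
        by (rule split_extension_map[OF E(2) Bm RMod_module[OF E(1)] Am s(1) _ E(4) RMod_module[OF E(3)] s'(1)])
          (use s(2) s'(2) in \<open>auto intro: that\<close>)
      then show ?thesis using xy e by (auto simp: mod_ext_equiv_def)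
    qed
    then show "is_singleton (Ext1_Mod R S A B)" using iff by blast
  qed
qed

section \<open>Chain complexes\<close>

lemma Ch_obj: "C \<in> Ch R S \<Longrightarrow> obj C n \<in> RMod R S"
  by (simp add: Ch_def)

lemma Ch_module: "C \<in> Ch R S \<Longrightarrow> left_module R (obj C n)"
  by (blast intro: RMod_module Ch_obj)

lemma Ch_group: "C \<in> Ch R S \<Longrightarrow> abelian_group (obj C n)"
  by (drule Ch_module) (erule left_module_group)

lemma Ch_bd: "C \<in> Ch R S \<Longrightarrow> bd C n \<in> lin_hom R (obj C n) (obj C (n - 1))"
  by (simp add: Ch_def)

lemma Ch_bd_closed: "\<lbrakk>C \<in> Ch R S; x \<in> carrier (obj C n)\<rbrakk> \<Longrightarrow> bd C n x \<in> carrier (obj C (n - 1))"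
  by (blast intro: lin_hom_closed Ch_bd)

text \<open>The defining condition read at \<open>n - 1\<close>, with \<open>n - 2\<close> in the
  form to which the simplifier brings \<open>n - 1 - 1\<close>.\<close>

lemma Ch_bd_bd:
  "\<lbrakk>C \<in> Ch R S; x \<in> carrier (obj C n)\<rbrakk> \<Longrightarrow> bd C (n - 1) (bd C n x) = \<zero>\<^bsub>obj C (n - 2)\<^esub>"
proof -
  assume "C \<in> Ch R S" "x \<in> carrier (obj C n)"
  then have "\<forall>x\<in>carrier (obj C (n - 1 + 1)). bd C (n - 1) (bd C (n - 1 + 1) x) = \<zero>\<^bsub>obj C (n - 1 - 1)\<^esub>"
    unfolding Ch_def by blast
  then show ?thesis using \<open>x \<in> carrier (obj C n)\<close> by simp
qed

lemma Ch_bd_zero: "C \<in> Ch R S \<Longrightarrow> bd C n \<zero>\<^bsub>obj C n\<^esub> = \<zero>\<^bsub>obj C (n - 1)\<^esub>"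
  using lin_hom_zero[OF Ch_bd Ch_group Ch_group] by blast

lemma ChI:
  assumes "\<And>n. obj C n \<in> RMod R S" "\<And>n. bd C n \<in> lin_hom R (obj C n) (obj C (n - 1))"
    and "\<And>n x. x \<in> carrier (obj C n) \<Longrightarrow> bd C (n - 1) (bd C n x) = \<zero>\<^bsub>obj C (n - 2)\<^esub>"
  shows "C \<in> Ch R S"
proof -
  have "bd C n (bd C (n + 1) x) = \<zero>\<^bsub>obj C (n - 1)\<^esub>" if "x \<in> carrier (obj C (n + 1))" for n x
    using assms(3)[OF that] by simp
  then show ?thesis using assms(1,2) by (simp add: Ch_def)
qed

lemma RMod_UNIV: "M \<in> RMod R UNIV \<longleftrightarrow> left_module R M"
  by (simp add: RMod_def)

text \<open>\<open>UNIV\<close> as the collection of small sets drops the size condition: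
  \<open>Ch R UNIV\<close> consists of all complexes on the type in question.\<close>

lemma Ch_UNIV: "C \<in> Ch R S \<Longrightarrow> C \<in> Ch R UNIV"
  by (auto simp: Ch_def RMod_def)

lemma chain_map_hom: "f \<in> chain_map R C D \<Longrightarrow> f n \<in> lin_hom R (obj C n) (obj D n)"
  by (simp add: chain_map_def)

lemma chain_map_closed:
  "\<lbrakk>f \<in> chain_map R C D; x \<in> carrier (obj C n)\<rbrakk> \<Longrightarrow> f n x \<in> carrier (obj D n)"
  by (blast intro: lin_hom_closed chain_map_hom)

lemma chain_map_bd:
  "\<lbrakk>f \<in> chain_map R C D; x \<in> carrier (obj C n)\<rbrakk> \<Longrightarrow> bd D n (f n x) = f (n - 1) (bd C n x)"
  by (simp add: chain_map_def)

lemma chain_mapI: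
  assumes "\<And>n. f n \<in> lin_hom R (obj C n) (obj D n)"
    and "\<And>n x. x \<in> carrier (obj C n) \<Longrightarrow> bd D n (f n x) = f (n - 1) (bd C n x)"
  shows "f \<in> chain_map R C D"
  using assms by (simp add: chain_map_def)

lemma chain_map_comp:
  assumes "C \<in> Ch R S" "f \<in> chain_map R C D" "g \<in> chain_map R D E"
  shows "(\<lambda>n x. g n (f n x)) \<in> chain_map R C E"
  by (rule chain_mapI)
    (use assms in \<open>auto intro: lin_hom_comp chain_map_hom simp: chain_map_bd chain_map_closed\<close>)

lemma chain_map_id: "(\<lambda>n x. x) \<in> chain_map R C C"
  by (rule chain_mapI) (auto intro: lin_hom_id)

lemma chain_map_zero:
  "f \<in> chain_map R C D \<Longrightarrow> C \<in> Ch R S \<Longrightarrow> D \<in> Ch R S' \<Longrightarrow> f n \<zero>\<^bsub>obj C n\<^esub> = \<zero>\<^bsub>obj D n\<^esub>"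
  using lin_hom_zero[OF chain_map_hom Ch_group Ch_group] by blast

text \<open>The terms are copied degree by degree, and the boundary is conjugated by the resulting
  isomorphisms.\<close>

lemma small_complex_copy:
  fixes E :: "('r, 'a) chain_complex" and S :: "'m set set"
  assumes U: "module_universe R S" and E: "E \<in> Ch R UNIV" and sm: "\<And>n. small S (carrier (obj E n))"
  obtains F :: "('r, 'm) chain_complex" and f g
    where "F \<in> Ch R S" "f \<in> chain_map R E F" "g \<in> chain_map R F E"
    "\<And>n x. x \<in> carrier (obj E n) \<Longrightarrow> g n (f n x) = x"
    "\<And>n y. y \<in> carrier (obj F n) \<Longrightarrow> f n (g n y) = y"
proof -
  have "\<exists>N f g. N \<in> RMod R S \<and> f \<in> lin_hom R (obj E n) N \<and> g \<in> lin_hom R N (obj E n) \<and>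
    (\<forall>x \<in> carrier (obj E n). g (f x) = x) \<and> (\<forall>y \<in> carrier N. f (g y) = y)" for n
    by (rule small_module_copy[OF U Ch_module[OF E] sm[of n]]) blast
  then obtain N f g where N: "\<And>n. N n \<in> RMod R S"
    and f: "\<And>n. f n \<in> lin_hom R (obj E n) (N n)" and g: "\<And>n. g n \<in> lin_hom R (N n) (obj E n)"
    and gf: "\<And>n x. x \<in> carrier (obj E n) \<Longrightarrow> g n (f n x) = x"
    and fg: "\<And>n y. y \<in> carrier (N n) \<Longrightarrow> f n (g n y) = y"
    by metis
  note c = lin_hom_closed[OF f] lin_hom_closed[OF g] Ch_bd_closed[OF E]
  let ?F = "\<lparr>obj = N, bd = (\<lambda>n x. f (n - 1) (bd E n (g n x)))\<rparr>"
  have F: "?F \<in> Ch R S"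
  proof (rule ChI)
    show "bd ?F n \<in> lin_hom R (obj ?F n) (obj ?F (n - 1))" for n
      using lin_hom_comp[OF lin_hom_comp[OF g Ch_bd[OF E]] f] by simp
    show "bd ?F (n - 1) (bd ?F n x) = \<zero>\<^bsub>obj ?F (n - 2)\<^esub>" if "x \<in> carrier (obj ?F n)" for n x
      using that c gf Ch_bd_bd[OF E, of "g n x" n]
        lin_hom_zero[OF f[of "n - 2"] Ch_group[OF E] left_module_group[OF RMod_module[OF N]]]
      by simp
  qed (use N in simp)
  have fF: "f \<in> chain_map R E ?F" by (rule chain_mapI) (use f gf in simp_all)
  have gF: "g \<in> chain_map R ?F E" by (rule chain_mapI) (use g gf c in simp_all)
  have "f n (g n y) = y" if "y \<in> carrier (obj ?F n)" for n y using that fg by simp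
  note fgF = this
  show thesis by (rule that[OF F fF gF gf fgF])
qed

section \<open>Vanishing of Ext for complexes\<close>

text \<open>The three complexes may have different types and no size bound applies, so pullbacks,
  pushouts and twisted sums are instances.\<close>

locale ch_extension =
  fixes R :: "('r, 'e) ring_scheme" and B :: "('r, 'b) chain_complex" and i
    and E :: "('r, 'c) chain_complex" and p and A :: "('r, 'a) chain_complex"
  assumes B: "B \<in> Ch R UNIV" and E: "E \<in> Ch R UNIV" and A: "A \<in> Ch R UNIV"
    and i: "i \<in> chain_map R B E" and p: "p \<in> chain_map R E A"
    and se: "\<And>n. short_exact R (obj B n) (i n) (obj E n) (p n) (obj A n)"
begin

lemmas D = short_exactD[OF se]

definition section_map where
  "section_map s \<longleftrightarrow> s \<in> chain_map R A E \<and> (\<forall>n. \<forall>a \<in> carrier (obj A n). p n (s n a) = a)"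

definition retraction_map where
  "retraction_map r \<longleftrightarrow> r \<in> chain_map R E B \<and> (\<forall>n. \<forall>b \<in> carrier (obj B n). r n (i n b) = b)"

text \<open>The degreewise retraction complementary to a chain section is a chain map: write
  \<open>e\<close> as \<open>i (r e) + s (p e)\<close>, take the boundary, which commutes with
  \<open>i\<close> and \<open>s\<close>, and apply \<open>r\<close>.\<close>

lemma retraction_of_section_map:
  assumes "section_map s"
  obtains r where "retraction_map r"
proof -
  have s: "s \<in> chain_map R A E" "\<And>n a. a \<in> carrier (obj A n) \<Longrightarrow> p n (s n a) = a"
    using assms by (auto simp: section_map_def)
  have "\<exists>r. r \<in> lin_hom R (obj E n) (obj B n) \<and> (\<forall>b \<in> carrier (obj B n). r (i n b) = b) \<and>
    (\<forall>a \<in> carrier (obj A n). r (s n a) = \<zero>\<^bsub>obj B n\<^esub>) \<and>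
    (\<forall>e \<in> carrier (obj E n). i n (r e) \<oplus>\<^bsub>obj E n\<^esub> s n (p n e) = e)" for n
    by (rule retraction_of_section[OF se Ch_module[OF B] Ch_module[OF E] Ch_module[OF A]
        chain_map_hom[OF s(1)]], erule s(2)) blast
  then obtain r where r: "\<And>n. r n \<in> lin_hom R (obj E n) (obj B n)"
    "\<And>n b. b \<in> carrier (obj B n) \<Longrightarrow> r n (i n b) = b"
    "\<And>n a. a \<in> carrier (obj A n) \<Longrightarrow> r n (s n a) = \<zero>\<^bsub>obj B n\<^esub>"
    "\<And>n e. e \<in> carrier (obj E n) \<Longrightarrow> i n (r n e) \<oplus>\<^bsub>obj E n\<^esub> s n (p n e) = e"
    by metis
  note c = chain_map_closed[OF i] chain_map_closed[OF p] chain_map_closed[OF s(1)] lin_hom_closed[OF r(1)]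
    Ch_bd_closed[OF A] Ch_bd_closed[OF B] Ch_bd_closed[OF E]
  have "r \<in> chain_map R E B"
  proof (rule chain_mapI)
    fix n e assume e: "e \<in> carrier (obj E n)"
    interpret B: abelian_group "obj B (n - 1)" by (rule Ch_group[OF B])
    let ?b = "r n e" and ?a = "p n e"
    have "bd E n e = bd E n (i n ?b \<oplus>\<^bsub>obj E n\<^esub> s n ?a)" using r(4)[OF e] by simp
    also have "\<dots> = i (n - 1) (bd B n ?b) \<oplus>\<^bsub>obj E (n - 1)\<^esub> s (n - 1) (bd A n ?a)"
      using e c by (simp add: lin_hom_add[OF Ch_bd[OF E]] chain_map_bd[OF i] chain_map_bd[OF s(1)])
    finally have "r (n - 1) (bd E n e) = bd B n ?b"
      using e c by (simp add: lin_hom_add[OF r(1)] r(2,3))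
    then show "bd B n (r n e) = r (n - 1) (bd E n e)" by simp
  qed (rule r(1))
  then show thesis using r(2) by (intro that[of r]) (simp add: retraction_map_def)
qed

end

text \<open>The direct sum with an upper triangular boundary. When \<open>h\<close> is a chain map
  from \<open>A\<close> to \<open>shift (- 1) B\<close>, this is its mapping cone up to a shift and
  signs.\<close>

definition twist :: "('r, 'b) chain_complex \<Rightarrow> ('r, 'a) chain_complex \<Rightarrow> (int \<Rightarrow> 'a \<Rightarrow> 'b)
    \<Rightarrow> ('r, 'b \<times> 'a) chain_complex" where
  "twist B A h = \<lparr>obj = (\<lambda>n. pair_module (obj B n) (obj A n)),
     bd = (\<lambda>n x. (bd B n (fst x) \<oplus>\<^bsub>obj B (n - 1)\<^esub> h n (snd x), bd A n (snd x)))\<rparr>"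

lemma twist_simps [simp]:
  "obj (twist B A h) n = pair_module (obj B n) (obj A n)"
  "bd (twist B A h) n x = (bd B n (fst x) \<oplus>\<^bsub>obj B (n - 1)\<^esub> h n (snd x), bd A n (snd x))"
  by (simp_all add: twist_def)

text \<open>Applying the boundary twice to \<open>(b, a)\<close> leaves
  \<open>bd (h a) + h (bd a)\<close> in the first component, so \<open>anti\<close> is what makes
  the twisted sum a complex.\<close>

lemma twist_extension:
  fixes B :: "('r, 'b) chain_complex" and A :: "('r, 'a) chain_complex"
  assumes B: "B \<in> Ch R UNIV" and A: "A \<in> Ch R UNIV"
    and h: "\<And>n. h n \<in> lin_hom R (obj A n) (obj B (n - 1))"
    and anti: "\<And>n a. a \<in> carrier (obj A n) \<Longrightarrow>
      bd B (n - 1) (h n a) \<oplus>\<^bsub>obj B (n - 2)\<^esub> h (n - 1) (bd A n a) = \<zero>\<^bsub>obj B (n - 2)\<^esub>"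
  shows "ch_extension R B (\<lambda>n b. (b, \<zero>\<^bsub>obj A n\<^esub>)) (twist B A h) (\<lambda>n. snd) A"
proof -
  note c = Ch_bd_closed[OF A] Ch_bd_closed[OF B] lin_hom_closed[OF h]
  have bdh: "bd (twist B A h) n \<in> lin_hom R (obj (twist B A h) n) (obj (twist B A h) (n - 1))" for n
    using lin_hom_pair[OF lin_hom_sum[OF Ch_module[OF B] lin_hom_comp[OF lin_hom_fst Ch_bd[OF B]]
        lin_hom_comp[OF lin_hom_snd h]] lin_hom_comp[OF lin_hom_snd Ch_bd[OF A]]]
    by (simp add: twist_def)
  have E: "twist B A h \<in> Ch R UNIV"
  proof (rule ChI)
    show "obj (twist B A h) n \<in> RMod R UNIV" for n
      using pair_module[OF Ch_module[OF B] Ch_module[OF A]] by (simp add: RMod_UNIV)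
    fix n x assume "x \<in> carrier (obj (twist B A h) n)"
    then obtain b a where x: "x = (b, a)" "b \<in> carrier (obj B n)" "a \<in> carrier (obj A n)" by auto
    interpret B2: abelian_group "obj B (n - 2)" by (rule Ch_group[OF B])
    have "bd B (n - 1) (h n a) \<in> carrier (obj B (n - 2))" "h (n - 1) (bd A n a) \<in> carrier (obj B (n - 2))"
      using c(2)[of "h n a" "n - 1"] c(3)[of "bd A n a" "n - 1"] c x by simp_all
    then show "bd (twist B A h) (n - 1) (bd (twist B A h) n x) = \<zero>\<^bsub>obj (twist B A h) (n - 2)\<^esub>"
      using x c lin_hom_add[OF Ch_bd[OF B], of "bd B n b" "n - 1" "h n a"] anti[OF x(3)]
        Ch_bd_bd[OF B x(2)] Ch_bd_bd[OF A x(3)]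
      by simp
  qed (rule bdh)
  show ?thesis
  proof (rule ch_extension.intro)
    show se: "short_exact R (obj B n) (\<lambda>b. (b, \<zero>\<^bsub>obj A n\<^esub>)) (obj (twist B A h) n) snd (obj A n)" for n
      using short_exact_pair[OF Ch_module[OF B] Ch_module[OF A]] by simp
    show "(\<lambda>n b. (b, \<zero>\<^bsub>obj A n\<^esub>)) \<in> chain_map R B (twist B A h)" "(\<lambda>n. snd) \<in> chain_map R (twist B A h) A"
      using lin_hom_zero[OF h Ch_group[OF A] Ch_group[OF B]] c abelian_monoid.r_zero[OF abelian_group.axioms(1)[OF Ch_group[OF B]]]
      by (auto intro!: chain_mapI simp: Ch_bd_zero[OF A] simp del: twist_simps(1)
          intro: short_exactD(1,2)[OF se])
  qed (rule B A E)+
qed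

text \<open>The outer terms alone bound the size of \<open>E\<close>, so the extension has a copy
  with middle term in \<open>Ch R S\<close>, where Ext can see it.\<close>

lemma (in ch_extension) small_copy:
  fixes S :: "'m set set"
  assumes U: "module_universe R S" and sm: "\<And>n. small S (carrier (obj B n))" "\<And>n. small S (carrier (obj A n))"
  obtains F :: "('r, 'm) chain_complex" and f g
    where "F \<in> Ch R S" "f \<in> chain_map R E F" "g \<in> chain_map R F E"
    "\<And>n x. x \<in> carrier (obj E n) \<Longrightarrow> g n (f n x) = x"
    "ch_extension R B (\<lambda>n b. f n (i n b)) F (\<lambda>n e. p n (g n e)) A"
proof -
  have "small S (carrier (obj E n))" for n
    using small_extension[OF U se Ch_module[OF B] Ch_module[OF E] Ch_module[OF A] sm] .
  then obtain F :: "('r, 'm) chain_complex" and f g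
    where F: "F \<in> Ch R S" "f \<in> chain_map R E F" "g \<in> chain_map R F E"
    "\<forall>n. \<forall>x \<in> carrier (obj E n). g n (f n x) = x"
    "\<forall>n. \<forall>y \<in> carrier (obj F n). f n (g n y) = y"
    using small_complex_copy[OF U E] by metis
  have "ch_extension R B (\<lambda>n b. f n (i n b)) F (\<lambda>n e. p n (g n e)) A"
    by (intro ch_extension.intro B A Ch_UNIV[OF F(1)] chain_map_comp[OF B i F(2)]
        chain_map_comp[OF Ch_UNIV[OF F(1)] F(3) p]
        short_exact_transport[OF se chain_map_hom[OF F(2)] chain_map_hom[OF F(3)]])
      (use F(4,5) in auto)
  then show thesis using that F by blast
qed

lemma ch_exts_iff:
  assumes "A \<in> Ch R S" "B \<in> Ch R S"
  shows "(i, E, p) \<in> ch_exts R S A B \<longleftrightarrow> E \<in> Ch R S \<and> ch_extension R B i E p A"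
  using assms by (auto simp: ch_exts_def ch_extension_def Ch_UNIV)

text \<open>As for modules, with one more point: the degreewise comparison maps commute with the
  boundaries. They send \<open>i b + s a\<close> to \<open>i' b + s' a\<close>, and all four maps
  are chain maps.\<close>

lemma Ext1_Ch_singleton_iff:
  fixes A B :: "('r, 'm) chain_complex"
  assumes U: "module_universe R S" and A: "A \<in> Ch R S" and B: "B \<in> Ch R S"
  shows "is_singleton (Ext1_Ch R S A B) \<longleftrightarrow>
    (\<forall>E i p. E \<in> Ch R S \<longrightarrow> ch_extension R B i E p A \<longrightarrow> Ex (ch_extension.section_map R E p A))"
    (is "_ \<longleftrightarrow> ?split")
proof -
  let ?X = "ch_exts R S A B" and ?r = "ch_ext_equiv R S A B"
  \<comment> \<open>The twisted sum with \<open>h = 0\<close> is the direct sum of complexes; this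
    is the split extension to compare with.\<close>
  let ?P = "twist B A (\<lambda>n a. \<zero>\<^bsub>obj B (n - 1)\<^esub>)"
  interpret P: ch_extension R B "\<lambda>n b. (b, \<zero>\<^bsub>obj A n\<^esub>)" ?P "\<lambda>n. snd" A
  proof (rule twist_extension[OF Ch_UNIV[OF B] Ch_UNIV[OF A]])
    show "bd B (n - 1) \<zero>\<^bsub>obj B (n - 1)\<^esub> \<oplus>\<^bsub>obj B (n - 2)\<^esub> \<zero>\<^bsub>obj B (n - 1 - 1)\<^esub> = \<zero>\<^bsub>obj B (n - 2)\<^esub>" for n
      using Ch_bd_zero[OF B, of "n - 1"] abelian_groupE(2,5)[OF Ch_group[OF B, of "n - 2"]] by simp
  qed (rule lin_hom_const_zero[OF Ch_module[OF B]])
  obtain F :: "('r, 'm) chain_complex" and f g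
    where F: "F \<in> Ch R S" "f \<in> chain_map R ?P F" "g \<in> chain_map R F ?P"
    and gf: "\<And>n x. x \<in> carrier (obj ?P n) \<Longrightarrow> g n (f n x) = x"
    and extF: "ch_extension R B (\<lambda>n b. f n (b, \<zero>\<^bsub>obj A n\<^esub>)) F (\<lambda>n e. snd (g n e)) A"
    using P.small_copy[OF U RMod_small[OF Ch_obj[OF B]] RMod_small[OF Ch_obj[OF A]]] by blast
  define j where "j n b = f n (b, \<zero>\<^bsub>obj A n\<^esub>)" for n b
  define q where "q n e = snd (g n e)" for n e
  define t where "t n a = f n (\<zero>\<^bsub>obj B n\<^esub>, a)" for n a
  have memF: "(j, F, q) \<in> ?X"
    using extF F(1) unfolding ch_exts_iff[OF A B] j_def q_def by simp
  have zB: "\<zero>\<^bsub>obj B n\<^esub> \<in> carrier (obj B n)" "\<zero>\<^bsub>obj B n\<^esub> \<oplus>\<^bsub>obj B n\<^esub> \<zero>\<^bsub>obj B n\<^esub> = \<zero>\<^bsub>obj B n\<^esub>" for n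
    using abelian_groupE(2,5)[OF Ch_group[OF B, of n]] by simp_all
  have "(\<lambda>n a. (\<zero>\<^bsub>obj B n\<^esub>, a)) \<in> chain_map R A ?P"
    by (rule chain_mapI)
      (simp_all add: lin_hom_pair[OF lin_hom_const_zero[OF Ch_module[OF B]] lin_hom_id] Ch_bd_zero[OF B] zB)
  then have t: "t \<in> chain_map R A F"
    unfolding t_def using chain_map_comp[OF A _ F(2)] by blast
  have qt: "q n (t n a) = a" if "a \<in> carrier (obj A n)" for n a
    using gf[of "(\<zero>\<^bsub>obj B n\<^esub>, a)" n] that zB by (simp add: q_def t_def)
  have sub: "?r \<subseteq> ?X \<times> ?X" by (auto simp: ch_ext_equiv_def)
  have refl: "(x, x) \<in> ?r" if "x \<in> ?X" for x
  proof -
    obtain i E p where x: "x = (i, E, p)" by (cases x)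
    then show ?thesis
      using that chain_map_id[of R E]
      by (auto simp: ch_ext_equiv_def bij_betw_def intro!: bexI[of _ "\<lambda>n x. x"])
  qed
  have iff: "is_singleton (Ext1_Ch R S A B) \<longleftrightarrow> (\<forall>x \<in> ?X. \<forall>y \<in> ?X. (x, y) \<in> ?r)"
    unfolding Ext1_Ch_def using singleton_quotient_iff[OF sub refl] memF by blast
  show ?thesis
  proof
    assume s: "is_singleton (Ext1_Ch R S A B)"
    show ?split
    proof (intro allI impI)
      fix E i p assume E: "E \<in> Ch R S" "ch_extension R B i E p A"
      then have "(i, E, p) \<in> ?X" by (simp add: ch_exts_iff[OF A B])
      then have "((j, F, q), (i, E, p)) \<in> ?r" using iff s memF by blast
      then obtain h where h: "h \<in> chain_map R F E" "\<forall>n. \<forall>e \<in> carrier (obj F n). p n (h n e) = q n e"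
        by (auto simp: ch_ext_equiv_def)
      then show "Ex (ch_extension.section_map R E p A)"
        using chain_map_comp[OF A t h(1)] qt chain_map_closed[OF t]
        by (intro exI[of _ "\<lambda>n a. h n (t n a)"]) (simp add: ch_extension.section_map_def[OF E(2)])
    qed
  next
    assume split: ?split
    have "(x, y) \<in> ?r" if xy: "x \<in> ?X" "y \<in> ?X" for x y
    proof -
      obtain i E p i' E' p' where e: "x = (i, E, p)" "y = (i', E', p')" by (cases x; cases y)
      have ex: "ch_extension R B i E p A" "ch_extension R B i' E' p' A" and EE: "E \<in> Ch R S" "E' \<in> Ch R S"
        using xy e by (auto simp: ch_exts_iff[OF A B])
      interpret X: ch_extension R B i E p A by fact
      interpret Y: ch_extension R B i' E' p' A by fact
      obtain s s' where "X.section_map s" and "Y.section_map s'"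
        using split[rule_format, OF EE(1) ex(1)] split[rule_format, OF EE(2) ex(2)] by blast
      then have s: "s \<in> chain_map R A E" "\<And>n a. a \<in> carrier (obj A n) \<Longrightarrow> p n (s n a) = a"
        and s': "s' \<in> chain_map R A E'" "\<And>n a. a \<in> carrier (obj A n) \<Longrightarrow> p' n (s' n a) = a"
        by (auto simp: X.section_map_def Y.section_map_def)
      have "\<exists>h. h \<in> lin_hom R (obj E n) (obj E' n) \<and> bij_betw h (carrier (obj E n)) (carrier (obj E' n)) \<and>
        (\<forall>b \<in> carrier (obj B n). h (i n b) = i' n b) \<and> (\<forall>a \<in> carrier (obj A n). h (s n a) = s' n a) \<and>
        (\<forall>e \<in> carrier (obj E n). p' n (h e) = p n e)" for n
        by (rule split_extension_map[OF X.se Ch_module[OF B] Ch_module[OF EE(1)] Ch_module[OF A]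
              chain_map_hom[OF s(1)] _ Y.se Ch_module[OF EE(2)] chain_map_hom[OF s'(1)]])
          (use s(2) s'(2) in auto)
      then obtain h where h: "\<And>n. h n \<in> lin_hom R (obj E n) (obj E' n)"
        "\<And>n. bij_betw (h n) (carrier (obj E n)) (carrier (obj E' n))"
        "\<And>n b. b \<in> carrier (obj B n) \<Longrightarrow> h n (i n b) = i' n b"
        "\<And>n a. a \<in> carrier (obj A n) \<Longrightarrow> h n (s n a) = s' n a"
        "\<And>n e. e \<in> carrier (obj E n) \<Longrightarrow> p' n (h n e) = p n e"
        by metis
      note c = chain_map_closed[OF X.i] chain_map_closed[OF Y.i] chain_map_closed[OF s(1)]
        chain_map_closed[OF s'(1)] chain_map_closed[OF X.p] Ch_bd_closed[OF A] Ch_bd_closed[OF B] lin_hom_closed[OF h(1)]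
      have "h \<in> chain_map R E E'"
      proof (rule chain_mapI)
        fix n e assume e: "e \<in> carrier (obj E n)"
        have "s n (p n e) \<in> carrier (obj E n)" "p n e = p n (s n (p n e))" using e c s(2) by simp_all
        then obtain b where b: "b \<in> carrier (obj B n)" "e = i n b \<oplus>\<^bsub>obj E n\<^esub> s n (p n e)"
          by (rule short_exact_diff[OF X.se Ch_module[OF EE(1)] Ch_module[OF A] e])
        \<comment> \<open>Naming \<open>p n e\<close> keeps \<open>e\<close> off the right-hand side
          of \<open>a(2)\<close>, so that unfolding this equation does not loop.\<close>
        define a where "a = p n e"
        have a: "a \<in> carrier (obj A n)" "e = i n b \<oplus>\<^bsub>obj E n\<^esub> s n a" using b e c by (simp_all add: a_def)
        show "bd E' n (h n e) = h (n - 1) (bd E n e)"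
          unfolding a(2) using a(1) b(1) c
          by (simp add: lin_hom_add[OF h(1)] lin_hom_add[OF Ch_bd[OF EE(1)]] lin_hom_add[OF Ch_bd[OF EE(2)]]
              h(3,4) chain_map_bd[OF X.i] chain_map_bd[OF Y.i] chain_map_bd[OF s(1)] chain_map_bd[OF s'(1)])
      qed (rule h(1))
      then have "\<exists>f \<in> chain_map R E E'. \<forall>n. bij_betw (f n) (carrier (obj E n)) (carrier (obj E' n)) \<and>
        (\<forall>x \<in> carrier (obj B n). f n (i n x) = i' n x) \<and> (\<forall>e \<in> carrier (obj E n). p' n (f n e) = p n e)"
        using h(2,3,5) by (intro bexI[of _ h]) simp_all
      then show ?thesis using xy e by (simp add: ch_ext_equiv_def)
    qed
    then show "is_singleton (Ext1_Ch R S A B)" using iff by blast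
  qed
qed

text \<open>Vanishing of Ext concerns middle terms in \<open>Ch R S\<close> only. Here
  \<open>E\<close> has any type: its small copy is split, and the section is carried back along the
  isomorphism.\<close>

lemma section_map_exists:
  fixes S :: "'m set set" and A B :: "('r, 'm) chain_complex" and E :: "('r, 'c) chain_complex"
  assumes U: "module_universe R S" and AS: "A \<in> Ch R S" and BS: "B \<in> Ch R S"
    and sing: "is_singleton (Ext1_Ch R S A B)" and ext: "ch_extension R B i E p A"
  obtains s where "s \<in> chain_map R A E" "\<And>n a. a \<in> carrier (obj A n) \<Longrightarrow> p n (s n a) = a"
proof -
  interpret ch_extension R B i E p A by fact
  obtain F :: "('r, 'm) chain_complex" and f g
    where F: "F \<in> Ch R S" "f \<in> chain_map R E F" "g \<in> chain_map R F E"
    and extF: "ch_extension R B (\<lambda>n b. f n (i n b)) F (\<lambda>n e. p n (g n e)) A"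
    by (rule small_copy[OF U RMod_small[OF Ch_obj[OF BS]] RMod_small[OF Ch_obj[OF AS]]]) (rule that)
  obtain s where "ch_extension.section_map R F (\<lambda>n e. p n (g n e)) A s"
    using sing[unfolded Ext1_Ch_singleton_iff[OF U AS BS], rule_format, OF F(1) extF] by blast
  then have s: "s \<in> chain_map R A F" "\<forall>n. \<forall>a \<in> carrier (obj A n). p n (g n (s n a)) = a"
    by (auto simp: ch_extension.section_map_def[OF extF])
  show thesis by (rule that[OF chain_map_comp[OF A s(1) F(3)]]) (use s(2) in simp)
qed

section \<open>Extending and lifting chain maps\<close>

text \<open>A section of the twisted sum has the form \<open>(t a, a)\<close>, and the first
  component of its compatibility with the boundaries is the asserted equation. Up to sign,
  \<open>t\<close> is a contraction of \<open>h\<close>.\<close>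

lemma twist_homotopy:
  fixes S :: "'m set set" and A B :: "('r, 'm) chain_complex"
  assumes U: "module_universe R S" and A: "A \<in> Ch R S" and B: "B \<in> Ch R S"
    and sing: "is_singleton (Ext1_Ch R S A B)"
    and h: "\<And>n. h n \<in> lin_hom R (obj A n) (obj B (n - 1))"
    and anti: "\<And>n a. a \<in> carrier (obj A n) \<Longrightarrow>
      bd B (n - 1) (h n a) \<oplus>\<^bsub>obj B (n - 2)\<^esub> h (n - 1) (bd A n a) = \<zero>\<^bsub>obj B (n - 2)\<^esub>"
  obtains t where "\<And>n. t n \<in> lin_hom R (obj A n) (obj B n)"
    and "\<And>n a. a \<in> carrier (obj A n) \<Longrightarrow> bd B n (t n a) \<oplus>\<^bsub>obj B (n - 1)\<^esub> h n a = t (n - 1) (bd A n a)"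
proof -
  have ext: "ch_extension R B (\<lambda>n b. (b, \<zero>\<^bsub>obj A n\<^esub>)) (twist B A h) (\<lambda>n. snd) A"
    by (rule twist_extension[OF Ch_UNIV[OF B] Ch_UNIV[OF A] h anti])
  obtain s where s: "s \<in> chain_map R A (twist B A h)" "\<And>n a. a \<in> carrier (obj A n) \<Longrightarrow> snd (s n a) = a"
    by (rule section_map_exists[OF U A B sing ext]) (rule that)
  show thesis
  proof (rule that)
    show "(\<lambda>a. fst (s n a)) \<in> lin_hom R (obj A n) (obj B n)" for n
      using lin_hom_comp[OF chain_map_hom[OF s(1), unfolded twist_simps] lin_hom_fst] .
    show "bd B n (fst (s n a)) \<oplus>\<^bsub>obj B (n - 1)\<^esub> h n a = fst (s (n - 1) (bd A n a))"
      if "a \<in> carrier (obj A n)" for n a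
      using chain_map_bd[OF s(1) that] s(2)[OF that] by (metis fst_conv twist_simps(2))
  qed
qed

section \<open>Direct sums, subcomplexes and pullbacks of extensions\<close>

definition pair_complex :: "('r, 'b) chain_complex \<Rightarrow> ('r, 'a) chain_complex \<Rightarrow> ('r, 'b \<times> 'a) chain_complex" where
  "pair_complex B A = \<lparr>obj = (\<lambda>n. pair_module (obj B n) (obj A n)),
     bd = (\<lambda>n x. (bd B n (fst x), bd A n (snd x)))\<rparr>"

lemma pair_complex_simps [simp]:
  "obj (pair_complex B A) n = pair_module (obj B n) (obj A n)"
  "bd (pair_complex B A) n x = (bd B n (fst x), bd A n (snd x))"
  by (simp_all add: pair_complex_def)

lemma pair_complex_Ch:
  assumes B: "B \<in> Ch R UNIV" and A: "A \<in> Ch R UNIV"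
  shows "pair_complex B A \<in> Ch R UNIV"
proof (rule ChI)
  show "obj (pair_complex B A) n \<in> RMod R UNIV" for n
    using pair_module[OF Ch_module[OF B] Ch_module[OF A]] by (simp add: RMod_UNIV)
  show "bd (pair_complex B A) n \<in> lin_hom R (obj (pair_complex B A) n) (obj (pair_complex B A) (n - 1))" for n
    using lin_hom_pair[OF lin_hom_comp[OF lin_hom_fst Ch_bd[OF B]] lin_hom_comp[OF lin_hom_snd Ch_bd[OF A]]]
    by (simp add: pair_complex_def)
qed (auto simp: Ch_bd_bd[OF A] Ch_bd_bd[OF B])

lemma lin_hom_restrict:
  "\<lbrakk>f \<in> lin_hom R M N; K \<subseteq> carrier M\<rbrakk> \<Longrightarrow> f \<in> lin_hom R (M\<lparr>carrier := K\<rparr>) N"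
  by (rule lin_homI) (auto simp: lin_hom_closed lin_hom_add lin_hom_smult subset_iff)

lemma lin_hom_corestrict:
  "\<lbrakk>f \<in> lin_hom R M N; \<And>x. x \<in> carrier M \<Longrightarrow> f x \<in> K\<rbrakk> \<Longrightarrow> f \<in> lin_hom R M (N\<lparr>carrier := K\<rparr>)"
  by (rule lin_homI) (auto simp: lin_hom_closed lin_hom_add lin_hom_smult)

lemma lin_hom_range: "f \<in> lin_hom R M (N\<lparr>carrier := K\<rparr>) \<Longrightarrow> K \<subseteq> carrier N \<Longrightarrow> f \<in> lin_hom R M N"
  using lin_hom_closed[of f R M "N\<lparr>carrier := K\<rparr>"] lin_hom_add[of f R M "N\<lparr>carrier := K\<rparr>"]
    lin_hom_smult[of f R M "N\<lparr>carrier := K\<rparr>"]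
  by (intro lin_homI) auto

lemma subcomplex_Ch:
  assumes P: "P \<in> Ch R UNIV" and K: "\<And>n. K n \<subseteq> carrier (obj P n)"
    "\<And>n. left_module R ((obj P n)\<lparr>carrier := K n\<rparr>)" "\<And>n x. x \<in> K n \<Longrightarrow> bd P n x \<in> K (n - 1)"
  shows "\<lparr>obj = (\<lambda>n. (obj P n)\<lparr>carrier := K n\<rparr>), bd = bd P\<rparr> \<in> Ch R UNIV"
proof (rule ChI)
  let ?Q = "\<lparr>obj = (\<lambda>n. (obj P n)\<lparr>carrier := K n\<rparr>), bd = bd P\<rparr>"
  show "bd ?Q n \<in> lin_hom R (obj ?Q n) (obj ?Q (n - 1))" for n
    using lin_hom_corestrict[OF lin_hom_restrict[OF Ch_bd[OF P] K(1)]] K(3) by simp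
  show "bd ?Q (n - 1) (bd ?Q n x) = \<zero>\<^bsub>obj ?Q (n - 2)\<^esub>" if "x \<in> carrier (obj ?Q n)" for n x
    using that K(1) Ch_bd_bd[OF P] by (auto simp: subset_iff)
qed (use K(2) in \<open>simp add: RMod_UNIV\<close>)

text \<open>The pairs \<open>(e, a)\<close> with \<open>p e = f a\<close> form an extension of
  \<open>A\<close> by \<open>B\<close>. It splits, and a section followed by the first projection is
  the lift.\<close>

lemma chain_map_lift:
  fixes S :: "'m set set" and A B :: "('r, 'm) chain_complex"
  assumes U: "module_universe R S" and A: "A \<in> Ch R S" and B: "B \<in> Ch R S"
    and sing: "is_singleton (Ext1_Ch R S A B)"
    and ext: "ch_extension R B i E p C" and f: "f \<in> chain_map R A C"
  obtains g where "g \<in> chain_map R A E" "\<And>n a. a \<in> carrier (obj A n) \<Longrightarrow> p n (g n a) = f n a"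
proof -
  interpret X: ch_extension R B i E p C by fact
  note AU = Ch_UNIV[OF A]
  let ?P = "pair_complex E A"
  define K where "K n = {x \<in> carrier (obj ?P n). p n (fst x) = f n (snd x)}" for n
  note K = K_def
  let ?Q = "\<lparr>obj = (\<lambda>n. (obj ?P n)\<lparr>carrier := K n\<rparr>), bd = bd ?P\<rparr>"
  note lin = lin_hom_add[OF chain_map_hom[OF X.p]] lin_hom_add[OF chain_map_hom[OF f]]
    lin_hom_smult[OF chain_map_hom[OF X.p]] lin_hom_smult[OF chain_map_hom[OF f]]
  note zero = chain_map_zero[OF X.p X.E X.A] chain_map_zero[OF f A X.A]
  note PC = pair_complex_Ch[OF X.E AU]
  have zc: "\<zero>\<^bsub>obj E n\<^esub> \<in> carrier (obj E n)" "\<zero>\<^bsub>obj A n\<^esub> \<in> carrier (obj A n)"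
    "\<zero>\<^bsub>obj C n\<^esub> \<in> carrier (obj C n)" for n
    using abelian_groupE(2) Ch_group[OF X.E] Ch_group[OF A] Ch_group[OF X.A] by blast+
  have Q: "?Q \<in> Ch R UNIV"
  proof (rule subcomplex_Ch[OF PC])
    show "left_module R ((obj ?P n)\<lparr>carrier := K n\<rparr>)" for n
      by (rule submodule[OF Ch_module[OF PC]])
        (auto simp: K lin zero zc abelian_groupE(1)[OF Ch_group[OF X.E]] abelian_groupE(1)[OF Ch_group[OF A]]
          left_module.smult_closed[OF Ch_module[OF X.E]] left_module.smult_closed[OF Ch_module[OF A]])
    show "bd ?P n x \<in> K (n - 1)" if "x \<in> K n" for n x
      using that by (auto simp: K Ch_bd_closed[OF X.E] Ch_bd_closed[OF A] chain_map_bd[OF X.p, symmetric]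
          chain_map_bd[OF f, symmetric])
  qed (auto simp: K)
  have jh: "(\<lambda>b. (i n b, \<zero>\<^bsub>obj A n\<^esub>)) \<in> lin_hom R (obj B n) (obj ?Q n)" for n
    using lin_hom_corestrict[OF lin_hom_pair[OF chain_map_hom[OF X.i] lin_hom_const_zero[OF Ch_module[OF A]]]]
      X.D(4) chain_map_closed[OF X.i] zc zero by (simp add: K)
  have sh: "snd \<in> lin_hom R (obj ?Q n) (obj A n)" for n
    using lin_hom_restrict[OF lin_hom_snd, of "K n"] by (auto simp: K)
  have extQ: "ch_extension R B (\<lambda>n b. (i n b, \<zero>\<^bsub>obj A n\<^esub>)) ?Q (\<lambda>n. snd) A"
  proof (rule ch_extension.intro)
    show "(\<lambda>n b. (i n b, \<zero>\<^bsub>obj A n\<^esub>)) \<in> chain_map R B ?Q"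
      by (rule chain_mapI[OF jh]) (simp add: chain_map_bd[OF X.i] Ch_bd_zero[OF A])
    show "(\<lambda>n. snd) \<in> chain_map R ?Q A" by (rule chain_mapI[OF sh]) simp
    show "short_exact R (obj B n) (\<lambda>b. (i n b, \<zero>\<^bsub>obj A n\<^esub>)) (obj ?Q n) snd (obj A n)" for n
    proof (rule short_exactI[OF jh sh])
      show "\<exists>b\<in>carrier (obj B n). e = (i n b, \<zero>\<^bsub>obj A n\<^esub>)"
        if "e \<in> carrier (obj ?Q n)" "snd e = \<zero>\<^bsub>obj A n\<^esub>" for e
        using that X.D(5)[of "fst e" n] zero by (cases e) (auto simp: K)
      show "\<exists>e\<in>carrier (obj ?Q n). snd e = a" if a: "a \<in> carrier (obj A n)" for a
        using X.D(6)[OF chain_map_closed[OF f a]] a by (fastforce simp: K)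
    qed (auto dest: X.D(3))
  qed (rule Ch_UNIV[OF B] Q AU)+
  obtain s where s: "s \<in> chain_map R A ?Q" "\<And>n a. a \<in> carrier (obj A n) \<Longrightarrow> snd (s n a) = a"
    by (rule section_map_exists[OF U A B sing extQ]) (rule that)
  have "(\<lambda>n. fst) \<in> chain_map R ?Q E"
    using lin_hom_restrict[OF lin_hom_fst, of "K _"] by (intro chain_mapI) (auto simp: K)
  then have "(\<lambda>n a. fst (s n a)) \<in> chain_map R A E" by (rule chain_map_comp[OF A s(1)])
  moreover have "p n (fst (s n a)) = f n a" if "a \<in> carrier (obj A n)" for n a
    using chain_map_closed[OF s(1) that] s(2)[OF that] by (simp add: K)
  ultimately show thesis by (rule that)
qed

section \<open>Factorisation through quotients and pushouts of extensions\<close>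

lemma (in abelian_group) minus_eq_zeroD:
  assumes "x \<in> carrier G" "y \<in> carrier G" "x \<ominus> y = \<zero>"
  shows "x = y"
proof -
  have "x = (x \<ominus> y) \<oplus> y" using assms(1,2) by (simp add: minus_eq a_assoc l_neg)
  then show ?thesis using assms by simp
qed

lemma lin_hom_injI:
  assumes f: "f \<in> lin_hom R M N" and M: "abelian_group M" and N: "abelian_group N"
    and ker: "\<And>x. \<lbrakk>x \<in> carrier M; f x = \<zero>\<^bsub>N\<^esub>\<rbrakk> \<Longrightarrow> x = \<zero>\<^bsub>M\<^esub>"
    and xy: "x \<in> carrier M" "y \<in> carrier M" "f x = f y"
  shows "x = y"
proof -
  interpret M: abelian_group M by fact
  interpret N: abelian_group N by fact
  have "f (x \<ominus>\<^bsub>M\<^esub> y) = \<zero>\<^bsub>N\<^esub>"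
    using lin_hom_diff[OF f M N xy(1,2)] xy lin_hom_closed[OF f] by (simp add: N.minus_eq N.r_neg)
  then have "x \<ominus>\<^bsub>M\<^esub> y = \<zero>\<^bsub>M\<^esub>" using ker[of "x \<ominus>\<^bsub>M\<^esub> y"] xy M.minus_closed by simp
  then show ?thesis by (rule M.minus_eq_zeroD[OF xy(1,2)])
qed

lemma lin_hom_factor:
  assumes M: "left_module R M" and N: "left_module R N" and P: "left_module R P"
    and q: "q \<in> lin_hom R M N" "q ` carrier M = carrier N"
    and g: "g \<in> lin_hom R M P" "\<And>x. x \<in> carrier M \<Longrightarrow> q x = \<zero>\<^bsub>N\<^esub> \<Longrightarrow> g x = \<zero>\<^bsub>P\<^esub>"
  obtains h where "h \<in> lin_hom R N P" "\<And>x. x \<in> carrier M \<Longrightarrow> h (q x) = g x"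
proof -
  interpret M: abelian_group M using M by (rule left_module_group)
  interpret N: abelian_group N using N by (rule left_module_group)
  interpret P: abelian_group P using P by (rule left_module_group)
  have eq: "g x = g y" if xy: "x \<in> carrier M" "y \<in> carrier M" "q x = q y" for x y
  proof -
    have "q (x \<ominus>\<^bsub>M\<^esub> y) = \<zero>\<^bsub>N\<^esub>"
      using lin_hom_diff[OF q(1) M.abelian_group_axioms N.abelian_group_axioms xy(1,2)] xy lin_hom_closed[OF q(1)]
      by (simp add: N.minus_eq N.r_neg)
    then have "g x \<ominus>\<^bsub>P\<^esub> g y = \<zero>\<^bsub>P\<^esub>"
      using g(2)[of "x \<ominus>\<^bsub>M\<^esub> y"] lin_hom_diff[OF g(1) M.abelian_group_axioms P.abelian_group_axioms xy(1,2)]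
        xy M.minus_closed by simp
    then show ?thesis using P.minus_eq_zeroD xy lin_hom_closed[OF g(1)] by blast
  qed
  define h where "h y = g (inv_into (carrier M) q y)" for y
  have hq: "h (q x) = g x" if "x \<in> carrier M" for x
    unfolding h_def using that by (intro eq) (auto simp: inv_into_into f_inv_into_f)
  have "h \<in> lin_hom R N P"
  proof (rule lin_homI)
    show "h y \<in> carrier P" if y: "y \<in> carrier N" for y
    proof -
      obtain u where "u \<in> carrier M" "y = q u" using y q(2) by blast
      then show ?thesis using hq lin_hom_closed[OF g(1)] by simp
    qed
    show "h (y \<oplus>\<^bsub>N\<^esub> z) = h y \<oplus>\<^bsub>P\<^esub> h z" if yz: "y \<in> carrier N" "z \<in> carrier N" for y z
    proof -
      obtain u v where uv: "u \<in> carrier M" "y = q u" "v \<in> carrier M" "z = q v"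
        using yz q(2) by blast
      then have "y \<oplus>\<^bsub>N\<^esub> z = q (u \<oplus>\<^bsub>M\<^esub> v)" by (simp add: lin_hom_add[OF q(1)])
      then show ?thesis using uv hq by (simp add: lin_hom_add[OF g(1)])
    qed
    show "h (a \<odot>\<^bsub>N\<^esub> y) = a \<odot>\<^bsub>P\<^esub> h y" if ay: "a \<in> carrier R" "y \<in> carrier N" for a y
    proof -
      obtain u where u: "u \<in> carrier M" "y = q u" using ay q(2) by blast
      then have "a \<odot>\<^bsub>N\<^esub> y = q (a \<odot>\<^bsub>M\<^esub> u)" using ay by (simp add: lin_hom_smult[OF q(1)])
      then show ?thesis
        using u hq ay left_module.smult_closed[OF M] by (simp add: lin_hom_smult[OF g(1)])
    qed
  qed
  then show thesis using hq by (rule that)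
qed

lemma quotient_complex_exists:
  fixes P :: "('r, 'a) chain_complex"
  assumes P: "P \<in> Ch R UNIV" and K: "\<And>n. K n \<subseteq> carrier (obj P n)"
    "\<And>n. left_module R ((obj P n)\<lparr>carrier := K n\<rparr>)" "\<And>n x. x \<in> K n \<Longrightarrow> bd P n x \<in> K (n - 1)"
  obtains Q :: "('r, 'a set) chain_complex" and q where "Q \<in> Ch R UNIV" "q \<in> chain_map R P Q"
    "\<And>n. q n ` carrier (obj P n) = carrier (obj Q n)"
    "\<And>n x. x \<in> carrier (obj P n) \<Longrightarrow> q n x = \<zero>\<^bsub>obj Q n\<^esub> \<longleftrightarrow> x \<in> K n"
proof -
  have "\<exists>(N :: ('r, 'a set) module) q. left_module R N \<and> q \<in> lin_hom R (obj P n) N \<and>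
    q ` carrier (obj P n) = carrier N \<and> a_kernel (obj P n) N q = K n" for n
    by (rule quotient_module_exists[OF Ch_module[OF P] K(1,2)[of n]]) blast
  then obtain N :: "int \<Rightarrow> ('r, 'a set) module" and q where N: "\<And>n. left_module R (N n)"
    and q: "\<And>n. q n \<in> lin_hom R (obj P n) (N n)" "\<And>n. q n ` carrier (obj P n) = carrier (N n)"
    and ker: "\<And>n. a_kernel (obj P n) (N n) (q n) = K n"
    by metis
  have qK: "q n x = \<zero>\<^bsub>N n\<^esub> \<longleftrightarrow> x \<in> K n" if "x \<in> carrier (obj P n)" for n x
    using that ker[of n] a_kernel_iff[of x "obj P n" "N n" "q n"] by simp
  \<comment> \<open>The boundary of \<open>P\<close> maps \<open>K n\<close> into
    \<open>K (n - 1)\<close>, so it descends to the quotients.\<close>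
  have "\<exists>d. d \<in> lin_hom R (N n) (N (n - 1)) \<and> (\<forall>x \<in> carrier (obj P n). d (q n x) = q (n - 1) (bd P n x))" for n
  proof -
    have "q (n - 1) (bd P n x) = \<zero>\<^bsub>N (n - 1)\<^esub>" if "x \<in> carrier (obj P n)" "q n x = \<zero>\<^bsub>N n\<^esub>" for x
      using that qK K(3) Ch_bd_closed[OF P] by simp
    then show ?thesis
      by (rule lin_hom_factor[OF Ch_module[OF P] N N q(1) q(2) lin_hom_comp[OF Ch_bd[OF P] q(1)]]) auto
  qed
  then obtain d where d: "\<And>n. d n \<in> lin_hom R (N n) (N (n - 1))"
    "\<And>n x. x \<in> carrier (obj P n) \<Longrightarrow> d n (q n x) = q (n - 1) (bd P n x)" by metis
  let ?Q = "\<lparr>obj = N, bd = d\<rparr>"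
  have Q: "?Q \<in> Ch R UNIV"
  proof (rule ChI)
    show "bd ?Q (n - 1) (bd ?Q n y) = \<zero>\<^bsub>obj ?Q (n - 2)\<^esub>" if "y \<in> carrier (obj ?Q n)" for n y
    proof -
      have "y \<in> q n ` carrier (obj P n)" using that q(2) by simp
      then obtain x where "x \<in> carrier (obj P n)" "y = q n x" by blast
      then show ?thesis
        using d(2) Ch_bd_closed[OF P] Ch_bd_bd[OF P]
          lin_hom_zero[OF q(1)[of "n - 2"] Ch_group[OF P] left_module_group[OF N]] by simp
    qed
  qed (use N d in \<open>simp_all add: RMod_UNIV\<close>)
  have "q \<in> chain_map R P ?Q" by (rule chain_mapI) (use q d in simp_all)
  then show thesis by (rule that[OF Q]) (use q qK in simp_all)
qed

text \<open>The pushout of \<open>E\<close> along \<open>f\<close> is an extension of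
  \<open>A\<close> by \<open>B\<close>. Its section yields a retraction \<open>g\<close> onto
  \<open>B\<close>, and \<open>E\<close> mapped into the pushout and then by \<open>g\<close>
  extends \<open>f\<close>.\<close>

lemma chain_map_extend:
  fixes S :: "'m set set" and A B :: "('r, 'm) chain_complex" and E :: "('r, 'b) chain_complex"
  assumes U: "module_universe R S" and A: "A \<in> Ch R S" and B: "B \<in> Ch R S"
    and sing: "is_singleton (Ext1_Ch R S A B)"
    and ext: "ch_extension R C i E p A" and f: "f \<in> chain_map R C B"
  obtains g where "g \<in> chain_map R E B" "\<And>n c. c \<in> carrier (obj C n) \<Longrightarrow> g n (i n c) = f n c"
proof -
  interpret X: ch_extension R C i E p A by fact
  note BU = Ch_UNIV[OF B] and C = X.B and D = X.D
  let ?P = "pair_complex B E"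
  note PC = pair_complex_Ch[OF BU X.E]
  \<comment> \<open>Dividing by the image of \<open>k\<close> identifies \<open>(f c, 0)\<close>
    with \<open>(0, i c)\<close>, which glues \<open>B\<close> and \<open>E\<close> along
    \<open>C\<close>.\<close>
  define k where "k n c = (f n c, \<ominus>\<^bsub>obj E n\<^esub> i n c)" for n c
  have k: "k n \<in> lin_hom R (obj C n) (obj ?P n)" for n
    using lin_hom_pair[OF chain_map_hom[OF f] lin_hom_neg[OF Ch_module[OF X.E] chain_map_hom[OF X.i]]]
    by (simp add: k_def[abs_def])
  have kbd: "bd ?P n (k n c) = k (n - 1) (bd C n c)" if "c \<in> carrier (obj C n)" for n c
    using that chain_map_closed[OF X.i] chain_map_bd[OF X.i] chain_map_bd[OF f]
    by (simp add: k_def lin_hom_minus[OF Ch_bd[OF X.E] Ch_group[OF X.E] Ch_group[OF X.E]])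
  have sub: "left_module R ((obj ?P n)\<lparr>carrier := k n ` carrier (obj C n)\<rparr>)" for n
  proof (rule submodule[OF Ch_module[OF PC]])
    show "\<zero>\<^bsub>obj ?P n\<^esub> \<in> k n ` carrier (obj C n)"
      using lin_hom_zero[OF k Ch_group[OF C] Ch_group[OF PC]] abelian_groupE(2)[OF Ch_group[OF C]]
      by (metis imageI)
    show "x \<oplus>\<^bsub>obj ?P n\<^esub> y \<in> k n ` carrier (obj C n)"
      if xy: "x \<in> k n ` carrier (obj C n)" "y \<in> k n ` carrier (obj C n)" for x y
    proof -
      obtain u v where "u \<in> carrier (obj C n)" "v \<in> carrier (obj C n)" "x = k n u" "y = k n v"
        using xy by blast
      then show ?thesis
        using lin_hom_add[OF k] abelian_groupE(1)[OF Ch_group[OF C]] by (metis imageI)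
    qed
    show "a \<odot>\<^bsub>obj ?P n\<^esub> x \<in> k n ` carrier (obj C n)"
      if ax: "a \<in> carrier R" "x \<in> k n ` carrier (obj C n)" for a x
    proof -
      obtain u where "u \<in> carrier (obj C n)" "x = k n u" using ax by blast
      then show ?thesis
        using lin_hom_smult[OF k ax(1)] left_module.smult_closed[OF Ch_module[OF C] ax(1)] by (metis imageI)
    qed
    show "k n ` carrier (obj C n) \<subseteq> carrier (obj ?P n)" using lin_hom_closed[OF k] by blast
  qed
  have kc: "k n ` carrier (obj C n) \<subseteq> carrier (obj ?P n)" for n using lin_hom_closed[OF k] by blast
  have kb: "bd ?P n x \<in> k (n - 1) ` carrier (obj C (n - 1))" if x: "x \<in> k n ` carrier (obj C n)" for n x
  proof -
    obtain u where u: "u \<in> carrier (obj C n)" "x = k n u" using x by blast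
    show ?thesis unfolding u(2) kbd[OF u(1)] using Ch_bd_closed[OF C u(1)] by (rule imageI)
  qed
  obtain Q :: "('r, ('m \<times> 'b) set) chain_complex" and q where Q: "Q \<in> Ch R UNIV" and q: "q \<in> chain_map R ?P Q"
    and surj: "\<And>n. q n ` carrier (obj ?P n) = carrier (obj Q n)"
    and ker: "\<And>n x. x \<in> carrier (obj ?P n) \<Longrightarrow> q n x = \<zero>\<^bsub>obj Q n\<^esub> \<longleftrightarrow> x \<in> k n ` carrier (obj C n)"
    by (rule quotient_complex_exists[where K = "\<lambda>n. k n ` carrier (obj C n)", OF PC kc sub kb], assumption, rule that)
  \<comment> \<open>The map \<open>p\<close> on the second component kills \<open>k c\<close>
    because \<open>p (i c) = 0\<close>, so it induces \<open>r\<close> on the pushout.\<close>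
  have "\<exists>r. r \<in> lin_hom R (obj Q n) (obj A n) \<and> (\<forall>x \<in> carrier (obj ?P n). r (q n x) = p n (snd x))" for n
  proof -
    have "p n (snd x) = \<zero>\<^bsub>obj A n\<^esub>" if x: "x \<in> carrier (obj ?P n)" "q n x = \<zero>\<^bsub>obj Q n\<^esub>" for x
    proof -
      interpret A: abelian_group "obj A n" by (rule Ch_group[OF A])
      obtain c where c: "c \<in> carrier (obj C n)" "x = k n c" using ker[OF x(1)] x(2) by blast
      have "p n (\<ominus>\<^bsub>obj E n\<^esub> i n c) = \<ominus>\<^bsub>obj A n\<^esub> \<zero>\<^bsub>obj A n\<^esub>"
        using lin_hom_minus[OF D(2) Ch_group[OF X.E] Ch_group[OF A] chain_map_closed[OF X.i c(1)]] D(4)[OF c(1)]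
        by simp
      then show ?thesis
        using c by (simp add: k_def A.add.inv_one)
    qed
    note van = this
    have "(\<lambda>x. p n (snd x)) \<in> lin_hom R (obj ?P n) (obj A n)"
      using lin_hom_comp[OF lin_hom_snd D(2)] by simp
    then show ?thesis
      using van by (rule lin_hom_factor[OF Ch_module[OF PC] Ch_module[OF Q] Ch_module[OF A] chain_map_hom[OF q] surj])
        blast+
  qed
  then obtain r where r: "\<And>n. r n \<in> lin_hom R (obj Q n) (obj A n)"
    "\<And>n x. x \<in> carrier (obj ?P n) \<Longrightarrow> r n (q n x) = p n (snd x)" by metis
  have zc: "\<zero>\<^bsub>obj E n\<^esub> \<in> carrier (obj E n)" "\<zero>\<^bsub>obj B n\<^esub> \<in> carrier (obj B n)" for n
    using abelian_groupE(2) Ch_group[OF X.E] Ch_group[OF B] by blast+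
  define j where "j n b = q n (b, \<zero>\<^bsub>obj E n\<^esub>)" for n b
  have inl: "(\<lambda>n b. (b, \<zero>\<^bsub>obj E n\<^esub>)) \<in> chain_map R B ?P"
    by (rule chain_mapI)
      (simp_all add: lin_hom_pair[OF lin_hom_id lin_hom_const_zero[OF Ch_module[OF X.E]]] Ch_bd_zero[OF X.E])
  have inr: "(\<lambda>n e. (\<zero>\<^bsub>obj B n\<^esub>, e)) \<in> chain_map R E ?P"
    by (rule chain_mapI)
      (simp_all add: lin_hom_pair[OF lin_hom_const_zero[OF Ch_module[OF B]] lin_hom_id] Ch_bd_zero[OF B])
  have j: "j \<in> chain_map R B Q"
    unfolding j_def by (rule chain_map_comp[OF B inl q])
  have rc: "r \<in> chain_map R Q A"
  proof (rule chain_mapI[OF r(1)])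
    fix n y assume "y \<in> carrier (obj Q n)"
    then obtain x where x: "x \<in> carrier (obj ?P n)" "y = q n x" using surj by blast
    have "r (n - 1) (bd Q n y) = p (n - 1) (snd (bd ?P n x))"
      unfolding x(2) chain_map_bd[OF q x(1)] by (rule r(2)[OF Ch_bd_closed[OF PC x(1)]])
    then show "bd A n (r n y) = r (n - 1) (bd Q n y)"
      using x r(2) chain_map_bd[OF X.p, of "snd x" n] by auto
  qed
  \<comment> \<open>The two representatives differ by \<open>k c\<close>. This moves the part of
    \<open>E\<close> coming from \<open>C\<close> over to \<open>B\<close>; it gives exactness in
    the middle and, with \<open>b = 0\<close>, the extension property.\<close>
  have kq: "q n (b \<oplus>\<^bsub>obj B n\<^esub> f n c, \<zero>\<^bsub>obj E n\<^esub>) = q n (b, i n c)"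
    if bc: "b \<in> carrier (obj B n)" "c \<in> carrier (obj C n)" for n b c
  proof -
    interpret E: abelian_group "obj E n" by (rule Ch_group[OF X.E])
    interpret Q: abelian_group "obj Q n" by (rule Ch_group[OF Q])
    have ic: "i n c \<in> carrier (obj E n)" by (rule chain_map_closed[OF X.i bc(2)])
    have "q n ((b, i n c) \<oplus>\<^bsub>obj ?P n\<^esub> k n c) = q n (b, i n c) \<oplus>\<^bsub>obj Q n\<^esub> \<zero>\<^bsub>obj Q n\<^esub>"
      using lin_hom_add[OF chain_map_hom[OF q], of "(b, i n c)" n "k n c"] lin_hom_closed[OF k bc(2)]
        ker[OF lin_hom_closed[OF k bc(2)]] bc ic by simp
    then show ?thesis
      using bc ic chain_map_closed[OF q, of "(b, i n c)" n] by (simp add: k_def E.r_neg)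
  qed
  have extQ: "ch_extension R B j Q r A"
  proof (rule ch_extension.intro)
    show "short_exact R (obj B n) (j n) (obj Q n) (r n) (obj A n)" for n
    proof (rule short_exactI)
      \<comment> \<open>If \<open>(b, 0) = (f c, - i c)\<close>, then \<open>i c = 0\<close>, hence
        \<open>c = 0\<close> by injectivity of \<open>i\<close>, and
        \<open>b = f 0 = 0\<close>.\<close>
      have "b = \<zero>\<^bsub>obj B n\<^esub>" if b: "b \<in> carrier (obj B n)" "j n b = \<zero>\<^bsub>obj Q n\<^esub>" for b
      proof -
        interpret E: abelian_group "obj E n" by (rule Ch_group[OF X.E])
        obtain c where c: "c \<in> carrier (obj C n)" "b = f n c" "\<zero>\<^bsub>obj E n\<^esub> = \<ominus>\<^bsub>obj E n\<^esub> i n c"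
          using ker[of "(b, \<zero>\<^bsub>obj E n\<^esub>)" n] b zc by (auto simp: j_def k_def)
        have "i n c = \<zero>\<^bsub>obj E n\<^esub>"
          using c(3)[symmetric] E.r_neg[OF chain_map_closed[OF X.i c(1)]] chain_map_closed[OF X.i c(1)] by simp
        then have "c = \<zero>\<^bsub>obj C n\<^esub>"
          using D(3)[OF c(1) abelian_groupE(2)[OF Ch_group[OF C]]] chain_map_zero[OF X.i C X.E] by simp
        then show ?thesis using c(2) chain_map_zero[OF f C B] by simp
      qed
      then show "b = b'" if "b \<in> carrier (obj B n)" "b' \<in> carrier (obj B n)" "j n b = j n b'" for b b'
        using lin_hom_injI[OF chain_map_hom[OF j] Ch_group[OF B] Ch_group[OF Q]] that by blast
      show "r n (j n b) = \<zero>\<^bsub>obj A n\<^esub>" if "b \<in> carrier (obj B n)" for b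
        using that zc r(2)[of "(b, \<zero>\<^bsub>obj E n\<^esub>)" n] chain_map_zero[OF X.p X.E A] by (simp add: j_def)
      show "\<exists>b\<in>carrier (obj B n). y = j n b" if y: "y \<in> carrier (obj Q n)" "r n y = \<zero>\<^bsub>obj A n\<^esub>" for y
      proof -
        obtain b e where x: "b \<in> carrier (obj B n)" "e \<in> carrier (obj E n)" "y = q n (b, e)"
          using y(1) unfolding surj[of n, symmetric] by auto
        then have "p n e = \<zero>\<^bsub>obj A n\<^esub>" using y(2) r(2)[of "(b, e)" n] by simp
        then obtain c where c: "c \<in> carrier (obj C n)" "e = i n c" using D(5)[OF x(2)] by blast
        have "y = j n (b \<oplus>\<^bsub>obj B n\<^esub> f n c)" using kq[OF x(1) c(1)] x(3) c(2) by (simp add: j_def)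
        then show ?thesis
          using abelian_groupE(1)[OF Ch_group[OF B] x(1) chain_map_closed[OF f c(1)]] by blast
      qed
      show "\<exists>y\<in>carrier (obj Q n). r n y = a" if "a \<in> carrier (obj A n)" for a
      proof -
        obtain e where e: "e \<in> carrier (obj E n)" "p n e = a" using D(6)[OF \<open>a \<in> carrier (obj A n)\<close>] by blast
        have "(\<zero>\<^bsub>obj B n\<^esub>, e) \<in> carrier (obj ?P n)" using e zc by simp
        then show ?thesis
          using r(2)[of "(\<zero>\<^bsub>obj B n\<^esub>, e)" n] e chain_map_closed[OF q] by (metis snd_conv)
      qed
    qed (rule chain_map_hom[OF j] r(1))+
  qed (rule BU Q X.A j rc)+
  interpret Y: ch_extension R B j Q r A by fact
  obtain s where "s \<in> chain_map R A Q" "\<And>n a. a \<in> carrier (obj A n) \<Longrightarrow> r n (s n a) = a"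
    by (rule section_map_exists[OF U A B sing extQ]) (rule that)
  then have "Y.section_map s" by (simp add: Y.section_map_def)
  then obtain g where "Y.retraction_map g" by (rule Y.retraction_of_section_map)
  then have g: "g \<in> chain_map R Q B" "\<And>n b. b \<in> carrier (obj B n) \<Longrightarrow> g n (j n b) = b"
    by (auto simp: Y.retraction_map_def)
  show thesis
  proof (rule that)
    show "(\<lambda>n e. g n (q n (\<zero>\<^bsub>obj B n\<^esub>, e))) \<in> chain_map R E B"
      by (rule chain_map_comp[OF X.E chain_map_comp[OF X.E inr q] g(1)])
    show "g n (q n (\<zero>\<^bsub>obj B n\<^esub>, i n c)) = f n c" if c: "c \<in> carrier (obj C n)" for n c
    proof -
      interpret B: abelian_group "obj B n" by (rule Ch_group[OF B])
      have "q n (\<zero>\<^bsub>obj B n\<^esub>, i n c) = j n (f n c)"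
        using kq[OF zc(2) c] chain_map_closed[OF f c] by (simp add: j_def)
      then show ?thesis using g(2)[OF chain_map_closed[OF f c]] by simp
    qed
  qed
qed

section \<open>Spheres, disks and shifts\<close>

lemma Ch_iff_UNIV: "C \<in> Ch R S \<longleftrightarrow> C \<in> Ch R UNIV \<and> (\<forall>n. obj C n \<in> RMod R S)"
  by (auto simp: Ch_def RMod_def)

lemma RMod_submodule:
  assumes U: "module_universe R S" and M: "M \<in> RMod R S" and K: "left_module R (M\<lparr>carrier := K\<rparr>)" "K \<subseteq> carrier M"
  shows "M\<lparr>carrier := K\<rparr> \<in> RMod R S"
  using RModI[OF U K(1)] small_lepoll[OF subset_imp_lepoll[OF K(2)] RMod_small[OF M]] by simp

text \<open>For \<open>I = {n}\<close> and \<open>J = {}\<close> this is the sphere on \<open>M\<close> in degree \<open>n\<close>, for \<open>I = {n, n - 1}\<close>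
  and \<open>J = {n}\<close> the disk.\<close>

definition conc :: "int set \<Rightarrow> int set \<Rightarrow> ('r, 'a) module \<Rightarrow> ('r, 'a) chain_complex" where
  "conc I J M = \<lparr>obj = (\<lambda>k. M\<lparr>carrier := if k \<in> I then carrier M else {\<zero>\<^bsub>M\<^esub>}\<rparr>),
     bd = (\<lambda>k x. if k \<in> J then x else \<zero>\<^bsub>M\<^esub>)\<rparr>"

lemma conc_simps:
  "obj (conc I J M) k = M\<lparr>carrier := if k \<in> I then carrier M else {\<zero>\<^bsub>M\<^esub>}\<rparr>"
  "bd (conc I J M) k x = (if k \<in> J then x else \<zero>\<^bsub>M\<^esub>)"
  by (simp_all add: conc_def)

lemma conc_obj_in [simp]: "k \<in> I \<Longrightarrow> obj (conc I J M) k = M"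
  by (simp add: conc_simps)

lemma conc_obj_notin [simp]: "k \<notin> I \<Longrightarrow> obj (conc I J M) k = M\<lparr>carrier := {\<zero>\<^bsub>M\<^esub>}\<rparr>"
  by (simp add: conc_simps)

lemma conc_bd_in [simp]: "k \<in> J \<Longrightarrow> bd (conc I J M) k x = x"
  by (simp add: conc_simps)

lemma conc_bd_notin [simp]: "k \<notin> J \<Longrightarrow> bd (conc I J M) k x = \<zero>\<^bsub>M\<^esub>"
  by (simp add: conc_simps)

lemma conc_zero [simp]: "\<zero>\<^bsub>obj (conc I J M) k\<^esub> = \<zero>\<^bsub>M\<^esub>"
  by (simp add: conc_simps)

text \<open>In a degree \<open>k\<close> of \<open>J\<close> the boundary is the identity of
  \<open>M\<close>, so both \<open>k\<close> and \<open>k - 1\<close> must carry \<open>M\<close>.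
  Two consecutive identities would not compose to zero.\<close>

lemma conc_Ch_UNIV:
  assumes M: "left_module R M" and J: "\<And>k. k \<in> J \<Longrightarrow> k \<in> I \<and> k - 1 \<in> I \<and> k - 1 \<notin> J"
  shows "conc I J M \<in> Ch R UNIV"
proof (rule ChI)
  interpret M: abelian_group M using M by (rule left_module_group)
  show "obj (conc I J M) k \<in> RMod R UNIV" for k
    using M zero_submodule[OF M] by (cases "k \<in> I") (simp_all add: RMod_UNIV)
  show "bd (conc I J M) k \<in> lin_hom R (obj (conc I J M) k) (obj (conc I J M) (k - 1))" for k
    by (cases "k \<in> J") (auto intro!: lin_homI simp: J smult_zero[OF M] conc_simps)
  show "bd (conc I J M) (k - 1) (bd (conc I J M) k x) = \<zero>\<^bsub>obj (conc I J M) (k - 2)\<^esub>"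
    if "x \<in> carrier (obj (conc I J M) k)" for k x
    using J by (auto simp: conc_simps)
qed

lemma conc_Ch:
  assumes U: "module_universe R S" and M: "M \<in> RMod R S"
    and J: "\<And>k. k \<in> J \<Longrightarrow> k \<in> I \<and> k - 1 \<in> I \<and> k - 1 \<notin> J"
  shows "conc I J M \<in> Ch R S"
proof -
  interpret M: abelian_group M by (rule left_module_group[OF RMod_module[OF M]])
  show ?thesis
    unfolding Ch_iff_UNIV[of _ _ S]
    using conc_Ch_UNIV[OF RMod_module[OF M] J] M RMod_submodule[OF U M zero_submodule[OF RMod_module[OF M]]]
    by (simp add: conc_simps)
qed

text \<open>The same maps \<open>i\<close> and \<open>p\<close> serve in every degree: outside
  \<open>I\<close> they restrict to maps between zero submodules.\<close>

lemma conc_extension: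
  assumes se: "short_exact R B i E p A" and mod: "left_module R B" "left_module R E" "left_module R A"
    and J: "\<And>k. k \<in> J \<Longrightarrow> k \<in> I \<and> k - 1 \<in> I \<and> k - 1 \<notin> J"
  shows "ch_extension R (conc I J B) (\<lambda>k. i) (conc I J E) (\<lambda>k. p) (conc I J A)"
proof -
  interpret E: abelian_group E using mod by (intro left_module_group)
  interpret A: abelian_group A using mod by (intro left_module_group)
  interpret B: abelian_group B using mod by (intro left_module_group)
  note D = short_exactD[OF se]
  note z = lin_hom_zero[OF D(1) B.abelian_group_axioms E.abelian_group_axioms]
    lin_hom_zero[OF D(2) E.abelian_group_axioms A.abelian_group_axioms]
  have lin: "i \<in> lin_hom R (obj (conc I J B) k) (obj (conc I J E) k)"
    "p \<in> lin_hom R (obj (conc I J E) k) (obj (conc I J A) k)" for k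
    using D(1,2) z
    by (cases "k \<in> I"; auto intro!: lin_homI simp: smult_zero[OF mod(1)] smult_zero[OF mod(2)] smult_zero[OF mod(3)])+
  have "short_exact R (obj (conc I J B) k) i (obj (conc I J E) k) p (obj (conc I J A) k)" for k
  proof (cases "k \<in> I")
    case False
    then show ?thesis using lin[of k] z by (intro short_exactI) auto
  qed (simp add: se)
  then show ?thesis
    by (intro ch_extension.intro conc_Ch_UNIV mod J chain_mapI lin) (auto simp: conc_simps z)
qed

lemma cycle_conc:
  assumes "left_module R M"
  shows "cycle_module (conc I J M) k = M\<lparr>carrier := if k \<in> I - J then carrier M else {\<zero>\<^bsub>M\<^esub>}\<rparr>"
proof -
  have "\<zero>\<^bsub>M\<^esub> \<in> carrier M" using assms abelian_groupE(2) left_module_group by blast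
  then have "a_kernel (obj (conc I J M) k) (obj (conc I J M) (k - 1)) (bd (conc I J M) k) =
      (if k \<in> I - J then carrier M else {\<zero>\<^bsub>M\<^esub>})"
    by (auto simp: a_kernel_iff conc_simps split: if_splits)
  then show ?thesis unfolding cycle_module_def by (simp add: conc_simps)
qed

text \<open>Maps from \<open>M\<close> into the cycles in degree \<open>n\<close> are the same as
  chain maps out of the sphere; this is the direction that constructs the chain map.\<close>

lemma sphere_map:
  assumes C: "C \<in> Ch R UNIV" and M: "left_module R M" and s: "s \<in> lin_hom R M (obj C n)"
    and z: "\<And>x. x \<in> carrier M \<Longrightarrow> bd C n (s x) = \<zero>\<^bsub>obj C (n - 1)\<^esub>"
  shows "(\<lambda>k x. if k = n then s x else \<zero>\<^bsub>obj C k\<^esub>) \<in> chain_map R (conc {n} {} M) C"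
proof (rule chain_mapI)
  fix k
  show "(\<lambda>x. if k = n then s x else \<zero>\<^bsub>obj C k\<^esub>) \<in> lin_hom R (obj (conc {n} {} M) k) (obj C k)"
    using s lin_hom_const_zero[OF Ch_module[OF C]] by (cases "k = n") auto
  fix x assume "x \<in> carrier (obj (conc {n} {} M) k)"
  then show "bd C k (if k = n then s x else \<zero>\<^bsub>obj C k\<^esub>) =
      (if k - 1 = n then s (bd (conc {n} {} M) k x) else \<zero>\<^bsub>obj C (k - 1)\<^esub>)"
    using z Ch_bd_zero[OF C] lin_hom_zero[OF s left_module_group[OF M] Ch_group[OF C]]
    by (cases "k = n") auto
qed

text \<open>A chain map out of the disk is determined by its top component \<open>s\<close>, as the
  identity boundary forces the one below to be \<open>bd\<close> after \<open>s\<close>. Any linear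
  \<open>s\<close> is allowed, since the boundary squares to zero.\<close>

lemma disk_map:
  assumes C: "C \<in> Ch R UNIV" and M: "left_module R M" and s: "s \<in> lin_hom R M (obj C n)"
  shows "(\<lambda>k x. if k = n then s x else if k = n - 1 then bd C n (s x) else \<zero>\<^bsub>obj C k\<^esub>)
    \<in> chain_map R (conc {n, n - 1} {n} M) C"
proof (rule chain_mapI)
  fix k
  show "(\<lambda>x. if k = n then s x else if k = n - 1 then bd C n (s x) else \<zero>\<^bsub>obj C k\<^esub>)
      \<in> lin_hom R (obj (conc {n, n - 1} {n} M) k) (obj C k)"
    using s lin_hom_const_zero[OF Ch_module[OF C]] lin_hom_comp[OF s Ch_bd[OF C]]
    by (cases "k = n"; cases "k = n - 1") auto
  fix x assume x: "x \<in> carrier (obj (conc {n, n - 1} {n} M) k)"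
  consider "k = n" | "k = n - 1" | "k \<noteq> n" "k \<noteq> n - 1" by blast
  then show "bd C k (if k = n then s x else if k = n - 1 then bd C n (s x) else \<zero>\<^bsub>obj C k\<^esub>) =
      (if k - 1 = n then s (bd (conc {n, n - 1} {n} M) k x) else if k - 1 = n - 1
       then bd C n (s (bd (conc {n, n - 1} {n} M) k x)) else \<zero>\<^bsub>obj C (k - 1)\<^esub>)"
  proof cases
    case 2
    then show ?thesis using x Ch_bd_bd[OF C lin_hom_closed[OF s]] by simp
  qed (use Ch_bd_zero[OF C] lin_hom_zero[OF s left_module_group[OF M] Ch_group[OF C]] in auto)
qed

text \<open>Dually, a chain map into the disk is determined by its bottom component
  \<open>s\<close>; the top one is forced to be \<open>s\<close> after \<open>bd\<close>.\<close>

lemma disk_comap: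
  assumes C: "C \<in> Ch R UNIV" and M: "left_module R M" and s: "s \<in> lin_hom R (obj C (n - 1)) M"
  shows "(\<lambda>k x. if k = n - 1 then s x else if k = n then s (bd C n x) else \<zero>\<^bsub>M\<^esub>)
    \<in> chain_map R C (conc {n, n - 1} {n} M)"
proof (rule chain_mapI)
  fix k
  show "(\<lambda>x. if k = n - 1 then s x else if k = n then s (bd C n x) else \<zero>\<^bsub>M\<^esub>)
      \<in> lin_hom R (obj C k) (obj (conc {n, n - 1} {n} M) k)"
    using s lin_hom_const_zero[OF zero_submodule[OF M]] lin_hom_comp[OF Ch_bd[OF C] s]
    by (cases "k = n"; cases "k = n - 1") auto
  fix x assume x: "x \<in> carrier (obj C k)"
  have s0: "s \<zero>\<^bsub>obj C (n - 1)\<^esub> = \<zero>\<^bsub>M\<^esub>"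
    by (rule lin_hom_zero[OF s Ch_group[OF C] left_module_group[OF M]])
  consider "k = n" | "k = n + 1" | "k \<noteq> n" "k \<noteq> n + 1" by blast
  then show "bd (conc {n, n - 1} {n} M) k (if k = n - 1 then s x else if k = n then s (bd C n x) else \<zero>\<^bsub>M\<^esub>) =
      (if k - 1 = n - 1 then s (bd C k x) else if k - 1 = n then s (bd C n (bd C k x)) else \<zero>\<^bsub>M\<^esub>)"
  \<comment> \<open>Only \<open>k = n + 1\<close> needs the boundary of \<open>C\<close> to square
    to zero: there the target is zero and the component in degree \<open>n\<close> already contains
    a boundary.\<close>
  proof cases
    case 2
    then show ?thesis using x Ch_bd_bd[OF C, of x "n + 1"] s0 by simp
  qed auto
qed

lemma cycle_carrier:
  "x \<in> carrier (cycle_module C n) \<longleftrightarrow> x \<in> carrier (obj C n) \<and> bd C n x = \<zero>\<^bsub>obj C (n - 1)\<^esub>"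
  by (simp add: cycle_module_def a_kernel_iff)

lemma cycle_module:
  assumes "C \<in> Ch R S"
  shows "left_module R (cycle_module C n)"
  unfolding cycle_module_def by (rule kernel_submodule[OF Ch_module[OF assms] Ch_module[OF assms] Ch_bd[OF assms]])

lemma cycle_RMod:
  assumes "module_universe R S" "C \<in> Ch R S"
  shows "cycle_module C n \<in> RMod R S"
  unfolding cycle_module_def
  by (rule RMod_submodule[OF assms(1) Ch_obj[OF assms(2)]])
    (use cycle_module[OF assms(2), of n] in \<open>auto simp: cycle_module_def a_kernel_iff\<close>)

text \<open>The quotient of cycles by boundaries has the boundaries as its unit. It is trivial iff
  every coset equals the unit, that is, iff every cycle is a boundary.\<close>

lemma exact_complex_iff:
  assumes C: "C \<in> Ch R S"
  shows "exact_complex C \<longleftrightarrow> (\<forall>n. \<forall>x \<in> carrier (obj C n). bd C n x = \<zero>\<^bsub>obj C (n - 1)\<^esub> \<longrightarrow>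
    (\<exists>y \<in> carrier (obj C (n + 1)). bd C (n + 1) y = x))"
proof -
  have "trivial_group (homology_group C n) \<longleftrightarrow> (\<forall>x \<in> carrier (cycle_module C n). x \<in> boundaries C n)" for n
  proof -
    let ?Z = "cycle_module C n" and ?B = "boundaries C n"
    interpret Z: abelian_group ?Z by (rule left_module_group[OF cycle_module[OF C]])
    interpret C1: abelian_group "obj C (n + 1)" by (rule Ch_group[OF C])
    have d: "bd C (n + 1) \<in> lin_hom R (obj C (n + 1)) ?Z"
      unfolding cycle_module_def
      using lin_hom_corestrict[OF Ch_bd[OF C, of "n + 1"], of "a_kernel (obj C n) (obj C (n - 1)) (bd C n)"]
        Ch_bd_bd[OF C, of _ "n + 1"] Ch_bd_closed[OF C, of _ "n + 1"]
      by (simp add: a_kernel_iff)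
    have BZ: "?B \<subseteq> carrier ?Z" using lin_hom_closed[OF d] by (auto simp: boundaries_def)
    have sub: "subgroup ?B (add_monoid ?Z)"
    proof (rule group.subgroupI[OF Z.a_group])
      show "?B \<noteq> {}" using C1.zero_closed by (auto simp: boundaries_def)
      show "inv\<^bsub>add_monoid ?Z\<^esub> b \<in> ?B" if b: "b \<in> ?B" for b
      proof -
        obtain y where y: "y \<in> carrier (obj C (n + 1))" "b = bd C (n + 1) y"
          using b unfolding boundaries_def by blast
        have "\<ominus>\<^bsub>?Z\<^esub> b = bd C (n + 1) (\<ominus>\<^bsub>obj C (n + 1)\<^esub> y)"
          unfolding y(2) by (rule lin_hom_minus[OF d C1.abelian_group_axioms Z.abelian_group_axioms y(1), symmetric])
        then have "\<ominus>\<^bsub>?Z\<^esub> b \<in> ?B" unfolding boundaries_def using y(1) by blast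
        then show ?thesis by (simp add: a_inv_def)
      qed
      show "b \<otimes>\<^bsub>add_monoid ?Z\<^esub> b' \<in> ?B" if b: "b \<in> ?B" "b' \<in> ?B" for b b'
      proof -
        obtain y y' where y: "y \<in> carrier (obj C (n + 1))" "b = bd C (n + 1) y"
          "y' \<in> carrier (obj C (n + 1))" "b' = bd C (n + 1) y'"
          using b unfolding boundaries_def by blast
        have "b \<oplus>\<^bsub>?Z\<^esub> b' = bd C (n + 1) (y \<oplus>\<^bsub>obj C (n + 1)\<^esub> y')"
          unfolding y(2,4) by (rule lin_hom_add[OF d y(1,3), symmetric])
        then have "b \<oplus>\<^bsub>?Z\<^esub> b' \<in> ?B" unfolding boundaries_def using y(1,3) by blast
        then show ?thesis by simp
      qed
    qed (use BZ in simp)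
    interpret B: abelian_subgroup ?B ?Z
      using sub Z.abelian_group_axioms by (intro abelian_subgroupI3 additive_subgroup.intro)
    have mem: "x \<in> ?B +>\<^bsub>?Z\<^esub> x" if "x \<in> carrier ?Z" for x
      using that by (rule B.a_rcos_self)
    have "trivial_group (homology_group C n) \<longleftrightarrow> carrier (?Z A_Mod ?B) = {?B}"
      using B.a_factorgroup_is_group by (simp add: trivial_group_def homology_group_def A_FactGroup_def FactGroup_def)
    also have "\<dots> \<longleftrightarrow> (\<forall>x \<in> carrier ?Z. ?B +>\<^bsub>?Z\<^esub> x = ?B)"
      using Z.zero_closed
      by (auto simp: A_FactGroup_def FactGroup_def RCOSETS_def a_r_coset_def)
    also have "\<dots> \<longleftrightarrow> (\<forall>x \<in> carrier ?Z. x \<in> ?B)"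
    proof (intro iffI ballI)
      show "x \<in> ?B" if "\<forall>x \<in> carrier ?Z. ?B +>\<^bsub>?Z\<^esub> x = ?B" "x \<in> carrier ?Z" for x
        using mem[OF that(2)] that by simp
      show "?B +>\<^bsub>?Z\<^esub> x = ?B" if "\<forall>x \<in> carrier ?Z. x \<in> ?B" "x \<in> carrier ?Z" for x
        using that by (intro B.a_rcos_const) blast
    qed
    finally show ?thesis .
  qed
  note triv = this
  have bdry: "x \<in> boundaries C n \<longleftrightarrow> (\<exists>y \<in> carrier (obj C (n + 1)). bd C (n + 1) y = x)" for x n
    by (auto simp: boundaries_def)
  have "trivial_group (homology_group C n) \<longleftrightarrow> (\<forall>x \<in> carrier (obj C n). bd C n x = \<zero>\<^bsub>obj C (n - 1)\<^esub> \<longrightarrow>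
    (\<exists>y \<in> carrier (obj C (n + 1)). bd C (n + 1) y = x))" for n
    unfolding triv[of n] cycle_carrier bdry Ball_def by blast
  then show ?thesis unfolding exact_complex_def by (simp only:)
qed

text \<open>The boundary is negated for every \<open>k\<close>. The shifts applied later are those
  by 1 and -1, for which this is the usual sign, and it turns anticommuting families into chain
  maps.\<close>

definition shift :: "int \<Rightarrow> ('r, 'a) chain_complex \<Rightarrow> ('r, 'a) chain_complex" where
  "shift k C = \<lparr>obj = (\<lambda>n. obj C (n + k)), bd = (\<lambda>n x. \<ominus>\<^bsub>obj C (n + k - 1)\<^esub> bd C (n + k) x)\<rparr>"

lemma shift_simps [simp]:
  "obj (shift k C) n = obj C (n + k)"
  "bd (shift k C) n x = \<ominus>\<^bsub>obj C (n + k - 1)\<^esub> bd C (n + k) x"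
  by (simp_all add: shift_def)

lemma shift_index: "n - 1 + k = n + k - (1 :: int)" "n - 2 + k = n + k - (2 :: int)" "n + 1 + k = n + k + (1 :: int)"
  by simp_all

lemma (in abelian_group) a_inv_eq_zero_iff:
  assumes "x \<in> carrier G"
  shows "\<ominus> x = \<zero> \<longleftrightarrow> x = \<zero>"
  using r_neg[OF assms] assms by (auto simp: add.inv_one)

lemma shift_Ch:
  assumes C: "C \<in> Ch R S"
  shows "shift k C \<in> Ch R S"
proof (rule ChI)
  show "bd (shift k C) n \<in> lin_hom R (obj (shift k C) n) (obj (shift k C) (n - 1))" for n
    using lin_hom_neg[OF Ch_module[OF C] Ch_bd[OF C]] by (simp add: shift_def shift_index)
  show "bd (shift k C) (n - 1) (bd (shift k C) n x) = \<zero>\<^bsub>obj (shift k C) (n - 2)\<^esub>"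
    if "x \<in> carrier (obj (shift k C) n)" for n x
  proof -
    have x: "x \<in> carrier (obj C (n + k))" using that by simp
    interpret A: abelian_group "obj C (n + k - 2)" by (rule Ch_group[OF C])
    have "bd C (n + k - 1) (\<ominus>\<^bsub>obj C (n + k - 1)\<^esub> bd C (n + k) x) = \<ominus>\<^bsub>obj C (n + k - 2)\<^esub> \<zero>\<^bsub>obj C (n + k - 2)\<^esub>"
      using lin_hom_minus[OF Ch_bd[OF C] Ch_group[OF C] Ch_group[OF C] Ch_bd_closed[OF C x]] Ch_bd_bd[OF C x] by simp
    then show ?thesis by (simp add: shift_index A.add.inv_one)
  qed
qed (simp add: Ch_obj[OF C])

text \<open>A sign changes neither kernels nor images, and the cycle modules are equal as records,
  as membership in \<open>\<V>\<close> demands.\<close>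

lemma shift_tilde:
  assumes Y: "Y \<in> exact_tilde R S \<Y> \<V>"
  shows "shift k Y \<in> exact_tilde R S \<Y> \<V>"
proof -
  have C: "Y \<in> Ch R S" and ex: "exact_complex Y" and YV: "\<And>n. obj Y n \<in> \<Y>" "\<And>n. cycle_module Y n \<in> \<V>"
    using Y by (auto simp: exact_tilde_def)
  note neg = abelian_group.a_inv_eq_zero_iff[OF Ch_group[OF C] Ch_bd_closed[OF C]]
  have "a_kernel (obj Y (n + k)) (obj Y (n + k - 1)) (\<lambda>x. \<ominus>\<^bsub>obj Y (n + k - 1)\<^esub> bd Y (n + k) x) =
      a_kernel (obj Y (n + k)) (obj Y (n + k - 1)) (bd Y (n + k))" for n
    by (rule Set.set_eqI) (unfold a_kernel_iff, use neg in blast)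
  then have cyc: "cycle_module (shift k Y) n = cycle_module Y (n + k)" for n
    unfolding cycle_module_def by (simp add: shift_def shift_index)
  have "exact_complex (shift k Y)"
    unfolding exact_complex_iff[OF shift_Ch[OF C]]
  proof (intro allI ballI impI)
    fix n x assume x: "x \<in> carrier (obj (shift k Y) n)" "bd (shift k Y) n x = \<zero>\<^bsub>obj (shift k Y) (n - 1)\<^esub>"
    then have "bd Y (n + k) x = \<zero>\<^bsub>obj Y (n + k - 1)\<^esub>" using neg by (simp add: shift_index)
    then obtain y where y: "y \<in> carrier (obj Y (n + k + 1))" "bd Y (n + k + 1) y = x"
      using ex[unfolded exact_complex_iff[OF C]] x by auto
    interpret Y0: abelian_group "obj Y (n + k)" by (rule Ch_group[OF C])
    have "\<ominus>\<^bsub>obj Y (n + k)\<^esub> bd Y (n + k + 1) (\<ominus>\<^bsub>obj Y (n + k + 1)\<^esub> y) = x"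
      using lin_hom_minus[OF Ch_bd[OF C] Ch_group[OF C] Ch_group[OF C] y(1)] y(2) x(1) by simp
    then show "\<exists>y \<in> carrier (obj (shift k Y) (n + 1)). bd (shift k Y) (n + 1) y = x"
      using y abelian_group.a_inv_closed[OF Ch_group[OF C] y(1)]
      by (intro bexI[of _ "\<ominus>\<^bsub>obj Y (n + k + 1)\<^esub> y"]) (simp_all add: shift_index)
  qed
  then show ?thesis using shift_Ch[OF C] YV cyc by (simp add: exact_tilde_def)
qed

section \<open>The induced cotorsion pair\<close>

text \<open>When the kernel is zero, the zero map is a retraction onto it, which gives a
  section.\<close>

lemma section_to_zero_kernel:
  assumes U: "module_universe R S" and A: "A \<in> RMod R S" and M: "left_module R M"
    and E: "left_module R E" and se: "short_exact R (M\<lparr>carrier := {\<zero>\<^bsub>M\<^esub>}\<rparr>) i E p A"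
  shows "\<exists>s \<in> lin_hom R A E. \<forall>a \<in> carrier A. p (s a) = a"
proof -
  note Z = zero_submodule[OF M]
  have "(\<lambda>e. \<zero>\<^bsub>M\<^esub>) \<in> lin_hom R E (M\<lparr>carrier := {\<zero>\<^bsub>M\<^esub>}\<rparr>)"
    using lin_hom_const_zero[OF Z] by simp
  then show ?thesis
    by (rule section_of_retraction[OF se Z E RMod_module[OF A]]) auto
qed

text \<open>\<open>F\<close> is a copy of \<open>R\<close> as a left module over itself and
  \<open>u\<close> is the copy of 1; a map out of \<open>F\<close> is a choice of image for
  \<open>u\<close>.\<close>

lemma free_module_exists:
  fixes R :: "('r, 'e) ring_scheme" and S :: "'m set set"
  assumes R: "ring R" and U: "module_universe R S"
  obtains F u where "F \<in> RMod R S" "u \<in> carrier F"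
    "\<And>x. x \<in> carrier F \<Longrightarrow> \<exists>a \<in> carrier R. x = a \<odot>\<^bsub>F\<^esub> u"
    "\<And>(M :: ('r, 'm) module) m. \<lbrakk>left_module R M; m \<in> carrier M\<rbrakk> \<Longrightarrow> \<exists>f \<in> lin_hom R F M. f u = m"
proof -
  interpret R: ring R by fact
  let ?M = "\<lparr>carrier = carrier R, monoid.mult = undefined, one = undefined, zero = \<zero>\<^bsub>R\<^esub>,
    add = (\<lambda>x y. x \<oplus>\<^bsub>R\<^esub> y), smult = (\<lambda>x y. x \<otimes>\<^bsub>R\<^esub> y)\<rparr> :: ('r, 'r) module"
  have M: "left_module R ?M"
  proof (rule left_moduleI)
    show "\<exists>y \<in> carrier ?M. y \<oplus>\<^bsub>?M\<^esub> x = \<zero>\<^bsub>?M\<^esub>" if "x \<in> carrier ?M" for x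
      using that R.l_neg by (intro bexI[of _ "\<ominus>\<^bsub>R\<^esub> x"]) simp_all
  qed (use R in \<open>simp_all add: R.a_ac R.l_distr R.r_distr R.m_assoc\<close>)
  have "small S (carrier ?M)"
    using U by (auto simp: module_universe_def small_def)
  then obtain F f g where F: "F \<in> RMod R S" and f: "f \<in> lin_hom R ?M F" and g: "g \<in> lin_hom R F ?M"
    and gf: "\<And>x. x \<in> carrier ?M \<Longrightarrow> g (f x) = x" and fg: "\<And>y. y \<in> carrier F \<Longrightarrow> f (g y) = y"
    by (rule small_module_copy[OF U M]) (rule that)
  show thesis
  proof (rule that[OF F])
    show "f \<one>\<^bsub>R\<^esub> \<in> carrier F" using lin_hom_closed[OF f] by simp
    show "\<exists>a \<in> carrier R. x = a \<odot>\<^bsub>F\<^esub> f \<one>\<^bsub>R\<^esub>" if x: "x \<in> carrier F" for x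
    proof
      show gx: "g x \<in> carrier R" using lin_hom_closed[OF g x] by simp
      show "x = g x \<odot>\<^bsub>F\<^esub> f \<one>\<^bsub>R\<^esub>"
        using lin_hom_smult[OF f gx, of "\<one>\<^bsub>R\<^esub>"] fg[OF x] gx by simp
    qed
    fix N :: "('r, 'm) module" and m assume N: "left_module R N" and m: "m \<in> carrier N"
    show "\<exists>h \<in> lin_hom R F N. h (f \<one>\<^bsub>R\<^esub>) = m"
    proof
      have "(\<lambda>r. r \<odot>\<^bsub>N\<^esub> m) \<in> lin_hom R ?M N"
        using m by (intro lin_homI)
          (simp_all add: left_module.smult_closed[OF N] left_module.smult_l_distr[OF N] left_module.smult_assoc1[OF N])
      then show "(\<lambda>x. g x \<odot>\<^bsub>N\<^esub> m) \<in> lin_hom R F N" by (rule lin_hom_comp[OF g])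
      show "g (f \<one>\<^bsub>R\<^esub>) \<odot>\<^bsub>N\<^esub> m = m" using gf m left_module.smult_one[OF N] by simp
    qed
  qed
qed

text \<open>The failure of the sections \<open>s\<close> to commute with boundaries is a chain map
  into \<open>shift (- 1) Y\<close>; a null homotopy \<open>t\<close> of it corrects
  \<open>s\<close> to the chain map \<open>s + i t\<close>.\<close>

lemma degreewise_split_section:
  assumes ext: "ch_extension R Y i E p C"
    and s: "\<And>n. s n \<in> lin_hom R (obj C n) (obj E n)" "\<And>n a. a \<in> carrier (obj C n) \<Longrightarrow> p n (s n a) = a"
    and null: "\<And>f. f \<in> chain_map R C (shift (- 1) Y) \<Longrightarrow> null_homotopic R C (shift (- 1) Y) f"
  obtains s' where "s' \<in> chain_map R C E" "\<And>n a. a \<in> carrier (obj C n) \<Longrightarrow> p n (s' n a) = a"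
proof -
  interpret X: ch_extension R Y i E p C by fact
  note Y = X.B and E = X.E and C = X.A
  note ic = chain_map_closed[OF X.i] and sc = lin_hom_closed[OF s(1)]
  note ilin = lin_hom_add[OF chain_map_hom[OF X.i]]
  have "\<exists>r. r \<in> lin_hom R (obj E n) (obj Y n) \<and>
    (\<forall>e \<in> carrier (obj E n). i n (r e) \<oplus>\<^bsub>obj E n\<^esub> s n (p n e) = e)" for n
    by (rule retraction_of_section[OF X.se Ch_module[OF Y] Ch_module[OF E] Ch_module[OF C] s(1)], erule s(2)) blast
  then obtain r where r: "\<And>n. r n \<in> lin_hom R (obj E n) (obj Y n)"
    "\<And>n e. e \<in> carrier (obj E n) \<Longrightarrow> i n (r n e) \<oplus>\<^bsub>obj E n\<^esub> s n (p n e) = e" by metis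
  \<comment> \<open>By \<open>bds\<close> the boundary of \<open>s a\<close> has
    \<open>s (bd a)\<close> as its part along \<open>s\<close>, and \<open>h a\<close> is the
    remaining component in \<open>Y\<close>.\<close>
  define h where "h n a = r (n - 1) (bd E n (s n a))" for n a
  have h: "h n \<in> lin_hom R (obj C n) (obj Y (n - 1))" for n
    unfolding h_def by (rule lin_hom_comp[OF lin_hom_comp[OF s(1) Ch_bd[OF E]] r(1)])
  note hc = lin_hom_closed[OF h]
  have bds: "bd E n (s n a) = i (n - 1) (h n a) \<oplus>\<^bsub>obj E (n - 1)\<^esub> s (n - 1) (bd C n a)"
    if a: "a \<in> carrier (obj C n)" for n a
    using r(2)[OF Ch_bd_closed[OF E sc[OF a]]] chain_map_bd[OF X.p sc[OF a]] s(2)[OF a] by (simp add: h_def)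
  have anti: "bd Y (n - 1) (h n a) \<oplus>\<^bsub>obj Y (n - 2)\<^esub> h (n - 1) (bd C n a) = \<zero>\<^bsub>obj Y (n - 2)\<^esub>"
    if a: "a \<in> carrier (obj C n)" for n a
  proof -
    interpret E2: abelian_group "obj E (n - 2)" by (rule Ch_group[OF E])
    interpret Y2: abelian_group "obj Y (n - 2)" by (rule Ch_group[OF Y])
    note da = Ch_bd_closed[OF C a]
    have c: "bd Y (n - 1) (h n a) \<in> carrier (obj Y (n - 2))" "h (n - 1) (bd C n a) \<in> carrier (obj Y (n - 2))"
      using Ch_bd_closed[OF Y hc[OF a]] hc[OF da] by simp_all
    \<comment> \<open>The boundary of \<open>bds\<close> vanishes. Its term along \<open>s\<close>
      drops out because \<open>bd (bd a) = 0\<close>, and injectivity of \<open>i\<close> leaves the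
      anticommutation of \<open>h\<close>.\<close>
    have "bd E (n - 1) (s (n - 1) (bd C n a)) = i (n - 2) (h (n - 1) (bd C n a))"
      using bds[OF da] Ch_bd_bd[OF C a] lin_hom_zero[OF s(1) Ch_group[OF C] Ch_group[OF E], of "n - 2"] ic[OF c(2)] by simp
    then have "bd E (n - 1) (bd E n (s n a)) = i (n - 2) (bd Y (n - 1) (h n a)) \<oplus>\<^bsub>obj E (n - 2)\<^esub> i (n - 2) (h (n - 1) (bd C n a))"
      using bds[OF a] lin_hom_add[OF Ch_bd[OF E] ic[OF hc[OF a]] sc[OF da]] chain_map_bd[OF X.i hc[OF a]] by simp
    then have "i (n - 2) (bd Y (n - 1) (h n a) \<oplus>\<^bsub>obj Y (n - 2)\<^esub> h (n - 1) (bd C n a)) = i (n - 2) \<zero>\<^bsub>obj Y (n - 2)\<^esub>"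
      using Ch_bd_bd[OF E sc[OF a]] ilin[OF c] chain_map_zero[OF X.i Y E] by simp
    then show ?thesis using X.D(3) c by blast
  qed
  have "h \<in> chain_map R C (shift (- 1) Y)"
  proof (rule chain_mapI)
    show "h n \<in> lin_hom R (obj C n) (obj (shift (- 1) Y) n)" for n using h by simp
    show "bd (shift (- 1) Y) n (h n a) = h (n - 1) (bd C n a)" if a: "a \<in> carrier (obj C n)" for n a
    proof -
      interpret Y2: abelian_group "obj Y (n - 2)" by (rule Ch_group[OF Y])
      have c: "bd Y (n - 1) (h n a) \<in> carrier (obj Y (n - 2))" "h (n - 1) (bd C n a) \<in> carrier (obj Y (n - 2))"
        using Ch_bd_closed[OF Y hc[OF a]] hc[OF Ch_bd_closed[OF C a]] by simp_all
      then have "\<ominus>\<^bsub>obj Y (n - 2)\<^esub> bd Y (n - 1) (h n a) = h (n - 1) (bd C n a)"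
        using anti[OF a] Y2.a_comm by (intro Y2.minus_equality) simp_all
      then show ?thesis by simp
    qed
  qed
  \<comment> \<open>A homotopy raises degree by one and the shift lowers it again, so
    \<open>t n\<close> maps into \<open>obj Y n\<close>. The sign in the shift gives
    \<open>h + bd t = t bd\<close>, the identity that makes \<open>s + i t\<close> a chain
    map.\<close>
  from null[OF this] obtain t where t: "\<And>n. t n \<in> lin_hom R (obj C n) (obj Y n)"
    and ht: "\<And>n a. a \<in> carrier (obj C n) \<Longrightarrow>
      h n a = (\<ominus>\<^bsub>obj Y (n - 1)\<^esub> bd Y n (t n a)) \<oplus>\<^bsub>obj Y (n - 1)\<^esub> t (n - 1) (bd C n a)"
    unfolding null_homotopic_def by auto
  note tc = lin_hom_closed[OF t]
  have hbt: "h n a \<oplus>\<^bsub>obj Y (n - 1)\<^esub> bd Y n (t n a) = t (n - 1) (bd C n a)" if a: "a \<in> carrier (obj C n)" for n a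
  proof -
    interpret Y1: abelian_group "obj Y (n - 1)" by (rule Ch_group[OF Y])
    note c = Ch_bd_closed[OF Y tc[OF a]] tc[OF Ch_bd_closed[OF C a]]
    have "h n a \<oplus>\<^bsub>obj Y (n - 1)\<^esub> bd Y n (t n a) = bd Y n (t n a) \<oplus>\<^bsub>obj Y (n - 1)\<^esub> h n a"
      by (rule Y1.a_comm[OF hc[OF a] c(1)])
    then show ?thesis using c unfolding ht[OF a] by (simp add: Y1.r_neg2)
  qed
  show thesis
  proof (rule that)
    show "(\<lambda>n a. s n a \<oplus>\<^bsub>obj E n\<^esub> i n (t n a)) \<in> chain_map R C E"
    proof (rule chain_mapI)
      show "(\<lambda>a. s n a \<oplus>\<^bsub>obj E n\<^esub> i n (t n a)) \<in> lin_hom R (obj C n) (obj E n)" for n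
        by (rule lin_hom_sum[OF Ch_module[OF E] s(1) lin_hom_comp[OF t chain_map_hom[OF X.i]]])
      fix n a assume a: "a \<in> carrier (obj C n)"
      interpret E1: abelian_group "obj E (n - 1)" by (rule Ch_group[OF E])
      note da = Ch_bd_closed[OF C a] and dt = Ch_bd_closed[OF Y tc[OF a]]
      have "bd E n (s n a \<oplus>\<^bsub>obj E n\<^esub> i n (t n a)) =
          (i (n - 1) (h n a) \<oplus>\<^bsub>obj E (n - 1)\<^esub> s (n - 1) (bd C n a)) \<oplus>\<^bsub>obj E (n - 1)\<^esub> i (n - 1) (bd Y n (t n a))"
        using lin_hom_add[OF Ch_bd[OF E] sc[OF a] ic[OF tc[OF a]]] bds[OF a] chain_map_bd[OF X.i tc[OF a]] by simp
      also have "\<dots> = s (n - 1) (bd C n a) \<oplus>\<^bsub>obj E (n - 1)\<^esub> i (n - 1) (h n a \<oplus>\<^bsub>obj Y (n - 1)\<^esub> bd Y n (t n a))"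
        using ilin[OF hc[OF a] dt] ic[OF hc[OF a]] ic[OF dt] sc[OF da] by (simp add: E1.a_ac)
      finally show "bd E n (s n a \<oplus>\<^bsub>obj E n\<^esub> i n (t n a)) =
          s (n - 1) (bd C n a) \<oplus>\<^bsub>obj E (n - 1)\<^esub> i (n - 1) (t (n - 1) (bd C n a))"
        unfolding hbt[OF a] .
    qed
    show "p n (s n a \<oplus>\<^bsub>obj E n\<^esub> i n (t n a)) = a" if a: "a \<in> carrier (obj C n)" for n a
      using lin_hom_add[OF chain_map_hom[OF X.p] sc[OF a] ic[OF tc[OF a]]] s(2)[OF a] X.D(4)[OF tc[OF a]]
        abelian_monoid.r_zero[OF abelian_group.axioms(1)[OF Ch_group[OF C]] a] by simp
  qed
qed

locale two_cotorsion_pairs =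
  fixes R :: "('r, 'e) ring_scheme" and S :: "'m set set" and \<U> \<V> \<X> \<Y> :: "('r, 'm) module set"
  assumes R: "ring R" and U: "module_universe R S"
    and UV: "cotorsion_pair (RMod R S) (Ext1_Mod R S) \<U> \<V>"
    and XY: "cotorsion_pair (RMod R S) (Ext1_Mod R S) \<X> \<Y>"
    and sub: "\<U> \<subseteq> \<X>"
begin

abbreviation tilde where "tilde \<equiv> exact_tilde R S \<Y> \<V>"
abbreviation perp where "perp \<equiv> left_perp (Ch R S) (Ext1_Ch R S) tilde"

lemma RMod_classes: "\<U> \<subseteq> RMod R S" "\<V> \<subseteq> RMod R S" "\<X> \<subseteq> RMod R S" "\<Y> \<subseteq> RMod R S"
  using UV XY unfolding cotorsion_pair_def by blast+

text \<open>A disk on a module of \<open>\<Y>\<close> has that module as a cycle module, so this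
  inclusion admits the disk to \<open>tilde\<close>.\<close>

lemma Y_subset_V: "\<Y> \<subseteq> \<V>"
  using cotorsion_pair_subset_iff[OF UV XY] sub by blast

lemma left_classI:
  assumes c: "cotorsion_pair (RMod R S) (Ext1_Mod R S) \<A> \<B>" and A: "A \<in> RMod R S"
    and "\<And>B E i p. \<lbrakk>B \<in> \<B>; E \<in> RMod R S; short_exact R B i E p A\<rbrakk> \<Longrightarrow>
      \<exists>s \<in> lin_hom R A E. \<forall>a \<in> carrier A. p (s a) = a"
  shows "A \<in> \<A>"
proof -
  have "A \<in> left_perp (RMod R S) (Ext1_Mod R S) \<B>"
    unfolding left_perp_def
  proof (intro CollectI conjI ballI A)
    fix B assume B: "B \<in> \<B>"
    then have "B \<in> RMod R S" using c unfolding cotorsion_pair_def by blast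
    then show "is_singleton (Ext1_Mod R S A B)"
      unfolding Ext1_Mod_singleton_iff[OF U A \<open>B \<in> RMod R S\<close>] using assms(3)[OF B] by blast
  qed
  then show ?thesis using c unfolding cotorsion_pair_def by blast
qed

lemma right_classI:
  assumes c: "cotorsion_pair (RMod R S) (Ext1_Mod R S) \<A> \<B>" and B: "B \<in> RMod R S"
    and "\<And>A E i p. \<lbrakk>A \<in> \<A>; E \<in> RMod R S; short_exact R B i E p A\<rbrakk> \<Longrightarrow>
      \<exists>s \<in> lin_hom R A E. \<forall>a \<in> carrier A. p (s a) = a"
  shows "B \<in> \<B>"
proof -
  have "B \<in> right_perp (RMod R S) (Ext1_Mod R S) \<A>"
    unfolding right_perp_def
  proof (intro CollectI conjI ballI B)
    fix A assume A: "A \<in> \<A>"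
    then have "A \<in> RMod R S" using c unfolding cotorsion_pair_def by blast
    then show "is_singleton (Ext1_Mod R S A B)"
      unfolding Ext1_Mod_singleton_iff[OF U \<open>A \<in> RMod R S\<close> B] using assms(3)[OF A] by blast
  qed
  then show ?thesis using c unfolding cotorsion_pair_def by blast
qed

lemma cotorsion_split:
  assumes c: "cotorsion_pair (RMod R S) (Ext1_Mod R S) \<A> \<B>" and A: "A \<in> \<A>" and B: "B \<in> \<B>"
    and E: "E \<in> RMod R S" "short_exact R B i E p A"
  obtains s where "s \<in> lin_hom R A E" "\<And>a. a \<in> carrier A \<Longrightarrow> p (s a) = a"
proof -
  have "A \<in> RMod R S" "B \<in> RMod R S" using c A B unfolding cotorsion_pair_def by blast+
  moreover have "A \<in> left_perp (RMod R S) (Ext1_Mod R S) \<B>" using c A unfolding cotorsion_pair_def by blast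
  then have "is_singleton (Ext1_Mod R S A B)" using B by (simp add: left_perp_def)
  ultimately have "\<exists>s \<in> lin_hom R A E. \<forall>a \<in> carrier A. p (s a) = a"
    using E Ext1_Mod_singleton_iff[OF U] by blast
  then show thesis using that by blast
qed

text \<open>Needed for every \<open>M\<close>: the zero terms and zero cycles of a disk are zero
  submodules of the module on which the disk is built.\<close>

lemma zero_in_right_class:
  assumes c: "cotorsion_pair (RMod R S) (Ext1_Mod R S) \<A> \<B>" and M: "M \<in> RMod R S"
  shows "M\<lparr>carrier := {\<zero>\<^bsub>M\<^esub>}\<rparr> \<in> \<B>"
proof (rule right_classI[OF c])
  note Mm = RMod_module[OF M]
  show "M\<lparr>carrier := {\<zero>\<^bsub>M\<^esub>}\<rparr> \<in> RMod R S"
    using RMod_submodule[OF U M zero_submodule[OF Mm]] abelian_groupE(2)[OF left_module_group[OF Mm]] by simp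
  show "\<exists>s \<in> lin_hom R A E. \<forall>a \<in> carrier A. p (s a) = a"
    if "A \<in> \<A>" "E \<in> RMod R S" "short_exact R (M\<lparr>carrier := {\<zero>\<^bsub>M\<^esub>}\<rparr>) i E p A" for A E i p
  proof (rule section_to_zero_kernel[OF U _ Mm RMod_module[OF that(2)] that(3)])
    show "A \<in> RMod R S" using that(1) c unfolding cotorsion_pair_def by blast
  qed
qed

section \<open>Disks and spheres in the left orthogonal\<close>

lemma tildeD:
  assumes "Y \<in> tilde"
  shows "Y \<in> Ch R S" "obj Y n \<in> \<Y>" "cycle_module Y n \<in> \<V>"
    "\<lbrakk>x \<in> carrier (obj Y n); bd Y n x = \<zero>\<^bsub>obj Y (n - 1)\<^esub>\<rbrakk> \<Longrightarrow> \<exists>y \<in> carrier (obj Y (n + 1)). bd Y (n + 1) y = x"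
  using assms exact_complex_iff[of Y R S] by (auto simp: exact_tilde_def)

lemma perpI:
  assumes A: "A \<in> Ch R S"
    and "\<And>Y E i p. \<lbrakk>Y \<in> tilde; E \<in> Ch R S; ch_extension R Y i E p A\<rbrakk> \<Longrightarrow>
      \<exists>s \<in> chain_map R A E. \<forall>n. \<forall>a \<in> carrier (obj A n). p n (s n a) = a"
  shows "A \<in> perp"
  unfolding left_perp_def
proof (intro CollectI conjI ballI)
  fix Y assume Y: "Y \<in> tilde"
  show "is_singleton (Ext1_Ch R S A Y)"
    unfolding Ext1_Ch_singleton_iff[OF U A tildeD(1)[OF Y]]
  proof (intro allI impI)
    fix E i p assume E: "E \<in> Ch R S" "ch_extension R Y i E p A"
    show "Ex (ch_extension.section_map R E p A)"
      using assms(2)[OF Y E] by (auto simp: ch_extension.section_map_def[OF E(2)])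
  qed
qed (rule A)

text \<open>Only the sequence in degree \<open>n\<close> has to be split. The section there extends
  to the disk by \<open>disk_map\<close>, and in degree \<open>n - 1\<close> it remains a section
  because \<open>p\<close> commutes with boundaries.\<close>

lemma disk_in_perp:
  assumes X: "X \<in> \<X>"
  shows "conc {n, n - 1} {n} X \<in> perp"
proof (rule perpI)
  note XR = subsetD[OF RMod_classes(3) X]
  show "conc {n, n - 1} {n} X \<in> Ch R S" by (rule conc_Ch[OF U XR]) auto
  fix Y E i p assume Y: "Y \<in> tilde" and E: "E \<in> Ch R S"
    and ext: "ch_extension R Y i E p (conc {n, n - 1} {n} X)"
  interpret X: ch_extension R Y i E p "conc {n, n - 1} {n} X" by fact
  have "short_exact R (obj Y n) (i n) (obj E n) (p n) X" using X.se[of n] by simp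
  then obtain s where s: "s \<in> lin_hom R X (obj E n)" "\<And>a. a \<in> carrier X \<Longrightarrow> p n (s a) = a"
    by (rule cotorsion_split[OF XY X tildeD(2)[OF Y] Ch_obj[OF E]]) (rule that)
  let ?s = "\<lambda>k x. if k = n then s x else if k = n - 1 then bd E n (s x) else \<zero>\<^bsub>obj E k\<^esub>"
  show "\<exists>s \<in> chain_map R (conc {n, n - 1} {n} X) E.
      \<forall>k. \<forall>a \<in> carrier (obj (conc {n, n - 1} {n} X) k). p k (s k a) = a"
  proof (rule bexI[of _ ?s], intro allI ballI)
    show "?s \<in> chain_map R (conc {n, n - 1} {n} X) E"
      by (rule disk_map[OF X.E RMod_module[OF XR] s(1)])
    fix k a assume a: "a \<in> carrier (obj (conc {n, n - 1} {n} X) k)"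
    consider "k = n" | "k = n - 1" | "k \<noteq> n" "k \<noteq> n - 1" by blast
    then show "p k (?s k a) = a"
    proof cases
      case 2
      then have "a \<in> carrier X" using a by simp
      then show ?thesis using 2 s chain_map_bd[OF X.p, of "s a" n] lin_hom_closed[OF s(1)] by simp
    qed (use a s(2) chain_map_zero[OF X.p X.E X.A] in auto)
  qed
qed

text \<open>Exactness of \<open>Y\<close> makes \<open>Z\<^sub>nE \<rightarrow> U\<close> surjective for an extension \<open>E\<close> of the sphere on \<open>U\<close>
  by \<open>Y\<close>; a section of it is a chain map.\<close>

lemma sphere_in_perp:
  assumes M: "M \<in> \<U>"
  shows "conc {n} {} M \<in> perp"
proof (rule perpI)
  note MR = subsetD[OF RMod_classes(1) M]
  show "conc {n} {} M \<in> Ch R S" by (rule conc_Ch[OF U MR]) auto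
  fix Y E i p assume Y: "Y \<in> tilde" and E: "E \<in> Ch R S" and ext: "ch_extension R Y i E p (conc {n} {} M)"
  interpret X: ch_extension R Y i E p "conc {n} {} M" by fact
  have se: "short_exact R (obj Y n) (i n) (obj E n) (p n) M" using X.se[of n] by simp
  note D = short_exactD[OF se]
  have ZE: "left_module R (cycle_module E n)" by (rule cycle_module[OF E])
  have "short_exact R (cycle_module Y n) (i n) (cycle_module E n) (p n) M"
  proof (rule short_exactI)
    have "i n \<in> lin_hom R (cycle_module Y n) (obj E n)"
      unfolding cycle_module_def by (rule lin_hom_restrict[OF D(1)]) (auto simp: a_kernel_iff)
    moreover have "i n y \<in> a_kernel (obj E n) (obj E (n - 1)) (bd E n)" if "y \<in> carrier (cycle_module Y n)" for y
      using that chain_map_bd[OF X.i, of y n] chain_map_zero[OF X.i X.B X.E] lin_hom_closed[OF D(1)]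
      by (simp add: a_kernel_iff cycle_carrier)
    ultimately show "i n \<in> lin_hom R (cycle_module Y n) (cycle_module E n)"
      unfolding cycle_module_def[of E] by (rule lin_hom_corestrict)
    show "p n \<in> lin_hom R (cycle_module E n) M"
      unfolding cycle_module_def by (rule lin_hom_restrict[OF D(2)]) (auto simp: a_kernel_iff)
    show "\<exists>b \<in> carrier (cycle_module Y n). e = i n b"
      if e: "e \<in> carrier (cycle_module E n)" "p n e = \<zero>\<^bsub>M\<^esub>" for e
    proof -
      obtain b where b: "b \<in> carrier (obj Y n)" "e = i n b" using D(5)[of e] e by (auto simp: cycle_carrier)
      have "i (n - 1) (bd Y n b) = i (n - 1) \<zero>\<^bsub>obj Y (n - 1)\<^esub>"
        using e(1) b chain_map_bd[OF X.i b(1)] chain_map_zero[OF X.i X.B X.E] by (simp add: cycle_carrier)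
      then have "bd Y n b = \<zero>\<^bsub>obj Y (n - 1)\<^esub>"
        using X.D(3) Ch_bd_closed[OF X.B b(1)] abelian_groupE(2)[OF Ch_group[OF X.B]] by blast
      then show ?thesis using b by (auto simp: cycle_carrier)
    qed
    show "\<exists>e \<in> carrier (cycle_module E n). p n e = a" if a: "a \<in> carrier M" for a
    proof -
      interpret E: abelian_group "obj E n" by (rule Ch_group[OF E])
      interpret E1: abelian_group "obj E (n - 1)" by (rule Ch_group[OF E])
      interpret M: abelian_group M by (rule left_module_group[OF RMod_module[OF MR]])
      obtain e where e: "e \<in> carrier (obj E n)" "p n e = a" using D(6)[OF a] by blast
      have de: "bd E n e \<in> carrier (obj E (n - 1))" by (rule Ch_bd_closed[OF E e(1)])
      \<comment> \<open>The sphere has zero boundary, so \<open>bd e = i z\<close>, and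
        \<open>z\<close> is a cycle because \<open>i\<close> is injective. Exactness gives
        \<open>z = bd y\<close>, so \<open>e - i y\<close> is a cycle over the same
        \<open>a\<close>.\<close>
      have "p (n - 1) (bd E n e) = \<zero>\<^bsub>obj (conc {n} {} M) (n - 1)\<^esub>"
        using chain_map_bd[OF X.p e(1)] by simp
      then obtain z where z: "z \<in> carrier (obj Y (n - 1))" "bd E n e = i (n - 1) z"
        using X.D(5)[OF de] by blast
      have "i (n - 2) (bd Y (n - 1) z) = i (n - 2) \<zero>\<^bsub>obj Y (n - 2)\<^esub>"
        using chain_map_bd[OF X.i z(1)] z(2) Ch_bd_bd[OF E e(1)] chain_map_zero[OF X.i X.B X.E] by simp
      then have "bd Y (n - 1) z = \<zero>\<^bsub>obj Y (n - 2)\<^esub>"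
        using X.D(3)[of _ "n - 2"] Ch_bd_closed[OF X.B z(1)] abelian_groupE(2)[OF Ch_group[OF X.B]] by simp
      then obtain y where y: "y \<in> carrier (obj Y n)" "bd Y n y = z" using tildeD(4)[OF Y z(1)] by auto
      have iy: "i n y \<in> carrier (obj E n)" by (rule lin_hom_closed[OF D(1) y(1)])
      have "bd E n (e \<ominus>\<^bsub>obj E n\<^esub> i n y) = \<zero>\<^bsub>obj E (n - 1)\<^esub>"
        using lin_hom_diff[OF Ch_bd[OF E] E.abelian_group_axioms E1.abelian_group_axioms e(1) iy]
          chain_map_bd[OF X.i y(1)] y z de by (simp add: E1.minus_eq E1.r_neg)
      moreover have "p n (e \<ominus>\<^bsub>obj E n\<^esub> i n y) = a"
        using lin_hom_diff[OF D(2) E.abelian_group_axioms M.abelian_group_axioms e(1) iy] D(4)[OF y(1)] e a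
        by (simp add: M.minus_eq M.add.inv_one)
      ultimately show ?thesis
        using e iy E.minus_closed by (intro bexI[of _ "e \<ominus>\<^bsub>obj E n\<^esub> i n y"]) (simp_all add: cycle_carrier)
    qed
  qed (use D(3,4) in \<open>auto simp: cycle_carrier\<close>)
  then obtain s where s: "s \<in> lin_hom R M (cycle_module E n)" "\<And>a. a \<in> carrier M \<Longrightarrow> p n (s a) = a"
    by (rule cotorsion_split[OF UV M tildeD(3)[OF Y] cycle_RMod[OF U E]]) (rule that)
  have sE: "s \<in> lin_hom R M (obj E n)"
    using s(1) unfolding cycle_module_def by (rule lin_hom_range) (auto simp: a_kernel_iff)
  have z: "bd E n (s x) = \<zero>\<^bsub>obj E (n - 1)\<^esub>" if "x \<in> carrier M" for x
    using lin_hom_closed[OF s(1) that] by (simp add: cycle_carrier)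
  let ?s = "\<lambda>k x. if k = n then s x else \<zero>\<^bsub>obj E k\<^esub>"
  show "\<exists>s \<in> chain_map R (conc {n} {} M) E. \<forall>k. \<forall>a \<in> carrier (obj (conc {n} {} M) k). p k (s k a) = a"
  proof (rule bexI[of _ ?s], intro allI ballI)
    show "?s \<in> chain_map R (conc {n} {} M) E"
      by (rule sphere_map[OF X.E RMod_module[OF MR] sE z])
    show "p k (?s k a) = a" if "a \<in> carrier (obj (conc {n} {} M) k)" for k a
      using that s(2) chain_map_zero[OF X.p X.E X.A] by (cases "k = n") auto
  qed
qed

section \<open>Terms of complexes in the left orthogonal, and null homotopy\<close>

lemma perp_singleton: "\<lbrakk>A \<in> perp; Y \<in> tilde\<rbrakk> \<Longrightarrow> is_singleton (Ext1_Ch R S A Y)"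
  by (simp add: left_perp_def)

lemma perp_Ch: "A \<in> perp \<Longrightarrow> A \<in> Ch R S"
  by (simp add: left_perp_def)

lemma disk_in_tilde:
  assumes Y: "Y \<in> \<Y>"
  shows "conc {n, n - 1} {n} Y \<in> tilde"
proof -
  note YR = subsetD[OF RMod_classes(4) Y]
  have C: "conc {n, n - 1} {n} Y \<in> Ch R S" by (rule conc_Ch[OF U YR]) auto
  note Z = zero_in_right_class[OF XY YR] zero_in_right_class[OF UV YR]
  have "exact_complex (conc {n, n - 1} {n} Y)"
    unfolding exact_complex_iff[OF C]
  proof (intro allI ballI impI)
    fix k x assume x: "x \<in> carrier (obj (conc {n, n - 1} {n} Y) k)"
      "bd (conc {n, n - 1} {n} Y) k x = \<zero>\<^bsub>obj (conc {n, n - 1} {n} Y) (k - 1)\<^esub>"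
    show "\<exists>y \<in> carrier (obj (conc {n, n - 1} {n} Y) (k + 1)). bd (conc {n, n - 1} {n} Y) (k + 1) y = x"
    \<comment> \<open>In degree \<open>n\<close> the boundary is the identity, so nonzero cycles
      occur at most in degree \<open>n - 1\<close>, where each is its own preimage.\<close>
    proof (cases "k = n - 1")
      case True
      then show ?thesis using x by (intro bexI[of _ x]) simp_all
    next
      case False
      then have "x = \<zero>\<^bsub>Y\<^esub>" using x by (cases "k = n") simp_all
      then show ?thesis
        using False abelian_groupE(2)[OF Ch_group[OF C, of "k + 1"]] Ch_bd_zero[OF C, of "k + 1"]
        by (intro bexI[of _ "\<zero>\<^bsub>Y\<^esub>"]) simp_all
    qed
  qed
  moreover have "obj (conc {n, n - 1} {n} Y) k \<in> \<Y>" for k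
    using Y Z by (cases "k \<in> {n, n - 1}") simp_all
  moreover have "cycle_module (conc {n, n - 1} {n} Y) k \<in> \<V>" for k
    using Y Y_subset_V Z unfolding cycle_conc[OF RMod_module[OF YR]] by auto
  ultimately show ?thesis using C by (simp add: exact_tilde_def)
qed

text \<open>An extension of \<open>A_n\<close> by \<open>Y\<close> becomes an extension of disks.
  The chain map from \<open>A\<close> to the disk on \<open>A_n\<close> that is the identity in
  degree \<open>n\<close> lifts to the disk on \<open>E\<close>, and its component in degree
  \<open>n\<close> is a section.\<close>

lemma perp_obj:
  assumes A: "A \<in> perp"
  shows "obj A n \<in> \<X>"
proof (rule left_classI[OF XY Ch_obj[OF perp_Ch[OF A]]])
  note AC = perp_Ch[OF A]
  fix Y E i p assume Y: "Y \<in> \<Y>" and E: "E \<in> RMod R S" and se: "short_exact R Y i E p (obj A n)"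
  \<comment> \<open>\<open>disk_comap\<close> starts from the bottom degree of the disk. That degree
    has to be \<open>n\<close>, hence the top is \<open>n + 1\<close>.\<close>
  let ?D = "conc {n + 1, n + 1 - 1} {n + 1} :: ('r, 'm) module \<Rightarrow> _"
  note YT = disk_in_tilde[OF Y, of "n + 1"]
  have ext: "ch_extension R (?D Y) (\<lambda>k. i) (?D E) (\<lambda>k. p) (?D (obj A n))"
    by (rule conc_extension[OF se])
      (use Y RMod_classes(4) E in \<open>auto intro: RMod_module Ch_module[OF AC]\<close>)
  have "(\<lambda>x. x) \<in> lin_hom R (obj A (n + 1 - 1)) (obj A n)" by (simp add: lin_hom_id)
  then have f: "(\<lambda>k x. if k = n + 1 - 1 then x else if k = n + 1 then bd A (n + 1) x else \<zero>\<^bsub>obj A n\<^esub>)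
      \<in> chain_map R A (?D (obj A n))"
    by (rule disk_comap[OF Ch_UNIV[OF AC] Ch_module[OF AC]])
  obtain g where g: "g \<in> chain_map R A (?D E)" "\<And>k a. a \<in> carrier (obj A k) \<Longrightarrow>
      p (g k a) = (if k = n + 1 - 1 then a else if k = n + 1 then bd A (n + 1) a else \<zero>\<^bsub>obj A n\<^esub>)"
    by (rule chain_map_lift[OF U AC tildeD(1)[OF YT] perp_singleton[OF A YT] ext f]) (rule that)
  show "\<exists>s \<in> lin_hom R (obj A n) E. \<forall>a \<in> carrier (obj A n). p (s a) = a"
    using chain_map_hom[OF g(1), of n] g(2)[of _ n] by (intro bexI[of _ "g n"]) simp_all
qed

text \<open>Since \<open>obj Y n\<close> is the term of \<open>shift 1 Y\<close> in degree
  \<open>n - 1\<close>, \<open>f\<close> can serve as twisting family; the sign of the shift makes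
  it anticommute. Splitting the twisted sum gives \<open>- bd t + f = t bd\<close>, so
  \<open>t\<close> is a null homotopy.\<close>

lemma perp_null_homotopic:
  assumes A: "A \<in> perp" and Y: "Y \<in> tilde" and f: "f \<in> chain_map R A Y"
  shows "null_homotopic R A Y f"
proof -
  note AC = perp_Ch[OF A] and YC = tildeD(1)[OF Y] and T = shift_tilde[OF Y, of 1]
  note fc = chain_map_closed[OF f]
  have h: "f n \<in> lin_hom R (obj A n) (obj (shift 1 Y) (n - 1))" for n using chain_map_hom[OF f] by simp
  have anti: "bd (shift 1 Y) (n - 1) (f n a) \<oplus>\<^bsub>obj (shift 1 Y) (n - 2)\<^esub> f (n - 1) (bd A n a) =
      \<zero>\<^bsub>obj (shift 1 Y) (n - 2)\<^esub>" if a: "a \<in> carrier (obj A n)" for n a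
  proof -
    interpret Y1: abelian_group "obj Y (n - 1)" by (rule Ch_group[OF YC])
    show ?thesis
      using chain_map_bd[OF f a] Ch_bd_closed[OF YC fc[OF a]] by (simp add: Y1.l_neg)
  qed
  obtain t where t: "\<And>n. t n \<in> lin_hom R (obj A n) (obj (shift 1 Y) n)"
    and ht: "\<And>n a. a \<in> carrier (obj A n) \<Longrightarrow>
      bd (shift 1 Y) n (t n a) \<oplus>\<^bsub>obj (shift 1 Y) (n - 1)\<^esub> f n a = t (n - 1) (bd A n a)"
    by (rule twist_homotopy[OF U AC tildeD(1)[OF T] perp_singleton[OF A T] h anti], assumption, rule that)
  have "f n a = bd Y (n + 1) (t n a) \<oplus>\<^bsub>obj Y n\<^esub> t (n - 1) (bd A n a)" if a: "a \<in> carrier (obj A n)" for n a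
  proof -
    interpret Y1: abelian_group "obj Y n" by (rule Ch_group[OF YC])
    have c: "bd Y (n + 1) (t n a) \<in> carrier (obj Y n)" "f n a \<in> carrier (obj Y n)"
      using Ch_bd_closed[OF YC, of "t n a" "n + 1"] lin_hom_closed[OF t a] fc[OF a] by simp_all
    have "t (n - 1) (bd A n a) = (\<ominus>\<^bsub>obj Y n\<^esub> bd Y (n + 1) (t n a)) \<oplus>\<^bsub>obj Y n\<^esub> f n a"
      using ht[OF a] by simp
    then show ?thesis using c by (simp add: Y1.r_neg2)
  qed
  then show ?thesis unfolding null_homotopic_def using t by (intro exI[of _ t]) simp
qed

text \<open>Terms in \<open>\<X>\<close> split every extension by \<open>Y\<close> degreewise. The
  obstruction to a chain section is a map into \<open>shift (- 1) Y\<close>, which is again in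
  \<open>tilde\<close>.\<close>

lemma perp_of_null_homotopic:
  assumes C: "C \<in> Ch R S" and X: "\<And>n. obj C n \<in> \<X>"
    and null: "\<And>Y f. \<lbrakk>Y \<in> tilde; f \<in> chain_map R C Y\<rbrakk> \<Longrightarrow> null_homotopic R C Y f"
  shows "C \<in> perp"
proof (rule perpI[OF C])
  fix Y E i p assume Y: "Y \<in> tilde" and E: "E \<in> Ch R S" and ext: "ch_extension R Y i E p C"
  have "\<exists>s. s \<in> lin_hom R (obj C n) (obj E n) \<and> (\<forall>a \<in> carrier (obj C n). p n (s a) = a)" for n
    by (rule cotorsion_split[OF XY X tildeD(2)[OF Y] Ch_obj[OF E] ch_extension.se[OF ext]]) blast
  then obtain s where s: "\<And>n. s n \<in> lin_hom R (obj C n) (obj E n)"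
    "\<And>n a. a \<in> carrier (obj C n) \<Longrightarrow> p n (s n a) = a" by metis
  show "\<exists>s \<in> chain_map R C E. \<forall>n. \<forall>a \<in> carrier (obj C n). p n (s n a) = a"
    by (rule degreewise_split_section[OF ext s null[OF shift_tilde[OF Y]]]) auto
qed

section \<open>The right orthogonal: exactness, terms and cycles\<close>

lemma free_in_left_class:
  assumes F: "F \<in> RMod R S" "u \<in> carrier F" "\<And>x. x \<in> carrier F \<Longrightarrow> \<exists>a \<in> carrier R. x = a \<odot>\<^bsub>F\<^esub> u"
    "\<And>(M :: ('r, 'm) module) m. \<lbrakk>left_module R M; m \<in> carrier M\<rbrakk> \<Longrightarrow> \<exists>f \<in> lin_hom R F M. f u = m"
  shows "F \<in> \<U>"
proof (rule left_classI[OF UV F(1)])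
  fix B E i p assume E: "E \<in> RMod R S" and se: "short_exact R B i E p F"
  note D = short_exactD[OF se]
  \<comment> \<open>Projectivity of \<open>F\<close>: sending \<open>u\<close> to a preimage of
    \<open>u\<close> defines a section, because every element is a multiple of
    \<open>u\<close>.\<close>
  obtain e where e: "e \<in> carrier E" "p e = u" using D(6)[OF F(2)] by blast
  obtain f where f: "f \<in> lin_hom R F E" "f u = e" using F(4)[OF RMod_module[OF E] e(1)] by blast
  have "p (f x) = x" if "x \<in> carrier F" for x
    using F(3)[OF that] e f F(2) by (auto simp: lin_hom_smult[OF f(1)] lin_hom_smult[OF D(2)])
  then show "\<exists>s \<in> lin_hom R F E. \<forall>a \<in> carrier F. p (s a) = a" using f by blast
qed

lemma right_perp_subset_tilde: "right_perp (Ch R S) (Ext1_Ch R S) perp \<subseteq> tilde"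
proof
  fix B assume B: "B \<in> right_perp (Ch R S) (Ext1_Ch R S) perp"
  then have C: "B \<in> Ch R S" and sing: "\<And>A. A \<in> perp \<Longrightarrow> is_singleton (Ext1_Ch R S A B)"
    by (auto simp: right_perp_def)
  note CU = Ch_UNIV[OF C]
  have "exact_complex B"
    unfolding exact_complex_iff[OF C]
  proof (intro allI ballI impI)
    fix m z assume z: "z \<in> carrier (obj B m)" "bd B m z = \<zero>\<^bsub>obj B (m - 1)\<^esub>"
    obtain F u where F: "F \<in> RMod R S" "u \<in> carrier F" "\<And>x. x \<in> carrier F \<Longrightarrow> \<exists>a \<in> carrier R. x = a \<odot>\<^bsub>F\<^esub> u"
      "\<And>(M :: ('r, 'm) module) m. \<lbrakk>left_module R M; m \<in> carrier M\<rbrakk> \<Longrightarrow> \<exists>f \<in> lin_hom R F M. f u = m"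
      by (rule free_module_exists[OF R U]) (rule that)
    \<comment> \<open>The cycle \<open>z\<close> gives a map from \<open>F\<close> into degree
      \<open>m\<close>. A twisting family lowers degree by one, so the sphere must sit in degree
      \<open>m + 1\<close>.\<close>
    have SP: "conc {m + 1} {} F \<in> perp" by (rule sphere_in_perp[OF free_in_left_class[OF F]])
    obtain f where f: "f \<in> lin_hom R F (obj B m)" "f u = z" using F(4)[OF Ch_module[OF C] z(1)] by blast
    have bf: "bd B m (f x) = \<zero>\<^bsub>obj B (m - 1)\<^esub>" if "x \<in> carrier F" for x
      using F(3)[OF that] f z F(2)
      by (auto simp: lin_hom_smult[OF f(1)] lin_hom_smult[OF Ch_bd[OF C]] smult_zero[OF Ch_module[OF C]])
    define h where "h k x = (if k = m + 1 then f x else \<zero>\<^bsub>obj B (k - 1)\<^esub>)" for k x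
    have h: "h k \<in> lin_hom R (obj (conc {m + 1} {} F) k) (obj B (k - 1))" for k
      using f(1) lin_hom_const_zero[OF Ch_module[OF C]] by (cases "k = m + 1") (simp_all add: h_def[abs_def])
    have h0: "h k \<zero>\<^bsub>F\<^esub> = \<zero>\<^bsub>obj B (k - 1)\<^esub>" for k
      using lin_hom_zero[OF f(1) left_module_group[OF RMod_module[OF F(1)]] Ch_group[OF C]] by (simp add: h_def)
    have anti: "bd B (k - 1) (h k x) \<oplus>\<^bsub>obj B (k - 2)\<^esub> h (k - 1) (bd (conc {m + 1} {} F) k x) = \<zero>\<^bsub>obj B (k - 2)\<^esub>"
      if x: "x \<in> carrier (obj (conc {m + 1} {} F) k)" for k x
    proof -
      have "bd B (k - 1) (h k x) = \<zero>\<^bsub>obj B (k - 2)\<^esub>"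
        using x bf Ch_bd_zero[OF C, of "k - 1"] by (cases "k = m + 1") (simp_all add: h_def)
      then show ?thesis using h0[of "k - 1"] abelian_groupE(2,5)[OF Ch_group[OF C, of "k - 2"]] by simp
    qed
    obtain t where t: "\<And>k. t k \<in> lin_hom R (obj (conc {m + 1} {} F) k) (obj B k)"
      and ht: "\<And>k a. a \<in> carrier (obj (conc {m + 1} {} F) k) \<Longrightarrow>
        bd B k (t k a) \<oplus>\<^bsub>obj B (k - 1)\<^esub> h k a = t (k - 1) (bd (conc {m + 1} {} F) k a)"
      by (rule twist_homotopy[OF U perp_Ch[OF SP] C sing[OF SP] h anti], assumption, rule that)
    interpret Bm: abelian_group "obj B m" by (rule Ch_group[OF C])
    define y where "y = t (m + 1) u"
    have y: "y \<in> carrier (obj B (m + 1))"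
      using lin_hom_closed[OF t, of u "m + 1"] F(2) by (simp add: y_def)
    have "t m \<zero>\<^bsub>F\<^esub> = \<zero>\<^bsub>obj B m\<^esub>"
      using lin_hom_zero[OF t[of m] Ch_group[OF perp_Ch[OF SP]] Ch_group[OF C]] by simp
    \<comment> \<open>The right-hand side of \<open>ht\<close> vanishes because the sphere has zero
      boundary. Hence \<open>bd y = - z\<close>, and \<open>- y\<close> is the required
      preimage.\<close>
    then have "bd B (m + 1) y \<oplus>\<^bsub>obj B m\<^esub> z = \<zero>\<^bsub>obj B m\<^esub>"
      using ht[of u "m + 1"] F(2) f(2) by (simp add: h_def y_def)
    then have "\<ominus>\<^bsub>obj B m\<^esub> z = bd B (m + 1) y"
      using Bm.minus_equality[of "bd B (m + 1) y" z] z(1) Ch_bd_closed[OF C y] by simp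
    then have "bd B (m + 1) (\<ominus>\<^bsub>obj B (m + 1)\<^esub> y) = z"
      using lin_hom_minus[OF Ch_bd[OF C] Ch_group[OF C] Ch_group[OF C] y] Bm.minus_minus[OF z(1)] by simp
    then show "\<exists>y \<in> carrier (obj B (m + 1)). bd B (m + 1) y = z"
      using abelian_group.a_inv_closed[OF Ch_group[OF C] y] by blast
  qed
  \<comment> \<open>The canonical map from the disk on \<open>B_n\<close> to \<open>B\<close> is the
    identity in degree \<open>n\<close>, so its extension \<open>g\<close> to the disk on
    \<open>E\<close> is there a retraction of \<open>i\<close>.\<close>
  moreover have "obj B n \<in> \<Y>" for n
  proof (rule right_classI[OF XY Ch_obj[OF C]])
    fix A E i p assume A: "A \<in> \<X>" and E: "E \<in> RMod R S" and se: "short_exact R (obj B n) i E p A"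
    let ?D = "conc {n, n - 1} {n} :: ('r, 'm) module \<Rightarrow> _"
    note DP = disk_in_perp[OF A, of n]
    note mod = Ch_module[OF C] RMod_module[OF E] RMod_module[OF subsetD[OF RMod_classes(3) A]]
    have ext: "ch_extension R (?D (obj B n)) (\<lambda>k. i) (?D E) (\<lambda>k. p) (?D A)"
      by (rule conc_extension[OF se mod]) auto
    obtain g where g: "g \<in> chain_map R (?D E) B" "\<And>k c. c \<in> carrier (obj (?D (obj B n)) k) \<Longrightarrow>
        g k (i c) = (if k = n then c else if k = n - 1 then bd B n c else \<zero>\<^bsub>obj B k\<^esub>)"
      by (rule chain_map_extend[OF U perp_Ch[OF DP] C sing[OF DP] ext disk_map[OF CU Ch_module[OF C] lin_hom_id]])
        (rule that)
    have r: "g n \<in> lin_hom R E (obj B n)" "\<And>b. b \<in> carrier (obj B n) \<Longrightarrow> g n (i b) = b"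
      using chain_map_hom[OF g(1), of n] g(2)[of _ n] by simp_all
    show "\<exists>s \<in> lin_hom R A E. \<forall>a \<in> carrier A. p (s a) = a"
      by (rule section_of_retraction[OF se mod r(1)], erule r(2)) blast
  qed
  \<comment> \<open>Likewise with the sphere on the cycles, whose canonical map to \<open>B\<close>
    is the inclusion in degree \<open>n\<close>.\<close>
  moreover have "cycle_module B n \<in> \<V>" for n
  proof (rule right_classI[OF UV cycle_RMod[OF U C]])
    fix A E i p assume A: "A \<in> \<U>" and E: "E \<in> RMod R S" and se: "short_exact R (cycle_module B n) i E p A"
    let ?S = "conc {n} {} :: ('r, 'm) module \<Rightarrow> _"
    note SP = sphere_in_perp[OF A, of n]
    note ZM = cycle_module[OF C, of n]
    note mod = ZM RMod_module[OF E] RMod_module[OF subsetD[OF RMod_classes(1) A]]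
    have ext: "ch_extension R (?S (cycle_module B n)) (\<lambda>k. i) (?S E) (\<lambda>k. p) (?S A)"
      by (rule conc_extension[OF se mod]) auto
    have inc: "(\<lambda>x. x) \<in> lin_hom R (cycle_module B n) (obj B n)"
      unfolding cycle_module_def by (rule lin_hom_restrict[OF lin_hom_id]) (auto simp: a_kernel_iff)
    have f: "(\<lambda>k x. if k = n then x else \<zero>\<^bsub>obj B k\<^esub>) \<in> chain_map R (?S (cycle_module B n)) B"
      by (rule sphere_map[OF CU ZM inc]) (simp add: cycle_carrier)
    obtain g where g: "g \<in> chain_map R (?S E) B" "\<And>k c. c \<in> carrier (obj (?S (cycle_module B n)) k) \<Longrightarrow>
        g k (i c) = (if k = n then c else \<zero>\<^bsub>obj B k\<^esub>)"
      by (rule chain_map_extend[OF U perp_Ch[OF SP] C sing[OF SP] ext f]) (rule that)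
    have gn: "g n \<in> lin_hom R E (obj B n)" using chain_map_hom[OF g(1), of n] by simp
    \<comment> \<open>\<open>g\<close> is a chain map out of a complex with zero boundary, so its
      values are cycles and the retraction lands in \<open>cycle_module B n\<close>.\<close>
    have "bd B n (g n x) = \<zero>\<^bsub>obj B (n - 1)\<^esub>" if x: "x \<in> carrier E" for x
      using chain_map_bd[OF g(1), of x n] chain_map_zero[OF g(1) conc_Ch_UNIV[OF RMod_module[OF E]] C, of "n - 1"] x
      by simp
    then have r: "g n \<in> lin_hom R E (cycle_module B n)"
      unfolding cycle_module_def using lin_hom_closed[OF gn]
      by (intro lin_hom_corestrict[OF gn]) (simp add: a_kernel_iff)
    have ri: "\<And>b. b \<in> carrier (cycle_module B n) \<Longrightarrow> g n (i b) = b" using g(2)[of _ n] by simp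
    show "\<exists>s \<in> lin_hom R A E. \<forall>a \<in> carrier A. p (s a) = a"
      by (rule section_of_retraction[OF se mod r], erule ri) blast
  qed
  ultimately show "B \<in> tilde" using C by (simp add: exact_tilde_def)
qed

lemma tilde_subset_right_perp: "tilde \<subseteq> right_perp (Ch R S) (Ext1_Ch R S) perp"
  using tildeD(1) perp_singleton by (auto simp: right_perp_def)

end

theorem theorem3p4:
  fixes R :: "('r, 'e) ring_scheme"
    and S :: "'m set set"
    and \<U> \<V> \<X> \<Y> :: "('r, 'm) module set"
  assumes "ring R"
    and "module_universe R S"
    and "cotorsion_pair (RMod R S) (Ext1_Mod R S) \<U> \<V>"
    and "cotorsion_pair (RMod R S) (Ext1_Mod R S) \<X> \<Y>"
    and "\<U> \<subseteq> \<X>"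
  shows "cotorsion_pair (Ch R S) (Ext1_Ch R S)
      (left_perp (Ch R S) (Ext1_Ch R S) (exact_tilde R S \<Y> \<V>)) (exact_tilde R S \<Y> \<V>)
    \<and> left_perp (Ch R S) (Ext1_Ch R S) (exact_tilde R S \<Y> \<V>) =
      {C \<in> Ch R S. (\<forall>n. obj C n \<in> \<X>) \<and>
         (\<forall>Y \<in> exact_tilde R S \<Y> \<V>. \<forall>f \<in> chain_map R C Y. null_homotopic R C Y f)}"
proof -
  interpret two_cotorsion_pairs R S \<U> \<V> \<X> \<Y>
    by (rule two_cotorsion_pairs.intro) fact+
  \<comment> \<open>One half is the definition of \<open>perp\<close>; what remains is that
    \<open>tilde\<close> equals its double orthogonal.\<close>
  have "cotorsion_pair (Ch R S) (Ext1_Ch R S) perp tilde"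
    unfolding cotorsion_pair_def
    using perp_Ch tildeD(1) right_perp_subset_tilde tilde_subset_right_perp by blast
  moreover have "perp = {C \<in> Ch R S. (\<forall>n. obj C n \<in> \<X>) \<and>
      (\<forall>Y \<in> tilde. \<forall>f \<in> chain_map R C Y. null_homotopic R C Y f)}"
  proof (intro subset_antisym subsetI)
    show "C \<in> perp" if "C \<in> {C \<in> Ch R S. (\<forall>n. obj C n \<in> \<X>) \<and>
      (\<forall>Y \<in> tilde. \<forall>f \<in> chain_map R C Y. null_homotopic R C Y f)}" for C
      using that by (intro perp_of_null_homotopic) auto
  qed (use perp_Ch perp_obj perp_null_homotopic in auto)
  ultimately show ?thesis by blast
qed

end
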